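(* Let $\alpha=(\alpha_1,\alpha_2)\in(0,\infty)^2$, $\rho\in\{-1,0,1\}$, and let $\phi:\mathbb{R}^2\setminus\{0\}\to\mathbb{R}$ be smooth and $\alpha$-mixed homogeneous of degree $\rho$. Assume that at any point $(x_1,x_2)\neq(0,0)$ where the Hessian determinant of $\phi$ vanishes, at least one of the mappings $t\mapsto\partial_1^2\phi(t,x_2)$, $t\mapsto\partial_2^2\phi(x_1,t)$ is of finite type at $t=x_1$ (resp. $t=x_2$). Let $v\in\mathbb{R}^2\setminus\{0\}$ be a point at which the Hessian determinant of $\phi$ vanishes. Then after a linear transformation of coordinates the function $\phi_v(x)=\phi(x+v)-\phi(v)-x\cdot\nabla\phi(v)$ and its Hessian determinant $\mathcal{H}_{\phi_v}$ assume precisely one of the following local normal forms at the origin: (i) $\phi_v(x)=x_2^k r(x)+\varphi(x)$, $k\ge2$, $\varphi$ is flat; and $\mathcal{H}_{\phi_v}(x)=x_2^{\tilde k+2k-2}q(x)$ with $\tilde k\ge0$, or $\mathcal{H}_{\phi_v}$ is flat; and in the case when $\mathcal{H}_{\phi_v}$ is not flat, $\varphi$ vanishes identically; (ii) $\phi_v(x)=x_1^2r_1(x_1)+x_2^kr_2(x)$, $k\ge3$; $\mathcal{H}_{\phi_v}(x)=x_2^{k-2}q(x)$; (iii) $\phi_v(x)=x_1^2r_1(x)+x_2^kr_2(x)$, $k\ge3$, where $\partial_2^jr_1(0)=c(\phi,v)\,j\,\partial_2^{j-1}r_1(0)$ for $j=1,\dots,k-1$, for some constant $c(\phi,v)\neq0$;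 $\mathcal{H}_{\phi_v}(x)=x_2^{k-2}q(x)$; (iv) $\phi_v(x)=x_1^2r_1(x_1)+(x_2-x_1^2\psi(x_1))^kr_2(x)$, $k\ge3$; $\mathcal{H}_{\phi_v}(x)=(x_2-x_1^2\psi(x_1))^{k-2}q(x)$; (v) $\phi_v(x)=x_1^2r_1(x)+(x_2-x_1^2\psi(x_1))^kr_2(x)$, $k\ge3$, where $\partial_2^jr_1(0)=c(\phi,v)\,j\,\partial_2^{j-1}r_1(0)$ for $j=1,\dots,k-1$, for some constant $c(\phi,v)\neq0$; $\mathcal{H}_{\phi_v}(x)=(x_2-x_1^2\psi(x_1))^{k-2}q(x)$; (vi) $\phi_v(x)=(x_2-x_1^2\psi(x_1))^kr(x)$, $k\ge2$; $\mathcal{H}_{\phi_v}(x)=(x_2-x_1^2\psi(x_1))^{2k-3}q(x)$. In each of the cases (i)–(vi) the appearing functions are smooth and do not vanish at the origin, i.e., $r(0),r_1(0),r_2(0),q(0),\psi(0)\neq0$ (except for the function $\varphi$, which is flat), and the root of the function $x\mapsto x_2-x_1^2\psi(x_1)$ corresponds to the homogeneity curve through $v$. If moreover the Hessian determinant $\mathcal{H}_\phi$ is not flat at any point $x\neq0$, then the function $\varphi$ in case (i) always vanishes identically and the Hessian determinant $\mathcal{H}_{\phi_v}$ is never flat. Finally, if $\alpha_1=\alpha_2$, then only the normal forms (i) and (ii) can appear.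
   Context: A function $g$ on $\mathbb{R}^2\setminus\{0\}$ is $\alpha$-mixed homogeneous of degree $\rho$ if $g(r^{\alpha_1}x_1,r^{\alpha_2}x_2)=r^{\rho}g(x_1,x_2)$ for all $r>0$. The Hessian determinant of a function $f$ of two variables is $\mathcal{H}_f=\partial_1^2f\,\partial_2^2f-(\partial_1\partial_2f)^2$. A smooth function is of finite type at a point if some partial derivative of it (of order $\ge0$) does not vanish there, and flat at the point otherwise; in the normal forms "flat" means flat at the origin. The normal forms are identities valid in a neighbourhood of the origin; $k$ and $\tilde k$ are integers; in the normal forms the linear change of coordinates has already been carried out, i.e. $\phi_v$ stands for $\phi_v\circ L$ with $L$ a suitable invertible linear map of $\mathbb{R}^2$ and $\mathcal{H}_{\phi_v}$ for the Hessian determinant of $\phi_v\circ L$. The homogeneity curve through $v=(v_1,v_2)$ is the curve $r\mapsto(r^{\alpha_1}v_1,r^{\alpha_2}v_2)$, $r>0$. That the root of $x_2-x_1^2\psi(x_1)$ corresponds to it means that, near the origin, the zero set $\{x_2=x_1^2\psi(x_1)\}$ is mapped onto the homogeneity curve near $v$ by $x\mapsto v+Lx$. *)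

theory Defs
  imports "HOL-Analysis.Analysis"
begin

text \<open>The plane is \<^typ>\<open>real \<times> real\<close>.  Partial derivatives are indexed by basis vectors, so that the
  notions below apply both to functions on the plane (\<open>Basis = {(1,0), (0,1)}\<close>) and to functions on
  the line (\<open>Basis = {1}\<close>).\<close>

definition partial_deriv :: "'a::euclidean_space \<Rightarrow> ('a \<Rightarrow> real) \<Rightarrow> 'a \<Rightarrow> real"
  where "partial_deriv b f x = frechet_derivative f (at x) b"

abbreviation partial1 :: "(real \<times> real \<Rightarrow> real) \<Rightarrow> real \<times> real \<Rightarrow> real"  ("\<partial>\<^sub>1")
  where "\<partial>\<^sub>1 \<equiv> partial_deriv (1, 0)"

abbreviation partial2 :: "(real \<times> real \<Rightarrow> real) \<Rightarrow> real \<times> real \<Rightarrow> real"  ("\<partial>\<^sub>2")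
  where "\<partial>\<^sub>2 \<equiv> partial_deriv (0, 1)"

primrec Ck_on :: "nat \<Rightarrow> 'a::euclidean_space set \<Rightarrow> ('a \<Rightarrow> real) \<Rightarrow> bool"
  where
    "Ck_on 0 S f \<longleftrightarrow> continuous_on S f"
  | "Ck_on (Suc k) S f \<longleftrightarrow>
       (\<forall>x\<in>S. f differentiable (at x)) \<and> (\<forall>b\<in>Basis. Ck_on k S (partial_deriv b f))"

text \<open>To be used for open \<open>S\<close> only: the derivatives are taken in the full space.\<close>

definition smooth_on :: "'a::euclidean_space set \<Rightarrow> ('a \<Rightarrow> real) \<Rightarrow> bool"
  where "smooth_on S f \<longleftrightarrow> (\<forall>k. Ck_on k S f)"

definition smooth_near :: "'a::euclidean_space \<Rightarrow> ('a \<Rightarrow> real) \<Rightarrow> bool"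
  where "smooth_near p f \<longleftrightarrow> (\<exists>U. open U \<and> p \<in> U \<and> smooth_on U f)"

definition smooth_nonzero_near :: "'a::euclidean_space \<Rightarrow> ('a \<Rightarrow> real) \<Rightarrow> bool"
  where "smooth_nonzero_near p f \<longleftrightarrow> smooth_near p f \<and> f p \<noteq> 0"

text \<open>The list \<open>bs\<close> of directions may be empty: derivatives of order 0 are included.\<close>

definition finite_type_at :: "('a::euclidean_space \<Rightarrow> real) \<Rightarrow> 'a \<Rightarrow> bool"
  where "finite_type_at f p \<longleftrightarrow> (\<exists>bs. set bs \<subseteq> Basis \<and> foldr partial_deriv bs f p \<noteq> 0)"

definition flat_at :: "('a::euclidean_space \<Rightarrow> real) \<Rightarrow> 'a \<Rightarrow> bool"
  where "flat_at f p \<longleftrightarrow> \<not> finite_type_at f p"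

definition mixed_homogeneous :: "real \<Rightarrow> real \<Rightarrow> real \<Rightarrow> (real \<times> real \<Rightarrow> real) \<Rightarrow> bool"
  where "mixed_homogeneous \<alpha>\<^sub>1 \<alpha>\<^sub>2 \<rho> g \<longleftrightarrow>
    (\<forall>x\<^sub>1 x\<^sub>2 r. (x\<^sub>1, x\<^sub>2) \<noteq> (0, 0) \<longrightarrow> r > 0 \<longrightarrow>
       g (r powr \<alpha>\<^sub>1 * x\<^sub>1, r powr \<alpha>\<^sub>2 * x\<^sub>2) = r powr \<rho> * g (x\<^sub>1, x\<^sub>2))"

definition homogeneity_curve :: "real \<Rightarrow> real \<Rightarrow> real \<times> real \<Rightarrow> (real \<times> real) set"
  where "homogeneity_curve \<alpha>\<^sub>1 \<alpha>\<^sub>2 v = {(r powr \<alpha>\<^sub>1 * fst v, r powr \<alpha>\<^sub>2 * snd v) | r. r > 0}"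

definition hessian_det :: "(real \<times> real \<Rightarrow> real) \<Rightarrow> real \<times> real \<Rightarrow> real"
  where "hessian_det f x = \<partial>\<^sub>1 (\<partial>\<^sub>1 f) x * \<partial>\<^sub>2 (\<partial>\<^sub>2 f) x - (\<partial>\<^sub>1 (\<partial>\<^sub>2 f) x)\<^sup>2"

definition grad :: "(real \<times> real \<Rightarrow> real) \<Rightarrow> real \<times> real \<Rightarrow> real \<times> real"
  where "grad f x = (\<partial>\<^sub>1 f x, \<partial>\<^sub>2 f x)"

definition phi_at :: "(real \<times> real \<Rightarrow> real) \<Rightarrow> real \<times> real \<Rightarrow> real \<times> real \<Rightarrow> real"
  where "phi_at \<phi> v x = \<phi> (x + v) - \<phi> v - x \<bullet> grad \<phi> v"

text \<open>The normal forms, for a function \<open>f\<close> that stands for \<open>phi_at \<phi> v \<circ> L\<close>.  All identities are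
  identities of germs at the origin.\<close>

definition normal_form_i ::
    "(real \<times> real \<Rightarrow> real) \<Rightarrow> nat \<Rightarrow> (real \<times> real \<Rightarrow> real) \<Rightarrow> (real \<times> real \<Rightarrow> real) \<Rightarrow> bool"
  where "normal_form_i f k r \<phi>' \<longleftrightarrow>
    k \<ge> 2 \<and> smooth_nonzero_near 0 r \<and> smooth_near 0 \<phi>' \<and> flat_at \<phi>' 0 \<and>
    (\<forall>\<^sub>F x in nhds 0. f x = snd x ^ k * r x + \<phi>' x) \<and>
    (flat_at (hessian_det f) 0 \<or>
     (\<exists>k' q. smooth_nonzero_near 0 q \<and>
        (\<forall>\<^sub>F x in nhds 0. hessian_det f x = snd x ^ (k' + 2 * k - 2) * q x))) \<and>
    (\<not> flat_at (hessian_det f) 0 \<longrightarrow> (\<forall>\<^sub>F x in nhds 0. \<phi>' x = 0))"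

definition normal_form_ii ::
    "(real \<times> real \<Rightarrow> real) \<Rightarrow> nat \<Rightarrow> (real \<Rightarrow> real) \<Rightarrow> (real \<times> real \<Rightarrow> real) \<Rightarrow>
     (real \<times> real \<Rightarrow> real) \<Rightarrow> bool"
  where "normal_form_ii f k r\<^sub>1 r\<^sub>2 q \<longleftrightarrow>
    k \<ge> 3 \<and> smooth_nonzero_near 0 r\<^sub>1 \<and> smooth_nonzero_near 0 r\<^sub>2 \<and> smooth_nonzero_near 0 q \<and>
    (\<forall>\<^sub>F x in nhds 0. f x = (fst x)\<^sup>2 * r\<^sub>1 (fst x) + snd x ^ k * r\<^sub>2 x) \<and>
    (\<forall>\<^sub>F x in nhds 0. hessian_det f x = snd x ^ (k - 2) * q x)"

text \<open>The condition says that the Taylor coefficients of \<open>x\<^sub>2 \<mapsto> r\<^sub>1(0, x\<^sub>2)\<close> up to order \<open>k - 1\<close> form a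
  geometric progression of ratio \<open>c\<close>.\<close>

definition geometric_jet :: "nat \<Rightarrow> (real \<times> real \<Rightarrow> real) \<Rightarrow> bool"
  where "geometric_jet k r\<^sub>1 \<longleftrightarrow>
    (\<exists>c. c \<noteq> 0 \<and>
      (\<forall>j\<in>{1..k - 1}. (\<partial>\<^sub>2 ^^ j) r\<^sub>1 0 = c * real j * (\<partial>\<^sub>2 ^^ (j - 1)) r\<^sub>1 0))"

definition normal_form_iii ::
    "(real \<times> real \<Rightarrow> real) \<Rightarrow> nat \<Rightarrow> (real \<times> real \<Rightarrow> real) \<Rightarrow> (real \<times> real \<Rightarrow> real) \<Rightarrow>
     (real \<times> real \<Rightarrow> real) \<Rightarrow> bool"
  where "normal_form_iii f k r\<^sub>1 r\<^sub>2 q \<longleftrightarrow>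
    k \<ge> 3 \<and> smooth_nonzero_near 0 r\<^sub>1 \<and> smooth_nonzero_near 0 r\<^sub>2 \<and> smooth_nonzero_near 0 q \<and>
    geometric_jet k r\<^sub>1 \<and>
    (\<forall>\<^sub>F x in nhds 0. f x = (fst x)\<^sup>2 * r\<^sub>1 x + snd x ^ k * r\<^sub>2 x) \<and>
    (\<forall>\<^sub>F x in nhds 0. hessian_det f x = snd x ^ (k - 2) * q x)"

definition normal_form_iv ::
    "(real \<times> real \<Rightarrow> real) \<Rightarrow> nat \<Rightarrow> (real \<Rightarrow> real) \<Rightarrow> (real \<Rightarrow> real) \<Rightarrow> (real \<times> real \<Rightarrow> real) \<Rightarrow>
     (real \<times> real \<Rightarrow> real) \<Rightarrow> bool"
  where "normal_form_iv f k \<psi> r\<^sub>1 r\<^sub>2 q \<longleftrightarrow>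
    k \<ge> 3 \<and> smooth_nonzero_near 0 \<psi> \<and>
    smooth_nonzero_near 0 r\<^sub>1 \<and> smooth_nonzero_near 0 r\<^sub>2 \<and> smooth_nonzero_near 0 q \<and>
    (\<forall>\<^sub>F x in nhds 0.
       f x = (fst x)\<^sup>2 * r\<^sub>1 (fst x) + (snd x - (fst x)\<^sup>2 * \<psi> (fst x)) ^ k * r\<^sub>2 x) \<and>
    (\<forall>\<^sub>F x in nhds 0. hessian_det f x = (snd x - (fst x)\<^sup>2 * \<psi> (fst x)) ^ (k - 2) * q x)"

definition normal_form_v ::
    "(real \<times> real \<Rightarrow> real) \<Rightarrow> nat \<Rightarrow> (real \<Rightarrow> real) \<Rightarrow> (real \<times> real \<Rightarrow> real) \<Rightarrow>
     (real \<times> real \<Rightarrow> real) \<Rightarrow> (real \<times> real \<Rightarrow> real) \<Rightarrow> bool"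
  where "normal_form_v f k \<psi> r\<^sub>1 r\<^sub>2 q \<longleftrightarrow>
    k \<ge> 3 \<and> smooth_nonzero_near 0 \<psi> \<and>
    smooth_nonzero_near 0 r\<^sub>1 \<and> smooth_nonzero_near 0 r\<^sub>2 \<and> smooth_nonzero_near 0 q \<and>
    geometric_jet k r\<^sub>1 \<and>
    (\<forall>\<^sub>F x in nhds 0.
       f x = (fst x)\<^sup>2 * r\<^sub>1 x + (snd x - (fst x)\<^sup>2 * \<psi> (fst x)) ^ k * r\<^sub>2 x) \<and>
    (\<forall>\<^sub>F x in nhds 0. hessian_det f x = (snd x - (fst x)\<^sup>2 * \<psi> (fst x)) ^ (k - 2) * q x)"

definition normal_form_vi ::
    "(real \<times> real \<Rightarrow> real) \<Rightarrow> nat \<Rightarrow> (real \<Rightarrow> real) \<Rightarrow> (real \<times> real \<Rightarrow> real) \<Rightarrow>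
     (real \<times> real \<Rightarrow> real) \<Rightarrow> bool"
  where "normal_form_vi f k \<psi> r q \<longleftrightarrow>
    k \<ge> 2 \<and> smooth_nonzero_near 0 \<psi> \<and> smooth_nonzero_near 0 r \<and> smooth_nonzero_near 0 q \<and>
    (\<forall>\<^sub>F x in nhds 0. f x = (snd x - (fst x)\<^sup>2 * \<psi> (fst x)) ^ k * r x) \<and>
    (\<forall>\<^sub>F x in nhds 0. hessian_det f x = (snd x - (fst x)\<^sup>2 * \<psi> (fst x)) ^ (2 * k - 3) * q x)"

text \<open>Near the origin, \<open>x \<mapsto> v + L x\<close> maps the zero set of \<open>x\<^sub>2 - x\<^sub>1\<^sup>2 \<psi>(x\<^sub>1)\<close> onto the homogeneity
  curve near \<open>v\<close> (\<open>L\<close> is an invertible linear map whenever this is used).\<close>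

definition root_is_homogeneity_curve ::
    "real \<Rightarrow> real \<Rightarrow> real \<times> real \<Rightarrow> (real \<times> real \<Rightarrow> real \<times> real) \<Rightarrow> (real \<Rightarrow> real) \<Rightarrow> bool"
  where "root_is_homogeneity_curve \<alpha>\<^sub>1 \<alpha>\<^sub>2 v L \<psi> \<longleftrightarrow>
    (\<forall>\<^sub>F x in nhds 0.
       snd x - (fst x)\<^sup>2 * \<psi> (fst x) = 0 \<longleftrightarrow> v + L x \<in> homogeneity_curve \<alpha>\<^sub>1 \<alpha>\<^sub>2 v)"

datatype nf_case = NF_i | NF_ii | NF_iii | NF_iv | NF_v | NF_vi

primrec has_normal_form ::
    "nf_case \<Rightarrow> real \<Rightarrow> real \<Rightarrow> (real \<times> real \<Rightarrow> real) \<Rightarrow> real \<times> real \<Rightarrow>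
     (real \<times> real \<Rightarrow> real \<times> real) \<Rightarrow> bool"
  where
    "has_normal_form NF_i \<alpha>\<^sub>1 \<alpha>\<^sub>2 \<phi> v L \<longleftrightarrow>
       (\<exists>k r \<phi>'. normal_form_i (phi_at \<phi> v \<circ> L) k r \<phi>')"
  | "has_normal_form NF_ii \<alpha>\<^sub>1 \<alpha>\<^sub>2 \<phi> v L \<longleftrightarrow>
       (\<exists>k r\<^sub>1 r\<^sub>2 q. normal_form_ii (phi_at \<phi> v \<circ> L) k r\<^sub>1 r\<^sub>2 q)"
  | "has_normal_form NF_iii \<alpha>\<^sub>1 \<alpha>\<^sub>2 \<phi> v L \<longleftrightarrow>
       (\<exists>k r\<^sub>1 r\<^sub>2 q. normal_form_iii (phi_at \<phi> v \<circ> L) k r\<^sub>1 r\<^sub>2 q)"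
  | "has_normal_form NF_iv \<alpha>\<^sub>1 \<alpha>\<^sub>2 \<phi> v L \<longleftrightarrow>
       (\<exists>k \<psi> r\<^sub>1 r\<^sub>2 q. normal_form_iv (phi_at \<phi> v \<circ> L) k \<psi> r\<^sub>1 r\<^sub>2 q \<and>
          root_is_homogeneity_curve \<alpha>\<^sub>1 \<alpha>\<^sub>2 v L \<psi>)"
  | "has_normal_form NF_v \<alpha>\<^sub>1 \<alpha>\<^sub>2 \<phi> v L \<longleftrightarrow>
       (\<exists>k \<psi> r\<^sub>1 r\<^sub>2 q. normal_form_v (phi_at \<phi> v \<circ> L) k \<psi> r\<^sub>1 r\<^sub>2 q \<and>
          root_is_homogeneity_curve \<alpha>\<^sub>1 \<alpha>\<^sub>2 v L \<psi>)"
  | "has_normal_form NF_vi \<alpha>\<^sub>1 \<alpha>\<^sub>2 \<phi> v L \<longleftrightarrow>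
       (\<exists>k \<psi> r q. normal_form_vi (phi_at \<phi> v \<circ> L) k \<psi> r q \<and>
          root_is_homogeneity_curve \<alpha>\<^sub>1 \<alpha>\<^sub>2 v L \<psi>)"

end

theory Submission
  imports Defs
begin

text \<open>Linear coordinates move \<open>v\<close> to \<open>(1, y0)\<close> and turn \<open>\<phi>\<close> into \<open>u\<^sup>\<kappa> g(y)\<close> with \<open>u = x\<^sub>1\<close>,
  \<open>y = x\<^sub>2 u\<^bsup>-\<gamma>\<^esup>\<close>.  The Hessian determinant is then a power of \<open>u\<close> times the function
  \<open>h = \<kappa>(\<kappa>-1) g g'' + \<gamma>(1-\<gamma>) y g' g'' - (\<kappa>-\<gamma>)\<^sup>2 g'\<^sup>2\<close> of \<open>y\<close> alone, and the homogeneity curve is \<open>y = y0\<close>,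
  so everything is governed by vanishing orders at \<open>y0\<close>.

  If \<open>(\<kappa>-\<gamma>) g'(y0) = 0\<close>, then up to affine terms \<open>g\<close> may be replaced by \<open>G + d\<close>, where \<open>d\<close> is constant
  and \<open>G\<close> vanishes to second order.  When \<open>\<kappa>(\<kappa>-1) d = 0\<close> this gives (i) and (vi), otherwise it gives (ii),
  (iv) and flat cases of (i).  If \<open>(\<kappa>-\<gamma>) g'(y0) \<noteq> 0\<close>, then \<open>g\<close> is compared with the solution \<open>g0\<close> of
  \<open>h = 0\<close> that has the same value and slope at \<open>y0\<close>: it belongs to the developable surface enveloped by the dilates of the
  tangent plane at \<open>v\<close>, and the order of \<open>h\<close> is that of \<open>g - g0\<close> minus two.  Along a ruling of a developable
  surface the transversal second derivative is the reciprocal of an affine function.  This is the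
  geometric progression in (iii) and (v); it is constant exactly for cylinders, which give (ii) and (iv).

  For uniqueness, the zero set of the Hessian determinant is a line or is curved, the function
  vanishes on it or does not, and \<open>\<partial>\<^sub>2 r\<^sub>1(0)\<close> is zero or not; all this is invariant under linear maps.\<close>

section \<open>Smooth functions and germs\<close>

text \<open>Linear coordinates can make the homogeneity curve tangent to the first axis, but they
  cannot straighten it. It is straight exactly when \<gamma> = 1 or \<open>y0 = 0\<close>; for
  Hessian determinants that are not flat this separates (i)-(iii) from (iv)-(vi).

  If \<open>(\<kappa>-\<gamma>) g'(y0) \<noteq> 0\<close>, everything hinges on the number \<open>P
  = \<kappa>(\<kappa>-1) g(y0) + \<gamma>(1-\<gamma>) y0 g'(y0)\<close>, the coefficient of
  \<open>g''\<close> in \<open>h\<close>. Since \<open>h(y0) = 0\<close> reads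
  \<open>P g''(y0) = (\<kappa>-\<gamma>)\<^sup>2 g'(y0)\<^sup>2\<close>, it is nonzero.
  \<open>P\<close> then serves three times: it makes the ruling parameter a smooth function of
  \<open>y\<close>; it is the determinant of the coordinates whose axes are the ruling and the
  tangent of the curve; and it is the leading coefficient in the linear second-order expression in
  \<open>g - g0\<close> that equals \<open>h\<close>, which is why exactly two orders are lost.

  The finite type hypothesis enters where \<open>\<kappa>(\<kappa>-1) d = 0\<close>: a flat
  \<open>G\<close> would make both pure second derivatives flat along the two lines through
  \<open>v\<close>.\<close>

lemma partial_deriv_eq:
  "(f has_derivative D) (at x) \<Longrightarrow> partial_deriv b f x = D b"
  unfolding partial_deriv_def by (metis frechet_derivative_at)

lemma partial_deriv_cong:
  assumes "\<forall>\<^sub>F y in nhds x. f y = g y"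
  shows "partial_deriv b f x = partial_deriv b g x"
proof -
  obtain S where "open S" "x \<in> S" "\<And>y. y \<in> S \<Longrightarrow> f y = g y"
    using assms by (auto simp: eventually_nhds)
  then have *: "(f has_derivative D) (at x) \<longleftrightarrow> (g has_derivative D) (at x)" for D
    by (metis has_derivative_transform_within_open)
  show ?thesis
    unfolding partial_deriv_def frechet_derivative_def * by simp
qed

lemma eventually_partial_deriv_cong:
  assumes "\<forall>\<^sub>F y in nhds x. f y = g y"
  shows "\<forall>\<^sub>F y in nhds x. partial_deriv b f y = partial_deriv b g y"
  using assms by (subst (asm) eventually_eventually [symmetric])
    (auto elim!: eventually_mono intro: partial_deriv_cong)

lemma has_derivative_partial_deriv:
  fixes f :: "'a::euclidean_space \<Rightarrow> real"
  assumes "f differentiable (at x)"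
  shows "(f has_derivative (\<lambda>h. \<Sum>b\<in>Basis. (h \<bullet> b) * partial_deriv b f x)) (at x)"
proof -
  have d: "(f has_derivative frechet_derivative f (at x)) (at x)"
    using assms by (simp add: frechet_derivative_works)
  then have lin: "linear (frechet_derivative f (at x))"
    by (simp add: has_derivative_linear)
  have "frechet_derivative f (at x) = (\<lambda>h. \<Sum>b\<in>Basis. (h \<bullet> b) * partial_deriv b f x)"
  proof
    fix h
    have "frechet_derivative f (at x) h = frechet_derivative f (at x) (\<Sum>b\<in>Basis. (h \<bullet> b) *\<^sub>R b)"
      by (simp add: euclidean_representation)
    also have "\<dots> = (\<Sum>b\<in>Basis. (h \<bullet> b) * partial_deriv b f x)"
      by (simp add: linear_sum[OF lin] linear_scale[OF lin] partial_deriv_def)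
    finally show "frechet_derivative f (at x) h = (\<Sum>b\<in>Basis. (h \<bullet> b) * partial_deriv b f x)" .
  qed
  with d show ?thesis by simp
qed

section \<open>Closure properties of the classes of k times differentiable functions\<close>

lemma Ck_on_cong:
  assumes "open S" "\<And>x. x \<in> S \<Longrightarrow> f x = g x"
  shows "Ck_on k S f \<longleftrightarrow> Ck_on k S g"
  using assms(2)
proof (induction k arbitrary: f g)
  case 0
  then show ?case by (simp cong: continuous_on_cong)
next
  case (Suc k)
  have ev: "\<forall>\<^sub>F y in nhds x. f y = g y" if "x \<in> S" for x
    using that assms(1) Suc.prems by (auto intro: eventually_nhds_in_open elim!: eventually_mono[rotated])
  have "f differentiable (at x) \<longleftrightarrow> g differentiable (at x)" if "x \<in> S" for x
    using that assms(1) Suc.prems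
    by (metis (no_types, lifting) differentiable_def has_derivative_transform_within_open)
  moreover have "partial_deriv b f x = partial_deriv b g x" if "x \<in> S" for x b
    using partial_deriv_cong[OF ev[OF that]] .
  ultimately show ?case
    using Suc.IH[of "partial_deriv b f" "partial_deriv b g" for b] by auto
qed

lemma Ck_on_subset: "Ck_on k T f \<Longrightarrow> S \<subseteq> T \<Longrightarrow> Ck_on k S f"
  by (induction k arbitrary: f) (auto intro: continuous_on_subset)

lemma Ck_on_continuous: "Ck_on k S f \<Longrightarrow> continuous_on S f"
  by (cases k) (auto intro!: continuous_at_imp_continuous_on differentiable_imp_continuous_within)

lemma Ck_on_Suc_imp: "Ck_on (Suc k) S f \<Longrightarrow> Ck_on k S f"
proof (induction k arbitrary: f)
  case 0
  then show ?case using Ck_on_continuous[OF 0] by simp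
next
  case (Suc k)
  then show ?case by (metis Ck_on.simps(2))
qed

text \<open>\<open>Ck_on\<close> recurses through \<open>partial_deriv\<close>; this rule accepts
  any explicit derivative \<open>D\<close> instead, which turns the closure properties below into
  inductions on \<open>k\<close>.\<close>

lemma Ck_on_SucI:
  assumes "open S" "\<And>x. x \<in> S \<Longrightarrow> (f has_derivative D x) (at x)"
    and "\<And>b. b \<in> Basis \<Longrightarrow> Ck_on k S (\<lambda>x. D x b)"
  shows "Ck_on (Suc k) S f"
proof -
  have "Ck_on k S (partial_deriv b f)" if "b \<in> Basis" for b
    using assms(3)[OF that]
    by (subst Ck_on_cong[OF assms(1)]) (auto intro!: partial_deriv_eq assms(2))
  then show ?thesis
    using assms(2) by (auto simp: differentiable_def)
qed

lemma Ck_on_has_derivative: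
  assumes "Ck_on (Suc k) S f" "x \<in> S"
  shows "(f has_derivative (\<lambda>h. \<Sum>b\<in>Basis. (h \<bullet> b) * partial_deriv b f x)) (at x)"
  using assms by (auto intro: has_derivative_partial_deriv)

lemma Ck_on_const: "open S \<Longrightarrow> Ck_on k S (\<lambda>x. c)"
proof (induction k arbitrary: c)
  case (Suc k)
  then show ?case
    by (intro Ck_on_SucI[where D = "\<lambda>x h. 0"]) auto
qed auto

lemma Ck_on_inner: "open S \<Longrightarrow> Ck_on k S (\<lambda>x. x \<bullet> c)"
proof (cases k)
  case (Suc n)
  moreover assume "open S"
  moreover have "((\<lambda>x. x \<bullet> c) has_derivative (\<lambda>h. h \<bullet> c)) (at x)" for x
    by (auto intro!: derivative_eq_intros)
  ultimately show ?thesis by (auto intro!: Ck_on_SucI Ck_on_const simp del: Ck_on.simps(2))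
qed (auto intro!: continuous_intros)

lemma Ck_on_add:
  assumes "open S"
  shows "Ck_on k S f \<Longrightarrow> Ck_on k S g \<Longrightarrow> Ck_on k S (\<lambda>x. f x + g x)"
proof (induction k arbitrary: f g)
  case (Suc k)
  show ?case
  proof (rule Ck_on_SucI[OF assms])
    show "((\<lambda>x. f x + g x) has_derivative
      (\<lambda>h. frechet_derivative f (at x) h + frechet_derivative g (at x) h)) (at x)" if "x \<in> S" for x
      using Suc.prems that by (auto intro!: has_derivative_add simp: frechet_derivative_works)
    show "Ck_on k S (\<lambda>x. frechet_derivative f (at x) b + frechet_derivative g (at x) b)"
      if "b \<in> Basis" for b
      using Suc.IH[of "partial_deriv b f" "partial_deriv b g"] Suc.prems that
      by (simp add: partial_deriv_def [symmetric])
  qed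
qed (auto intro: continuous_on_add)

lemma Ck_on_mult:
  assumes "open S"
  shows "Ck_on k S f \<Longrightarrow> Ck_on k S g \<Longrightarrow> Ck_on k S (\<lambda>x. f x * g x)"
proof (induction k arbitrary: f g)
  case (Suc k)
  show ?case
  proof (rule Ck_on_SucI[OF assms])
    show "((\<lambda>x. f x * g x) has_derivative
      (\<lambda>h. f x * frechet_derivative g (at x) h + frechet_derivative f (at x) h * g x)) (at x)" if "x \<in> S" for x
      using Suc.prems that by (auto intro!: has_derivative_mult simp: frechet_derivative_works)
    show "Ck_on k S (\<lambda>x. f x * frechet_derivative g (at x) b + frechet_derivative f (at x) b * g x)"
      if "b \<in> Basis" for b
      using Suc.IH[of f "partial_deriv b g"] Suc.IH[of "partial_deriv b f" g]
        Suc.prems that Ck_on_Suc_imp[OF Suc.prems(1)] Ck_on_Suc_imp[OF Suc.prems(2)]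
      unfolding partial_deriv_def [symmetric] by (auto intro!: Ck_on_add[OF assms])
  qed
qed (auto intro: continuous_on_mult)

lemma Ck_on_sum:
  assumes "open S"
  shows "finite I \<Longrightarrow> (\<And>i. i \<in> I \<Longrightarrow> Ck_on k S (f i)) \<Longrightarrow> Ck_on k S (\<lambda>x. \<Sum>i\<in>I. f i x)"
  by (induction I rule: finite_induct) (auto intro!: Ck_on_add Ck_on_const assms)

text \<open>Smoothness is defined for real-valued functions, so the inner map enters through its
  coordinates \<open>A x \<bullet> c\<close>.\<close>

lemma has_derivative_compose_components:
  fixes A :: "'a::euclidean_space \<Rightarrow> 'b::euclidean_space"
  assumes "f differentiable (at (A x))"
    and "\<And>c. c \<in> Basis \<Longrightarrow> (\<lambda>x. A x \<bullet> c) differentiable (at x)"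
  shows "((\<lambda>x. f (A x)) has_derivative (\<lambda>h. \<Sum>c\<in>Basis. partial_deriv c f (A x) *
      frechet_derivative (\<lambda>x. A x \<bullet> c) (at x) h)) (at x)"
proof -
  define D where "D h = (\<Sum>c\<in>Basis. frechet_derivative (\<lambda>x. A x \<bullet> c) (at x) h *\<^sub>R c)" for h
  have D: "D h \<bullet> c = frechet_derivative (\<lambda>x. A x \<bullet> c) (at x) h" if "c \<in> Basis" for h c
    using that by (simp add: D_def inner_sum_left inner_Basis if_distrib cong: if_cong)
  have A: "(A has_derivative D) (at x)"
    using assms(2) by (subst has_derivative_componentwise_within) (auto simp: D frechet_derivative_works)
  show ?thesis
    using has_derivative_compose[OF A has_derivative_partial_deriv[OF assms(1)]]
    by (simp add: D mult.commute)
qed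

text \<open>The bound \<open>n\<close> allows an inner map of finite order: in
  \<open>smooth_inverse_function\<close> the inner map is known to order \<open>k\<close> only, its
  smoothness being the goal there.\<close>

lemma Ck_on_compose:
  fixes A :: "'a::euclidean_space \<Rightarrow> 'b::euclidean_space"
  assumes S: "open S" and AS: "A ` S \<subseteq> T"
    and A: "\<And>c k. c \<in> Basis \<Longrightarrow> k \<le> n \<Longrightarrow> Ck_on k S (\<lambda>x. A x \<bullet> c)"
  shows "k \<le> n \<Longrightarrow> Ck_on k T f \<Longrightarrow> Ck_on k S (\<lambda>x. f (A x))"
proof (induction k arbitrary: f)
  case 0
  have "continuous_on S A"
    by (subst continuous_on_componentwise) (use A[of _ 0] in auto)
  then show ?case
    using 0 AS by (auto intro: continuous_on_compose2)
next
  case (Suc k)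
  have dA: "(\<lambda>x. A x \<bullet> c) differentiable (at x)" if "c \<in> Basis" "x \<in> S" for c x
    using A[OF that(1) Suc.prems(1)] that(2) by simp
  have "((\<lambda>x. f (A x)) has_derivative (\<lambda>h. \<Sum>c\<in>Basis. partial_deriv c f (A x) *
      frechet_derivative (\<lambda>x. A x \<bullet> c) (at x) h)) (at x)" if "x \<in> S" for x
    using that Suc.prems AS dA by (intro has_derivative_compose_components) auto
  then show ?case
  proof (rule Ck_on_SucI[OF S])
    fix b :: 'a assume "b \<in> Basis"
    then have "Ck_on k S (\<lambda>x. partial_deriv c f (A x) * partial_deriv b (\<lambda>x. A x \<bullet> c) x)"
      if "c \<in> Basis" for c
      using A[OF that Suc.prems(1)] Suc.IH[of "partial_deriv c f"] Suc.prems that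
      by (auto intro!: Ck_on_mult[OF S])
    then show "Ck_on k S (\<lambda>x. \<Sum>c\<in>Basis. partial_deriv c f (A x) *
        frechet_derivative (\<lambda>x. A x \<bullet> c) (at x) b)"
      unfolding partial_deriv_def [symmetric] by (auto intro!: Ck_on_sum[OF S])
  qed
qed

lemma Ck_on_inverse: "Ck_on k (- {0::real}) inverse"
proof (induction k)
  case (Suc k)
  show ?case
  proof (rule Ck_on_SucI)
    show "(inverse has_derivative (\<lambda>h. - (inverse x * h * inverse x))) (at x)" if "x \<in> - {0}" for x :: real
      using has_derivative_inverse'[of x UNIV] that by auto
    have "Ck_on k (- {0::real}) (\<lambda>x. -1 * (inverse x * inverse x))"
      by (intro Ck_on_mult Ck_on_const Suc.IH) auto
    then show "Ck_on k (- {0}) (\<lambda>x. - (inverse x * b * inverse x))" if "b \<in> Basis" for b :: real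
      using that by simp
  qed auto
qed (auto intro!: continuous_intros)

lemma Ck_on_powr: "Ck_on k {0<..} (\<lambda>x::real. x powr a)"
proof (induction k arbitrary: a)
  case (Suc k)
  show ?case
  proof (rule Ck_on_SucI)
    show "((\<lambda>x. x powr a) has_derivative (\<lambda>h. (a * x powr (a - 1)) * h)) (at x)" if "x \<in> {0<..}" for x :: real
      using has_real_derivative_powr[of x a] that by (auto simp: has_field_derivative_def)
    have "Ck_on k {0<..} (\<lambda>x::real. a * x powr (a - 1))"
      by (intro Ck_on_mult Ck_on_const Suc.IH) auto
    then show "Ck_on k {0<..} (\<lambda>x. a * x powr (a - 1) * b)" if "b \<in> Basis" for b :: real
      using that by simp
  qed auto
qed (auto intro!: continuous_intros)

section \<open>Smooth functions near a point\<close>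

lemma smooth_near_open:
  assumes "open S" "p \<in> S" "\<forall>k. Ck_on k S f"
  shows "smooth_near p f"
  using assms unfolding smooth_near_def smooth_on_def by blast

lemma smooth_nearE:
  assumes "smooth_near p f"
  obtains S where "open S" "p \<in> S" "\<forall>k. Ck_on k S f"
  using assms unfolding smooth_near_def smooth_on_def by blast

lemma smooth_near2E:
  assumes "smooth_near p f" "smooth_near p g"
  obtains S where "open S" "p \<in> S" "\<forall>k. Ck_on k S f" "\<forall>k. Ck_on k S g"
proof -
  obtain S T where "open S" "p \<in> S" "\<forall>k. Ck_on k S f" "open T" "p \<in> T" "\<forall>k. Ck_on k T g"
    using assms by (metis smooth_nearE)
  then have "open (S \<inter> T)" "p \<in> S \<inter> T" "\<forall>k. Ck_on k (S \<inter> T) f" "\<forall>k. Ck_on k (S \<inter> T) g"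
    by (auto intro: Ck_on_subset)
  then show ?thesis using that by blast
qed

lemma smooth_near_cong:
  assumes "smooth_near p f" "\<forall>\<^sub>F x in nhds p. f x = g x"
  shows "smooth_near p g"
proof -
  obtain S where S: "open S" "p \<in> S" "\<forall>k. Ck_on k S f" using assms(1) by (rule smooth_nearE)
  obtain T where T: "open T" "p \<in> T" "\<And>x. x \<in> T \<Longrightarrow> f x = g x"
    using assms(2) by (auto simp: eventually_nhds)
  have "Ck_on k (S \<inter> T) f" for k using S by (auto intro: Ck_on_subset)
  then have "Ck_on k (S \<inter> T) g" for k
    using S T by (subst Ck_on_cong[where g = f]) auto
  then show ?thesis using S T by (intro smooth_near_open[of "S \<inter> T"]) auto
qed

lemma smooth_near_eventually:
  assumes "smooth_near p f"
  shows "\<forall>\<^sub>F x in nhds p. smooth_near x f"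
proof -
  obtain S where S: "open S" "p \<in> S" "\<forall>k. Ck_on k S f" using assms by (rule smooth_nearE)
  then show ?thesis unfolding eventually_nhds by (intro exI[of _ S]) (auto intro: smooth_near_open)
qed

lemma smooth_near_differentiable: "smooth_near p f \<Longrightarrow> f differentiable (at p)"
  by (erule smooth_nearE) (metis Ck_on.simps(2))

lemma smooth_near_isCont: "smooth_near p f \<Longrightarrow> isCont f p"
  using differentiable_imp_continuous_within smooth_near_differentiable by blast

lemma smooth_near_partial [intro]:
  assumes "smooth_near p f" "b \<in> Basis"
  shows "smooth_near p (partial_deriv b f)"
proof -
  obtain S where S: "open S" "p \<in> S" "\<forall>k. Ck_on k S f" using assms(1) by (rule smooth_nearE)
  then show ?thesis using assms(2) by (intro smooth_near_open[of S]) (metis Ck_on.simps(2))+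
qed

named_theorems smooth

lemma smooth_near_const [smooth]: "smooth_near p (\<lambda>x. c)"
  by (rule smooth_near_open[of UNIV]) (auto intro!: Ck_on_const)

lemma smooth_near_inner [smooth]: "smooth_near p (\<lambda>x. x \<bullet> c)"
  by (rule smooth_near_open[of UNIV]) (auto intro!: Ck_on_inner)

lemma smooth_near_ident [smooth]: "smooth_near p (\<lambda>x::real. x)"
  using smooth_near_inner[of p "1::real"] by simp

lemma smooth_near_add [smooth]:
  assumes "smooth_near p f" "smooth_near p g"
  shows "smooth_near p (\<lambda>x. f x + g x)"
proof -
  obtain S where "open S" "p \<in> S" "\<forall>k. Ck_on k S f" "\<forall>k. Ck_on k S g"
    using assms by (rule smooth_near2E)
  then show ?thesis by (intro smooth_near_open[of S]) (auto intro: Ck_on_add)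
qed

lemma smooth_near_mult [smooth]:
  assumes "smooth_near p f" "smooth_near p g"
  shows "smooth_near p (\<lambda>x. f x * g x)"
proof -
  obtain S where "open S" "p \<in> S" "\<forall>k. Ck_on k S f" "\<forall>k. Ck_on k S g"
    using assms by (rule smooth_near2E)
  then show ?thesis by (intro smooth_near_open[of S]) (auto intro: Ck_on_mult)
qed

lemma smooth_near_minus [smooth]: "smooth_near p f \<Longrightarrow> smooth_near p (\<lambda>x. - f x)"
  using smooth_near_mult[OF smooth_near_const[of p "-1"], of f] by simp

lemma smooth_near_diff [smooth]:
  "smooth_near p f \<Longrightarrow> smooth_near p g \<Longrightarrow> smooth_near p (\<lambda>x. f x - g x)"
  using smooth_near_add[OF _ smooth_near_minus, of p f g] by simp

lemma smooth_near_power [smooth]: "smooth_near p f \<Longrightarrow> smooth_near p (\<lambda>x. f x ^ n)"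
  by (induction n) (auto intro!: smooth)

lemma smooth_near_sum [smooth]:
  "finite I \<Longrightarrow> (\<And>i. i \<in> I \<Longrightarrow> smooth_near p (f i)) \<Longrightarrow> smooth_near p (\<lambda>x. \<Sum>i\<in>I. f i x)"
  by (induction I rule: finite_induct) (auto intro!: smooth)

lemma smooth_near_compose:
  fixes A :: "'a::euclidean_space \<Rightarrow> 'b::euclidean_space"
  assumes "smooth_near (A p) f" and "\<And>c. c \<in> Basis \<Longrightarrow> smooth_near p (\<lambda>x. A x \<bullet> c)"
  shows "smooth_near p (\<lambda>x. f (A x))"
proof -
  obtain T where T: "open T" "A p \<in> T" "\<forall>k. Ck_on k T f" using assms(1) by (rule smooth_nearE)
  have "\<exists>S. open S \<and> p \<in> S \<and> (\<forall>k. Ck_on k S (\<lambda>x. A x \<bullet> c))" if "c \<in> Basis" for c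
    using assms(2)[OF that] by (metis smooth_nearE)
  then obtain S where S: "\<And>c. c \<in> Basis \<Longrightarrow> open (S c) \<and> p \<in> S c \<and> (\<forall>k. Ck_on k (S c) (\<lambda>x. A x \<bullet> c))"
    by metis
  define S0 where "S0 = (\<Inter>c\<in>Basis. S c)"
  have S0: "open S0" "p \<in> S0" "\<And>c k. c \<in> Basis \<Longrightarrow> Ck_on k S0 (\<lambda>x. A x \<bullet> c)"
    using S by (auto simp: S0_def intro: Ck_on_subset)
  have contA: "continuous_on S0 A"
    by (subst continuous_on_componentwise) (use S0(3)[of _ 0] in auto)
  define S1 where "S1 = S0 \<inter> A -` T"
  have "open S1" unfolding S1_def
    using continuous_open_preimage[OF contA S0(1) T(1)] by simp
  moreover have "p \<in> S1" using S0 T by (simp add: S1_def)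
  moreover have "Ck_on k S1 (\<lambda>x. f (A x))" for k
    by (rule Ck_on_compose[of S1 A T k]) (use \<open>open S1\<close> S0 T in \<open>auto simp: S1_def intro: Ck_on_subset\<close>)
  ultimately show ?thesis by (blast intro: smooth_near_open)
qed

lemma smooth_near_compose_real:
  fixes f :: "real \<Rightarrow> real"
  shows "smooth_near (a p) f \<Longrightarrow> smooth_near p a \<Longrightarrow> smooth_near p (\<lambda>x. f (a x))"
  by (rule smooth_near_compose) auto

lemma smooth_near_compose_pair:
  fixes f :: "real \<times> real \<Rightarrow> real"
  assumes "smooth_near (a p, b p) f" "smooth_near p a" "smooth_near p b"
  shows "smooth_near p (\<lambda>x. f (a x, b x))"
  by (rule smooth_near_compose) (use assms in \<open>auto simp: Basis_prod_def\<close>)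

lemma smooth_near_fst [smooth]: "smooth_near p (fst :: real \<times> real \<Rightarrow> real)"
  using smooth_near_inner[of p "(1::real, 0::real)"] by (simp add: inner_prod_def)

lemma smooth_near_snd [smooth]: "smooth_near p (snd :: real \<times> real \<Rightarrow> real)"
  using smooth_near_inner[of p "(0::real, 1::real)"] by (simp add: inner_prod_def)

lemma smooth_near_inverse [smooth]:
  assumes "smooth_near p f" "f p \<noteq> 0"
  shows "smooth_near p (\<lambda>x. inverse (f x))"
  by (rule smooth_near_compose_real[OF smooth_near_open[of "- {0}"]])
     (use assms in \<open>auto simp: Ck_on_inverse\<close>)

lemma smooth_near_divide [smooth]:
  "smooth_near p f \<Longrightarrow> smooth_near p g \<Longrightarrow> g p \<noteq> 0 \<Longrightarrow> smooth_near p (\<lambda>x. f x / g x)"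
  unfolding divide_inverse by (intro smooth)

lemma smooth_near_powr [smooth]:
  assumes "smooth_near p f" "f p > 0"
  shows "smooth_near p (\<lambda>x. f x powr a)"
  by (rule smooth_near_compose_real[where f = "\<lambda>x. x powr a", OF smooth_near_open[of "{0<..}"]])
     (use assms in \<open>auto simp: Ck_on_powr\<close>)

lemma smooth_nonzero_near_mult:
  "smooth_nonzero_near p f \<Longrightarrow> smooth_nonzero_near p g \<Longrightarrow> smooth_nonzero_near p (\<lambda>x. f x * g x)"
  by (auto simp: smooth_nonzero_near_def intro: smooth)

section \<open>Parameter integrals, Hadamard's lemma and inverse functions\<close>

lemma Ck_on_le: "Ck_on k S f \<Longrightarrow> j \<le> k \<Longrightarrow> Ck_on j S f"
  by (induction k) (auto simp: le_Suc_eq simp del: Ck_on.simps(2) intro: Ck_on_Suc_imp)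

lemma sum_Basis_prod:
  fixes f :: "'a::euclidean_space \<times> 'b::euclidean_space \<Rightarrow> real"
  shows "sum f Basis = (\<Sum>i\<in>Basis. f (i, 0)) + (\<Sum>i\<in>Basis. f (0, i))"
proof -
  have "inj_on (\<lambda>u. (u::'a, 0::'b)) Basis" "inj_on (\<lambda>u. (0::'a, u::'b)) Basis"
    by (auto intro!: inj_onI)
  then show ?thesis
    unfolding Basis_prod_def by (subst sum.union_disjoint) (auto simp: sum.reindex)
qed

text \<open>Differentiation under the integral sign: a partial derivative of the integral is the
  integral of a partial derivative, an integrand of the same kind, whence the induction over all
  \<open>h\<close>. \<open>W\<close> is an open neighbourhood of the segment because derivatives are
  taken in the full space.\<close>

lemma Ck_on_integral:
  fixes h :: "'a::euclidean_space \<times> real \<Rightarrow> real"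
  assumes U: "open U" "convex U" and W: "open W" "{0..1} \<subseteq> W"
  shows "\<forall>k. Ck_on k (U \<times> W) h \<Longrightarrow> Ck_on k U (\<lambda>x. integral {0..1} (\<lambda>t. h (x, t)))"
proof (induction k arbitrary: h)
  case 0
  have "continuous_on (U \<times> cbox 0 1) (\<lambda>(x, t). h (x, t))"
    using 0[rule_format, of 0] W by (auto simp: case_prod_beta intro: continuous_on_subset)
  then show ?case using integral_continuous_on_param[of U 0 1 "\<lambda>x t. h (x, t)"] by simp
next
  case (Suc k)
  \<comment> \<open>The derivative in the parameter as a bounded linear map, the form that
    \<open>leibniz_rule\<close> expects, assembled from the directions
    \<open>(b, 0)\<close>.\<close>
  define fx where "fx x t = (\<Sum>b\<in>Basis. partial_deriv (b, 0) h (x, t) *\<^sub>R blinfun_inner_left b)" for x t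
  have cont: "continuous_on (U \<times> W) (partial_deriv (b, 0) h)" if "b \<in> Basis" for b
    using Suc.prems[rule_format, of 1] that by (auto simp: Basis_prod_def)
  have contfx: "continuous_on (U \<times> cbox 0 1) (\<lambda>(x, t). fx x t)"
    unfolding fx_def case_prod_beta prod.collapse
    by (intro continuous_on_sum continuous_on_scaleR continuous_on_const)
       (use W in \<open>auto intro: continuous_on_subset[OF cont]\<close>)
  have deriv: "((\<lambda>x. h (x, t)) has_derivative blinfun_apply (fx x t)) (at x within U)"
    if "x \<in> U" "t \<in> cbox 0 1" for x t
  proof -
    have "(h has_derivative (\<lambda>v. \<Sum>b\<in>Basis. (v \<bullet> b) * partial_deriv b h (x, t))) (at (x, t))"
      using Suc.prems[rule_format, of 1] that W by (intro Ck_on_has_derivative[of 0 "U \<times> W"]) auto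
    moreover have "((\<lambda>x. (x, t)) has_derivative (\<lambda>v. (v, 0))) (at x)"
      by (auto intro!: derivative_eq_intros)
    ultimately have "((\<lambda>x. h (x, t)) has_derivative
        (\<lambda>v. \<Sum>b\<in>Basis. ((v, 0) \<bullet> b) * partial_deriv b h (x, t))) (at x)"
      using has_derivative_compose[of "\<lambda>x. (x, t)" "\<lambda>v. (v, 0)" x UNIV h] by simp
    moreover have "(\<Sum>b\<in>Basis. ((v, 0) \<bullet> b) * partial_deriv b h (x, t)) = blinfun_apply (fx x t) v" for v
      unfolding fx_def by (subst sum_Basis_prod) (simp add: blinfun.sum_left blinfun.scaleR_left mult.commute)
    ultimately show ?thesis by (simp add: has_derivative_at_withinI)
  qed
  have der: "((\<lambda>x. integral {0..1} (\<lambda>t. h (x, t))) has_derivative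
      blinfun_apply (integral {0..1} (fx x))) (at x)" if "x \<in> U" for x
  proof -
    have "(\<lambda>t. h (x, t)) integrable_on cbox 0 1" if "x \<in> U" for x
    proof (rule integrable_continuous)
      show "continuous_on (cbox 0 1) (\<lambda>t. h (x, t))"
        by (rule continuous_on_compose2[OF Ck_on_continuous[OF Suc.prems[rule_format, of 0]]])
           (use W that in \<open>auto intro!: continuous_intros\<close>)
    qed
    note int = this
    have "((\<lambda>x. integral (cbox 0 1) (\<lambda>t. h (x, t))) has_derivative
      blinfun_apply (integral (cbox 0 1) (fx x))) (at x within U)"
      by (rule leibniz_rule[OF _ _ contfx that U(2)]) (fact deriv int)+
    then show ?thesis using U(1) that by (simp only: at_within_open[OF that U(1)] box_real)
  qed
  show ?case
  proof (rule Ck_on_SucI[OF U(1) der])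
    fix b :: 'a assume b: "b \<in> Basis"
    have "blinfun_apply (integral {0..1} (fx x)) b = integral {0..1} (\<lambda>t. partial_deriv (b, 0) h (x, t))"
      if "x \<in> U" for x
    proof -
      have "continuous_on (cbox 0 1) (\<lambda>t. (x, t))" "(\<lambda>t. (x, t)) ` cbox 0 1 \<subseteq> U \<times> cbox 0 1"
        using that by (auto intro!: continuous_on_Pair continuous_on_const continuous_on_id)
      from continuous_on_compose2[OF contfx this] have "continuous_on (cbox 0 1) (fx x)" by simp
      then have "fx x integrable_on cbox 0 1" by (rule integrable_continuous)
      then have "integral (cbox 0 1) ((\<lambda>f. blinfun_apply f b) \<circ> fx x) = blinfun_apply (integral (cbox 0 1) (fx x)) b"
        by (rule integral_linear) (rule blinfun.bounded_linear_left)
      moreover have "(\<lambda>f. blinfun_apply f b) \<circ> fx x = (\<lambda>t. partial_deriv (b, 0) h (x, t))"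
        using b by (auto simp: fx_def blinfun.sum_left blinfun.scaleR_left inner_Basis if_distrib cong: if_cong)
      ultimately show ?thesis by simp
    qed
    moreover have "Ck_on k U (\<lambda>x. integral {0..1} (\<lambda>t. partial_deriv (b, 0) h (x, t)))"
    proof (rule Suc.IH, rule allI)
      fix j show "Ck_on j (U \<times> W) (partial_deriv (b, 0) h)"
        using Suc.prems[rule_format, of "Suc j"] b by (auto simp: Basis_prod_def)
    qed
    ultimately show "Ck_on k U (\<lambda>x. blinfun_apply (integral {0..1} (fx x)) b)"
      by (subst Ck_on_cong[OF U(1)]) auto
  qed
qed

text \<open>Hadamard's lemma: the quotient is the average of \<open>\<partial>\<^sub>b f\<close> over the segment that joins the two
  arguments.\<close>

lemma hadamard:
  fixes f l :: "'a::euclidean_space \<Rightarrow> real"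
  assumes f: "smooth_near p f" and l: "smooth_near p l" "l p = 0" and b: "b \<in> Basis"
  obtains q where "smooth_near p q" "\<forall>\<^sub>F x in nhds p. f x - f (x - l x *\<^sub>R b) = l x * q x"
    "q p = partial_deriv b f p"
proof -
  obtain T where T: "open T" "p \<in> T" "\<forall>k. Ck_on k T f" using f by (rule smooth_nearE)
  obtain S where S: "open S" "p \<in> S" "\<forall>k. Ck_on k S l" using l(1) by (rule smooth_nearE)
  obtain e where e: "e > 0" "ball p e \<subseteq> T" using T by (meson open_contains_ball)
  have "isCont l p" by (rule smooth_near_isCont[OF l(1)])
  then have "\<forall>\<^sub>F x in nhds p. \<bar>l x\<bar> < e / 4"
    using l(2) \<open>e > 0\<close> unfolding isCont_def tendsto_iff
    by (force simp: eventually_at_filter dist_real_def elim: eventually_mono dest: spec[of _ "e/4"])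
  then obtain V where V: "open V" "p \<in> V" "\<And>x. x \<in> V \<Longrightarrow> \<bar>l x\<bar> < e / 4"
    by (auto simp: eventually_nhds)
  obtain d0 where d0: "d0 > 0" "ball p d0 \<subseteq> S \<inter> V"
    using S V by (metis IntI open_Int open_contains_ball)
  define d where "d = min d0 (e / 2)"
  define U where "U = ball p d"
  have U: "open U" "convex U" "p \<in> U" "U \<subseteq> S" "\<And>x. x \<in> U \<Longrightarrow> \<bar>l x\<bar> < e / 4"
    "\<And>x. x \<in> U \<Longrightarrow> dist p x < e / 2"
    using d0 e V by (auto simp: U_def d_def)
  \<comment> \<open>\<open>A (x, t)\<close> below runs from \<open>x - l x *\<^sub>R b\<close> at
    \<open>t = 0\<close> to \<open>x\<close> at \<open>t = 1\<close>. On \<open>W\<close> the factor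
    \<open>t - 1\<close> has size at most 2, and \<open>l\<close> is below \<open>e / 4\<close> on
    \<open>U\<close>, so \<open>A\<close> stays within \<open>e / 2 + 2 * (e / 4) = e\<close> of
    \<open>p\<close>.\<close>
  define W where "W = {-1<..<2::real}"
  define A where "A = (\<lambda>z::'a \<times> real. fst z + ((snd z - 1) * l (fst z)) *\<^sub>R b)"
  have AT: "A z \<in> T" if "z \<in> U \<times> W" for z
  proof -
    have "norm b = 1" using b by simp
    then have "dist p (A z) \<le> dist p (fst z) + \<bar>snd z - 1\<bar> * \<bar>l (fst z)\<bar>"
      using dist_triangle[of p "A z" "fst z"] by (simp add: A_def dist_norm abs_mult)
    also have "\<dots> \<le> dist p (fst z) + 2 * \<bar>l (fst z)\<bar>"
      using that by (intro add_left_mono mult_right_mono) (auto simp: W_def)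
    also have "\<dots> < e / 2 + 2 * (e / 4)"
      using that U(5)[of "fst z"] U(6)[of "fst z"] by (intro add_strict_mono) auto
    finally show ?thesis using e by auto
  qed
  have opUW: "open (U \<times> W)" using U by (auto simp: W_def intro: open_Times)
  have fst_c: "Ck_on k (U \<times> W) (\<lambda>z. fst z \<bullet> c)" for k c
    using Ck_on_inner[OF opUW, of k "(c, 0)"] by (simp add: inner_prod_def)
  have snd_c: "Ck_on k (U \<times> W) snd" for k
    using Ck_on_inner[OF opUW, of k "(0, 1)"] by (simp add: inner_prod_def)
  have lc: "Ck_on k (U \<times> W) (\<lambda>z. l (fst z))" for k
    by (rule Ck_on_compose[OF opUW, of fst S k]) (use U S fst_c in auto)
  have Ac: "Ck_on k (U \<times> W) (\<lambda>z. A z \<bullet> c)" for k c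
  proof -
    have eq: "A z \<bullet> c = fst z \<bullet> c + ((snd z + -1) * l (fst z)) * (b \<bullet> c)" for z
      by (simp add: A_def inner_add_left)
    show ?thesis
      unfolding eq by (intro Ck_on_add Ck_on_mult Ck_on_const fst_c snd_c lc opUW)
  qed
  define h where "h = (\<lambda>z. partial_deriv b f (A z))"
  have hc: "\<forall>k. Ck_on k (U \<times> W) h"
  proof
    fix k
    have "Ck_on k T (partial_deriv b f)" using T(3)[rule_format, of "Suc k"] b by simp
    show "Ck_on k (U \<times> W) h"
      unfolding h_def by (rule Ck_on_compose[OF opUW, of A T k]) (use AT Ac \<open>Ck_on k T _\<close> in auto)
  qed
  define q where "q x = integral {0..1} (\<lambda>t. h (x, t))" for x
  have "smooth_near p q"
    unfolding q_def
    by (rule smooth_near_open[OF U(1,3)], rule allI, rule Ck_on_integral[OF U(1,2) _ _ hc])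
      (auto simp: W_def)
  moreover have "f x - f (x - l x *\<^sub>R b) = l x * q x" if x: "x \<in> U" for x
  proof -
    have "((\<lambda>t. f (A (x, t))) has_vector_derivative l x * h (x, t)) (at t within {0..1})" if "t \<in> {0..1}" for t
    proof -
      have "A (x, t) \<in> T" using x that by (intro AT) (auto simp: W_def)
      then have f: "(f has_derivative (\<lambda>v. \<Sum>c\<in>Basis. (v \<bullet> c) * partial_deriv c f (A (x, t)))) (at (A (x, t)))"
        using T(3)[rule_format, of 1] by (intro Ck_on_has_derivative[of 0]) auto
      have "((\<lambda>t. A (x, t)) has_derivative (\<lambda>s. (s * l x) *\<^sub>R b)) (at t)"
        unfolding A_def by (auto intro!: derivative_eq_intros)
      from has_derivative_compose[OF this f]
      have "((\<lambda>t. f (A (x, t))) has_derivative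
          (\<lambda>s. \<Sum>c\<in>Basis. (((s * l x) *\<^sub>R b) \<bullet> c) * partial_deriv c f (A (x, t)))) (at t)" .
      moreover have "(\<Sum>c\<in>Basis. (((s * l x) *\<^sub>R b) \<bullet> c) * partial_deriv c f (A (x, t)))
          = s *\<^sub>R (l x * h (x, t))" for s
        using b by (simp add: inner_Basis h_def if_distrib if_distribR sum.delta cong: if_cong)
      ultimately show ?thesis
        by (auto simp: has_vector_derivative_def intro: has_derivative_at_withinI)
    qed
    then have "((\<lambda>t. l x * h (x, t)) has_integral (f (A (x, 1)) - f (A (x, 0)))) {0..1}"
      by (intro fundamental_theorem_of_calculus) auto
    then have "integral {0..1} (\<lambda>t. l x * h (x, t)) = f (A (x, 1)) - f (A (x, 0))"
      by (rule integral_unique)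
    then show ?thesis by (simp add: A_def q_def)
  qed
  then have "\<forall>\<^sub>F x in nhds p. f x - f (x - l x *\<^sub>R b) = l x * q x"
    using U(1,3) by (auto simp: eventually_nhds)
  \<comment> \<open>Since \<open>l p = 0\<close>, the segment over \<open>p\<close> is a single
    point and the integrand is constant.\<close>
  moreover have "q p = partial_deriv b f p"
    by (simp add: q_def h_def A_def l(2))
  ultimately show ?thesis using that by blast
qed

text \<open>The inverse function theorem yields a differentiable \<open>g\<close> whose derivative
  is the reciprocal of \<open>f'\<close> at \<open>g y\<close>. So if \<open>g\<close> is of order
  \<open>k\<close>, its derivative is too, and \<open>g\<close> is of order
  \<open>k + 1\<close>.\<close>

lemma smooth_inverse_function:
  fixes f :: "real \<Rightarrow> real"
  assumes f: "smooth_near a f" and nz: "partial_deriv 1 f a \<noteq> 0"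
  obtains g where "smooth_near (f a) g" "g (f a) = a"
    "\<forall>\<^sub>F x in nhds a. g (f x) = x" "\<forall>\<^sub>F y in nhds (f a). f (g y) = y"
proof -
  obtain S where S: "open S" "a \<in> S" "\<forall>k. Ck_on k S f" using f by (rule smooth_nearE)
  define F where "F x = partial_deriv 1 f x *\<^sub>R (id_blinfun :: real \<Rightarrow>\<^sub>L real)" for x
  have "(f has_derivative blinfun_apply (F x)) (at x)" if "x \<in> S" for x
  proof -
    have "blinfun_apply (F x) = (\<lambda>h. h * partial_deriv 1 f x)"
      by (simp add: F_def blinfun.scaleR_left mult.commute fun_eq_iff)
    then show ?thesis
      using Ck_on_has_derivative[OF S(3)[rule_format, of 1, unfolded One_nat_def] that] by simp
  qed
  moreover have "continuous_on S F"
    unfolding F_def using S(3)[rule_format, of 1] by (auto intro!: continuous_intros)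
  moreover have "(inverse (partial_deriv 1 f a) *\<^sub>R id_blinfun) o\<^sub>L F a = id_blinfun"
    using nz by (intro blinfun_eqI) (simp add: F_def blinfun.scaleR_left)
  ultimately have "\<exists>U' V g g'. open U' \<and> U' \<subseteq> S \<and> a \<in> U' \<and> open V \<and> f a \<in> V \<and> homeomorphism U' V f g \<and>
      (\<forall>y\<in>V. (g has_derivative (g' y)) (at y) \<and> g' y = inv (blinfun_apply (F (g y))) \<and>
        bij (blinfun_apply (F (g y))))"
    by (rule inverse_function_theorem[OF S(1) _ _ S(2)]) meson+
  then obtain U' V g g' where UV: "open U'" "U' \<subseteq> S" "a \<in> U'" "open V" "f a \<in> V"
      "homeomorphism U' V f g"
      "\<And>y. y \<in> V \<Longrightarrow> (g has_derivative (g' y)) (at y)"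
      "\<And>y. y \<in> V \<Longrightarrow> g' y = inv (blinfun_apply (F (g y)))"
      "\<And>y. y \<in> V \<Longrightarrow> bij (blinfun_apply (F (g y)))"
    by metis
  have gV: "g y \<in> U'" "f (g y) = y" if "y \<in> V" for y
    using UV(6) that by (auto simp: homeomorphism_def)
  have gU: "g (f x) = x" if "x \<in> U'" for x using UV(6) that by (auto simp: homeomorphism_def)
  have nzV: "partial_deriv 1 f (g y) \<noteq> 0" if "y \<in> V" for y
    using bij_is_inj[OF UV(9)[OF that]] by (auto simp: F_def inj_def blinfun.scaleR_left)
  have g': "g' y h = h * inverse (partial_deriv 1 f (g y))" if "y \<in> V" for y h
    unfolding UV(8)[OF that]
    by (rule inv_f_eq[OF bij_is_inj[OF UV(9)[OF that]]])
       (use nzV[OF that] in \<open>simp add: F_def blinfun.scaleR_left\<close>)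
  have "Ck_on k V g" for k
  proof (induction k)
    case 0
    show ?case using UV(6) by (auto simp: homeomorphism_def)
  next
    case (Suc k)
    have "Ck_on k S (partial_deriv 1 f)" using S(3)[rule_format, of "Suc k"] by simp
    then have "Ck_on k V (\<lambda>y. partial_deriv 1 f (g y))"
      using Ck_on_compose[of V g S k k "partial_deriv 1 f"] UV gV Ck_on_le[OF Suc.IH] by fastforce
    then have "Ck_on k V (\<lambda>y. inverse (partial_deriv 1 f (g y)))"
      using Ck_on_compose[OF UV(4), of "\<lambda>y. partial_deriv 1 f (g y)" "- {0}" k k inverse] nzV Ck_on_inverse
      by (fastforce intro: Ck_on_le)
    moreover have "Ck_on k V (\<lambda>y. g' y b)" if "Ck_on k V (\<lambda>y. b * inverse (partial_deriv 1 f (g y)))" for b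
      using that by (subst Ck_on_cong[OF UV(4)]) (auto simp: g')
    ultimately show ?case
      by (intro Ck_on_SucI[OF UV(4,7)]) (auto simp: UV(4) intro!: Ck_on_mult Ck_on_const)
  qed
  then have "smooth_near (f a) g" using UV by (intro smooth_near_open[of V]) auto
  moreover have "\<forall>\<^sub>F x in nhds a. g (f x) = x" using gU UV by (auto simp: eventually_nhds)
  moreover have "\<forall>\<^sub>F y in nhds (f a). f (g y) = y" using gV UV by (auto simp: eventually_nhds)
  ultimately show ?thesis using that gU UV by blast
qed

section \<open>Rules for partial derivatives\<close>

lemma partial_deriv_const: "partial_deriv b (\<lambda>x. c) x = 0"
  by (rule partial_deriv_eq[of _ "\<lambda>h. 0"]) simp

lemma partial_deriv_add:
  "f differentiable (at x) \<Longrightarrow> g differentiable (at x) \<Longrightarrow>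
    partial_deriv b (\<lambda>x. f x + g x) x = partial_deriv b f x + partial_deriv b g x"
  unfolding frechet_derivative_works
  by (drule (1) has_derivative_add, drule partial_deriv_eq) (auto simp: partial_deriv_def)

lemma partial_deriv_mult:
  "f differentiable (at x) \<Longrightarrow> g differentiable (at x) \<Longrightarrow>
    partial_deriv b (\<lambda>x. f x * g x) x = f x * partial_deriv b g x + partial_deriv b f x * g x"
  unfolding frechet_derivative_works
  by (drule (1) has_derivative_mult, drule partial_deriv_eq) (auto simp: partial_deriv_def)

lemma partial_deriv_cmult:
  "f differentiable (at x) \<Longrightarrow> partial_deriv b (\<lambda>x. c * f x) x = c * partial_deriv b f x"
  by (subst partial_deriv_mult) (auto simp: partial_deriv_const)

lemma partial_deriv_compose:
  fixes A :: "'a::euclidean_space \<Rightarrow> 'b::euclidean_space"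
  assumes "f differentiable (at (A x))"
    and "\<And>c. c \<in> Basis \<Longrightarrow> (\<lambda>x. A x \<bullet> c) differentiable (at x)"
  shows "partial_deriv b (\<lambda>x. f (A x)) x =
    (\<Sum>c\<in>Basis. partial_deriv c f (A x) * partial_deriv b (\<lambda>x. A x \<bullet> c) x)"
  using partial_deriv_eq[OF has_derivative_compose_components[OF assms]]
  unfolding partial_deriv_def[of b "\<lambda>x. A x \<bullet> c" for c] by simp

lemma partial_deriv_directional:
  assumes "f differentiable (at x)"
  shows "((\<lambda>t. f (x + t *\<^sub>R b)) has_real_derivative partial_deriv b f x) (at 0)"
proof -
  have lin: "linear (frechet_derivative f (at x))"
    using assms linear_frechet_derivative by blast
  have "((\<lambda>t. x + t *\<^sub>R b) has_derivative (\<lambda>t. t *\<^sub>R b)) (at 0)"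
    by (auto intro!: derivative_eq_intros)
  from has_derivative_compose[OF this, of f "frechet_derivative f (at x)"] assms show ?thesis
    by (simp add: frechet_derivative_works has_field_derivative_def partial_deriv_def
        linear_scale[OF lin] mult.commute[of _ "frechet_derivative f (at x) b"])
qed

lemma partial_deriv_eqI:
  assumes "f differentiable (at x)" "((\<lambda>t. f (x + t *\<^sub>R b)) has_real_derivative D) (at 0)"
  shows "partial_deriv b f x = D"
  using DERIV_unique partial_deriv_directional[OF assms(1)] assms(2) by blast

lemma partial_deriv_real:
  "(f has_real_derivative D) (at x) \<Longrightarrow> partial_deriv (1::real) f x = D"
  unfolding has_field_derivative_def by (drule partial_deriv_eq[where b = 1]) simp

lemma has_real_derivative_partial:
  fixes f :: "real \<Rightarrow> real"
  assumes "smooth_near x f"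
  shows "(f has_real_derivative partial_deriv 1 f x) (at x)"
  using has_derivative_partial_deriv[OF smooth_near_differentiable[OF assms]]
  by (simp add: has_field_derivative_def mult.commute[of _ "partial_deriv 1 f x"])

lemma has_derivative_partial_plane:
  assumes "smooth_near x f"
  shows "(f has_derivative (\<lambda>h. fst h * \<partial>\<^sub>1 f x + snd h * \<partial>\<^sub>2 f x)) (at x)"
proof -
  have "(\<Sum>b\<in>Basis. (h \<bullet> b) * partial_deriv b f x) = fst h * \<partial>\<^sub>1 f x + snd h * \<partial>\<^sub>2 f x" for h
    by (subst sum_Basis_prod) (simp add: inner_prod_def)
  with has_derivative_partial_deriv[OF smooth_near_differentiable[OF assms]] show ?thesis by simp
qed

lemma Basis_plane: "(1, 0) \<in> (Basis :: (real \<times> real) set)" "(0, 1) \<in> (Basis :: (real \<times> real) set)"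
  by (auto simp: Basis_prod_def)

lemma smooth_near_partial_plane [smooth]:
  "smooth_near p f \<Longrightarrow> smooth_near p (\<partial>\<^sub>1 f)" "smooth_near p f \<Longrightarrow> smooth_near p (\<partial>\<^sub>2 f)"
  using Basis_plane by auto

lemma smooth_near_partial_line [smooth]:
  "smooth_near p f \<Longrightarrow> smooth_near p (partial_deriv (1::real) f)"
  by auto

lemma hadamard_snd:
  assumes f: "smooth_near (a, b) f"
  obtains q where "smooth_near (a, b) q"
    "\<forall>\<^sub>F x in nhds (a, b). f x = f (fst x, b) + (snd x - b) * q x" "q (a, b) = \<partial>\<^sub>2 f (a, b)"
proof -
  have "smooth_near (a, b) (\<lambda>x. snd x - b)" by (intro smooth)
  then obtain q where q: "smooth_near (a, b) q" "q (a, b) = \<partial>\<^sub>2 f (a, b)"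
    "\<forall>\<^sub>F x in nhds (a, b). f x - f (x - (snd x - b) *\<^sub>R (0, 1)) = (snd x - b) * q x"
    using hadamard[OF f, of "\<lambda>x. snd x - b" "(0, 1)"] Basis_plane by auto
  have "\<forall>\<^sub>F x in nhds (a, b). f x = f (fst x, b) + (snd x - b) * q x"
    using q(3) by eventually_elim (auto simp: algebra_simps scaleR_prod_def minus_prod_def case_prod_beta)
  with q that show ?thesis by blast
qed

lemma eventually_nhds_compose:
  assumes "isCont A p" "\<forall>\<^sub>F y in nhds (A p). P y"
  shows "\<forall>\<^sub>F x in nhds p. P (A x)"
proof -
  have "filterlim A (nhds (A p)) (nhds p)"
    using assms(1) by (metis isCont_def tendsto_at_iff_tendsto_nhds)
  then show ?thesis using assms(2) by (rule eventually_compose_filterlim[rotated])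
qed

text \<open>Write \<open>f x = f (x1, c) + (x2 - c) * q x\<close> with \<open>q\<close> smooth. Both
  mixed derivatives at \<open>p\<close> equal \<open>\<partial>\<^sub>1 q p\<close>, since the terms
  that retain the factor \<open>x2 - c\<close> vanish there.\<close>

lemma partial_deriv_commute:
  assumes f: "smooth_near p f"
  shows "\<partial>\<^sub>2 (\<partial>\<^sub>1 f) p = \<partial>\<^sub>1 (\<partial>\<^sub>2 f) p"
proof -
  obtain a c where p: "p = (a, c)" by (cases p)
  obtain q where q: "smooth_near p q" "\<forall>\<^sub>F x in nhds p. f x = f (fst x, c) + (snd x - c) * q x"
    using hadamard_snd[of a c f] f p by auto
  have restr: "smooth_near p (\<lambda>x. g (fst x, c))" if "smooth_near p g" for g
    by (rule smooth_near_compose_pair) (use that p in \<open>auto intro: smooth\<close>)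
  have "\<forall>\<^sub>F x in nhds p. smooth_near (fst x, c) f"
    by (rule eventually_nhds_compose[where A = "\<lambda>x. (fst x, c)"])
       (use smooth_near_eventually[OF f] p in \<open>auto intro!: continuous_intros\<close>)
  note ev = q(2) smooth_near_eventually[OF restr[OF f]] smooth_near_eventually[OF q(1)] this
  have shift: "smooth_near x (\<lambda>x. snd x - c)" "\<partial>\<^sub>1 (\<lambda>x. snd x - c) x = 0" "\<partial>\<^sub>2 (\<lambda>x. snd x - c) x = 1"
    for x :: "real \<times> real"
    by (auto intro!: smooth partial_deriv_eq[of _ snd, THEN trans] derivative_eq_intros)
  have const: "\<partial>\<^sub>2 (\<lambda>x. g (fst x, c)) x = 0" if "smooth_near x (\<lambda>x. g (fst x, c))" for x and g :: "real \<times> real \<Rightarrow> real"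
    using smooth_near_differentiable[OF that] by (rule partial_deriv_eqI) simp
  have D1: "\<forall>\<^sub>F x in nhds p. \<partial>\<^sub>1 f x = \<partial>\<^sub>1 f (fst x, c) + (snd x - c) * \<partial>\<^sub>1 q x"
    using eventually_partial_deriv_cong[OF ev(1), of "(1, 0)"] ev(2-)
  proof eventually_elim
    case (elim x)
    have "\<partial>\<^sub>1 (\<lambda>x. f (fst x, c)) x = \<partial>\<^sub>1 f (fst x, c)"
      using partial_deriv_directional[OF smooth_near_differentiable[OF elim(4)], of "(1, 0)"]
      by (intro partial_deriv_eqI smooth_near_differentiable[OF elim(2)]) simp
    with elim show ?case
      by (simp add: partial_deriv_add partial_deriv_mult smooth_near_differentiable smooth shift)
  qed
  have D2: "\<forall>\<^sub>F x in nhds p. \<partial>\<^sub>2 f x = (snd x - c) * \<partial>\<^sub>2 q x + q x"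
    using eventually_partial_deriv_cong[OF ev(1), of "(0, 1)"] ev(2-)
    by eventually_elim
      (simp add: partial_deriv_add partial_deriv_mult smooth_near_differentiable smooth shift const)
  have "\<partial>\<^sub>2 (\<partial>\<^sub>1 f) p = \<partial>\<^sub>1 q p"
    unfolding partial_deriv_cong[OF D1] using restr[OF smooth_near_partial_plane(1)[OF f]] p q(1)
    by (simp add: partial_deriv_add partial_deriv_mult smooth_near_differentiable smooth shift const)
  also have "\<dots> = \<partial>\<^sub>1 (\<partial>\<^sub>2 f) p"
    unfolding partial_deriv_cong[OF D2] using p q(1)
    by (simp add: partial_deriv_add partial_deriv_mult smooth_near_differentiable smooth shift)
  finally show ?thesis .
qed

section \<open>Flat functions and vanishing orders\<close>

lemma flat_at_iff: "flat_at f p \<longleftrightarrow> (\<forall>bs. set bs \<subseteq> Basis \<longrightarrow> foldr partial_deriv bs f p = 0)"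
  by (auto simp: flat_at_def finite_type_at_def)

lemma flat_at_zero: "flat_at f p \<Longrightarrow> f p = 0"
  using flat_at_iff[of f p] by (auto dest: spec[of _ "[]"])

lemma flat_at_partial:
  fixes p :: "'a::euclidean_space"
  shows "flat_at f p \<Longrightarrow> b \<in> Basis \<Longrightarrow> flat_at (partial_deriv b f) p"
  unfolding flat_at_iff
proof (intro allI impI)
  fix bs :: "'a list"
  assume *: "\<forall>bs. set bs \<subseteq> Basis \<longrightarrow> foldr partial_deriv bs f p = 0" "b \<in> Basis" "set bs \<subseteq> Basis"
  show "foldr partial_deriv bs (partial_deriv b f) p = 0"
    using *(1)[rule_format, of "bs @ [b]"] *(2,3) by simp
qed

lemma eventually_foldr_partial_deriv_cong:
  "\<forall>\<^sub>F x in nhds p. f x = g x \<Longrightarrow> \<forall>\<^sub>F x in nhds p. foldr partial_deriv bs f x = foldr partial_deriv bs g x"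
  by (induction bs) (auto intro: eventually_partial_deriv_cong)

lemma flat_at_cong:
  assumes "\<forall>\<^sub>F x in nhds p. f x = g x"
  shows "flat_at f p \<longleftrightarrow> flat_at g p"
  using eventually_foldr_partial_deriv_cong[OF assms, THEN eventually_nhds_x_imp_x]
  by (simp add: flat_at_iff)

lemma flat_at_transfer: "flat_at f p \<Longrightarrow> \<forall>\<^sub>F x in nhds p. f x = g x \<Longrightarrow> flat_at g p"
  using flat_at_cong by blast

lemma foldr_partial_deriv_add:
  "set bs \<subseteq> Basis \<Longrightarrow> smooth_near p f \<Longrightarrow> smooth_near p g \<Longrightarrow>
    foldr partial_deriv bs (\<lambda>x. f x + g x) p = foldr partial_deriv bs f p + foldr partial_deriv bs g p"
\<comment> \<open>\<open>foldr\<close> applies the last direction of the list first, hence the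
  induction from the right end.\<close>
proof (induction bs arbitrary: f g rule: rev_induct)
  case (snoc b bs)
  have "\<forall>\<^sub>F x in nhds p. partial_deriv b (\<lambda>x. f x + g x) x = partial_deriv b f x + partial_deriv b g x"
    using smooth_near_eventually[OF snoc.prems(2)] smooth_near_eventually[OF snoc.prems(3)]
    by eventually_elim (auto intro: partial_deriv_add smooth_near_differentiable)
  from eventually_foldr_partial_deriv_cong[OF this, THEN eventually_nhds_x_imp_x]
  show ?case using snoc by auto
qed auto

lemma flat_at_add:
  "flat_at f p \<Longrightarrow> flat_at g p \<Longrightarrow> smooth_near p f \<Longrightarrow> smooth_near p g \<Longrightarrow> flat_at (\<lambda>x. f x + g x) p"
  by (simp add: flat_at_iff foldr_partial_deriv_add)

lemma foldr_partial_deriv_sum: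
  assumes "set bs \<subseteq> Basis"
  shows "finite I \<Longrightarrow> (\<And>i. i \<in> I \<Longrightarrow> smooth_near p (f i)) \<Longrightarrow>
    (\<And>i. i \<in> I \<Longrightarrow> foldr partial_deriv bs (f i) p = 0) \<Longrightarrow>
    foldr partial_deriv bs (\<lambda>x. \<Sum>i\<in>I. f i x) p = 0"
proof (induction I rule: finite_induct)
  case empty
  have "foldr partial_deriv bs (\<lambda>x. 0) = (\<lambda>x. 0)"
    by (induction bs) (auto simp: partial_deriv_const)
  then show ?case by simp
next
  case (insert i I)
  then show ?case using assms by (simp add: foldr_partial_deriv_add smooth)
qed

text \<open>The factor \<open>g\<close> makes the induction close: a derivative of
  \<open>f (A x) * g x\<close> is a sum of terms of the same shape, whose outer function is
  \<open>f\<close> or a partial derivative of \<open>f\<close>, again flat, with new smooth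
  factors.\<close>

lemma flat_at_compose_mult:
  fixes A :: "'a::euclidean_space \<Rightarrow> 'b::euclidean_space"
  assumes A: "\<And>c. c \<in> Basis \<Longrightarrow> smooth_near p (\<lambda>x. A x \<bullet> c)"
    and "flat_at f (A p)" "smooth_near (A p) f" "smooth_near p g"
  shows "flat_at (\<lambda>x. f (A x) * g x) p"
proof -
  have "foldr partial_deriv bs (\<lambda>x. f (A x) * g x) p = 0" if "set bs \<subseteq> Basis" for bs
    using that assms(2-)
  proof (induction bs arbitrary: f g rule: rev_induct)
    case Nil
    then show ?case by (simp add: flat_at_zero)
  next
    case (snoc b bs)
    have b: "b \<in> Basis" "set bs \<subseteq> Basis" using snoc.prems by auto
    have contA: "isCont A p"
      by (subst continuous_componentwise) (use smooth_near_isCont[OF A] in auto)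
    have smA: "\<forall>\<^sub>F x in nhds p. \<forall>c\<in>Basis. smooth_near x (\<lambda>x. A x \<bullet> c)"
      by (intro eventually_ball_finite) (auto intro!: smooth_near_eventually A)
    have smf: "smooth_near p (\<lambda>x. f (A x))"
      by (rule smooth_near_compose) (use snoc.prems A in auto)
    have smpf: "smooth_near p (\<lambda>x. partial_deriv c f (A x))" if "c \<in> Basis" for c
      by (rule smooth_near_compose) (use snoc.prems A that in auto)
    let ?F = "\<lambda>c x. partial_deriv c f (A x) * (partial_deriv b (\<lambda>x. A x \<bullet> c) x * g x)"
    have "\<forall>\<^sub>F x in nhds p. partial_deriv b (\<lambda>x. f (A x) * g x) x
        = (\<Sum>c\<in>Basis. ?F c x) + f (A x) * partial_deriv b g x"
      using smA eventually_nhds_compose[OF contA smooth_near_eventually[OF snoc.prems(3)]]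
        smooth_near_eventually[OF snoc.prems(4)]
    proof eventually_elim
      case (elim x)
      have "smooth_near x (\<lambda>x. f (A x))" by (rule smooth_near_compose) (use elim in auto)
      with elim show ?case
        by (simp add: partial_deriv_mult partial_deriv_compose smooth_near_differentiable
            sum_distrib_right mult.assoc)
    qed
    from eventually_foldr_partial_deriv_cong[OF this, THEN eventually_nhds_x_imp_x, of bs]
    have "foldr partial_deriv (bs @ [b]) (\<lambda>x. f (A x) * g x) p =
        foldr partial_deriv bs (\<lambda>x. (\<Sum>c\<in>Basis. ?F c x) + f (A x) * partial_deriv b g x) p"
      by simp
    also have "\<dots> = foldr partial_deriv bs (\<lambda>x. \<Sum>c\<in>Basis. ?F c x) p +
        foldr partial_deriv bs (\<lambda>x. f (A x) * partial_deriv b g x) p"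
      using snoc.prems b smf smpf
      by (intro foldr_partial_deriv_add smooth A smooth_near_partial) auto
    also have "foldr partial_deriv bs (\<lambda>x. f (A x) * partial_deriv b g x) p = 0"
      using snoc.prems b by (intro snoc.IH) auto
    also have "foldr partial_deriv bs (\<lambda>x. \<Sum>c\<in>Basis. ?F c x) p = 0"
      using snoc.prems b
      by (intro foldr_partial_deriv_sum snoc.IH flat_at_partial smooth smpf A smooth_near_partial) auto
    finally show ?case by simp
  qed
  then show ?thesis by (simp add: flat_at_iff)
qed

lemma flat_at_compose:
  fixes A :: "'a::euclidean_space \<Rightarrow> 'b::euclidean_space"
  assumes "\<And>c. c \<in> Basis \<Longrightarrow> smooth_near p (\<lambda>x. A x \<bullet> c)"
    and "flat_at f (A p)" "smooth_near (A p) f"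
  shows "flat_at (\<lambda>x. f (A x)) p"
  using flat_at_compose_mult[OF assms smooth_near_const[of p 1]] by simp

lemma flat_at_mult:
  assumes "flat_at f p" "smooth_near p f" "smooth_near p g"
  shows "flat_at (\<lambda>x. f x * g x) p"
  using flat_at_compose_mult[of p "\<lambda>x. x" f g] assms by (simp add: smooth)

section \<open>Orders of vanishing in one variable\<close>

abbreviation line_deriv :: "(real \<Rightarrow> real) \<Rightarrow> real \<Rightarrow> real"  ("\<D>")
  where "\<D> \<equiv> partial_deriv (1::real)"

lemma foldr_line_deriv: "set bs \<subseteq> Basis \<Longrightarrow> foldr partial_deriv bs f = (\<D> ^^ length bs) f"
  by (induction bs) auto

lemma flat_at_line_iff: "flat_at f p \<longleftrightarrow> (\<forall>n. (\<D> ^^ n) f p = 0)"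
proof
  assume "flat_at f p"
  then show "\<forall>n. (\<D> ^^ n) f p = 0"
    by (auto simp: flat_at_iff foldr_line_deriv dest: spec[of _ "replicate n 1" for n])
qed (auto simp: flat_at_iff foldr_line_deriv)

lemma smooth_near_line_deriv_pow: "smooth_near p f \<Longrightarrow> smooth_near p ((\<D> ^^ n) f)"
  by (induction n) (auto intro: smooth)

text \<open>Leibniz rule for the factor \<open>y - p\<close>. At \<open>y = p\<close> only a
  multiple of the n-th derivative of \<open>q\<close> remains; \<open>order_cases\<close> uses this
  to descend from \<open>f\<close> to \<open>q\<close>.\<close>

lemma line_deriv_pow_shift_mult:
  assumes "smooth_near p q"
  shows "\<forall>\<^sub>F y in nhds p. (\<D> ^^ Suc n) (\<lambda>y. (y - p) * q y) y =
    (y - p) * (\<D> ^^ Suc n) q y + real (Suc n) * (\<D> ^^ n) q y"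
proof (induction n)
  case 0
  show ?case using smooth_near_eventually[OF assms]
  proof eventually_elim
    case (elim y)
    show ?case
      by (simp, rule partial_deriv_real)
         (auto intro!: derivative_eq_intros has_real_derivative_partial[OF elim])
  qed
next
  case (Suc n)
  show ?case
    using eventually_partial_deriv_cong[OF Suc.IH, of 1]
      smooth_near_eventually[OF smooth_near_line_deriv_pow[OF assms, of n]]
      smooth_near_eventually[OF smooth_near_line_deriv_pow[OF assms, of "Suc n"]]
  proof eventually_elim
    case (elim y)
    have "\<D> (\<lambda>y. (y - p) * (\<D> ^^ Suc n) q y + real (Suc n) * (\<D> ^^ n) q y) y =
       (y - p) * (\<D> ^^ Suc (Suc n)) q y + (\<D> ^^ Suc n) q y + real (Suc n) * (\<D> ^^ Suc n) q y"
      using has_real_derivative_partial[OF elim(2)] has_real_derivative_partial[OF elim(3)]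
      by (intro partial_deriv_real) (auto intro!: derivative_eq_intros)
    with elim(1) show ?case by (simp add: algebra_simps)
  qed
qed

text \<open>The order is encoded by a smooth cofactor instead of derivatives: pulled back to the
  plane, the cofactor yields the nonvanishing function \<open>r\<close>, \<open>r\<^sub>2\<close> or
  \<open>q\<close> of a normal form.\<close>

definition ord_at :: "real \<Rightarrow> nat \<Rightarrow> (real \<Rightarrow> real) \<Rightarrow> bool"
  where "ord_at p k f \<longleftrightarrow> (\<exists>r. smooth_nonzero_near p r \<and> (\<forall>\<^sub>F y in nhds p. f y = (y - p) ^ k * r y))"

text \<open>Here the cofactor may vanish or be flat; this serves for remainder terms.\<close>

definition ord_ge :: "real \<Rightarrow> nat \<Rightarrow> (real \<Rightarrow> real) \<Rightarrow> bool"
  where "ord_ge p k f \<longleftrightarrow> (\<exists>r. smooth_near p r \<and> (\<forall>\<^sub>F y in nhds p. f y = (y - p) ^ k * r y))"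

lemma hadamard_line:
  assumes "smooth_near p f"
  obtains q where "smooth_near p q" "\<forall>\<^sub>F y in nhds p. f y = f p + (y - p) * q y" "q p = \<D> f p"
proof -
  have "smooth_near p (\<lambda>y. y - p)" by (intro smooth)
  then obtain q where q: "smooth_near p q" "q p = \<D> f p"
    "\<forall>\<^sub>F y in nhds p. f y - f (y - (y - p) *\<^sub>R 1) = (y - p) * q y"
    using hadamard[OF assms, of "\<lambda>y. y - p" 1] by auto
  from q(3) have "\<forall>\<^sub>F y in nhds p. f y = f p + (y - p) * q y"
    by eventually_elim (simp add: algebra_simps)
  with q that show ?thesis by blast
qed

lemma smooth_near_ord_ge_0: "smooth_near p f \<Longrightarrow> ord_ge p 0 f"
  by (auto simp: ord_ge_def)

lemma smooth_near_ord_ge_1: "smooth_near p f \<Longrightarrow> f p = 0 \<Longrightarrow> ord_ge p 1 f"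
  by (rule hadamard_line) (auto simp: ord_ge_def)

lemma ord_at_imp_ge: "ord_at p k f \<Longrightarrow> ord_ge p k f"
  by (auto simp: ord_at_def ord_ge_def smooth_nonzero_near_def)

lemma ord_ge_mono: "ord_ge p k f \<Longrightarrow> j \<le> k \<Longrightarrow> ord_ge p j f"
  unfolding ord_ge_def
proof (elim exE conjE)
  fix r assume *: "smooth_near p r" "\<forall>\<^sub>F y in nhds p. f y = (y - p) ^ k * r y" "j \<le> k"
  show "\<exists>r. smooth_near p r \<and> (\<forall>\<^sub>F y in nhds p. f y = (y - p) ^ j * r y)"
    using *(2) by (intro exI[of _ "\<lambda>y. (y - p) ^ (k - j) * r y"] conjI smooth *(1))
      (use *(3) in \<open>auto elim!: eventually_mono simp flip: power_add mult.assoc\<close>)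
qed

lemma ord_ge_mult: "ord_ge p j f \<Longrightarrow> ord_ge p k g \<Longrightarrow> ord_ge p (j + k) (\<lambda>y. f y * g y)"
  unfolding ord_ge_def
proof (elim exE conjE)
  fix r s assume *: "smooth_near p r" "\<forall>\<^sub>F y in nhds p. f y = (y - p) ^ j * r y"
    "smooth_near p s" "\<forall>\<^sub>F y in nhds p. g y = (y - p) ^ k * s y"
  show "\<exists>r. smooth_near p r \<and> (\<forall>\<^sub>F y in nhds p. f y * g y = (y - p) ^ (j + k) * r y)"
    using *(2,4) by (intro exI[of _ "\<lambda>y. r y * s y"] conjI smooth * , eventually_elim) (simp add: power_add)
qed

lemma ord_ge_add: "ord_ge p k f \<Longrightarrow> ord_ge p k g \<Longrightarrow> ord_ge p k (\<lambda>y. f y + g y)"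
  unfolding ord_ge_def
proof (elim exE conjE)
  fix r s assume *: "smooth_near p r" "\<forall>\<^sub>F y in nhds p. f y = (y - p) ^ k * r y"
    "smooth_near p s" "\<forall>\<^sub>F y in nhds p. g y = (y - p) ^ k * s y"
  show "\<exists>r. smooth_near p r \<and> (\<forall>\<^sub>F y in nhds p. f y + g y = (y - p) ^ k * r y)"
    using *(2,4) by (intro exI[of _ "\<lambda>y. r y + s y"] conjI smooth * , eventually_elim) (simp add: algebra_simps)
qed

lemma ord_at_mult: "ord_at p j f \<Longrightarrow> ord_at p k g \<Longrightarrow> ord_at p (j + k) (\<lambda>y. f y * g y)"
  unfolding ord_at_def
proof (elim exE conjE)
  fix r s assume *: "smooth_nonzero_near p r" "\<forall>\<^sub>F y in nhds p. f y = (y - p) ^ j * r y"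
    "smooth_nonzero_near p s" "\<forall>\<^sub>F y in nhds p. g y = (y - p) ^ k * s y"
  show "\<exists>r. smooth_nonzero_near p r \<and> (\<forall>\<^sub>F y in nhds p. f y * g y = (y - p) ^ (j + k) * r y)"
    using *(2,4) by (intro exI[of _ "\<lambda>y. r y * s y"] conjI smooth_nonzero_near_mult * , eventually_elim)
      (simp add: power_add)
qed

lemma ord_at_0I: "smooth_near p f \<Longrightarrow> f p \<noteq> 0 \<Longrightarrow> ord_at p 0 f"
  by (auto simp: ord_at_def smooth_nonzero_near_def)

lemma ord_at_add_ge: "ord_at p k f \<Longrightarrow> ord_ge p (Suc k) g \<Longrightarrow> ord_at p k (\<lambda>y. f y + g y)"
  unfolding ord_at_def ord_ge_def
proof (elim exE conjE)
  fix r s assume *: "smooth_nonzero_near p r" "\<forall>\<^sub>F y in nhds p. f y = (y - p) ^ k * r y"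
    "smooth_near p s" "\<forall>\<^sub>F y in nhds p. g y = (y - p) ^ Suc k * s y"
  have "smooth_nonzero_near p (\<lambda>y. r y + (y - p) * s y)"
    using * by (auto simp: smooth_nonzero_near_def intro!: smooth)
  moreover have "\<forall>\<^sub>F y in nhds p. f y + g y = (y - p) ^ k * (r y + (y - p) * s y)"
    using *(2,4) by eventually_elim (simp add: algebra_simps)
  ultimately show "\<exists>r. smooth_nonzero_near p r \<and> (\<forall>\<^sub>F y in nhds p. f y + g y = (y - p) ^ k * r y)"
    by blast
qed

lemma ord_at_cong:
  assumes "ord_at p k f" "\<forall>\<^sub>F y in nhds p. f y = g y"
  shows "ord_at p k g"
proof -
  obtain r where r: "smooth_nonzero_near p r" "\<forall>\<^sub>F y in nhds p. f y = (y - p) ^ k * r y"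
    using assms(1) by (auto simp: ord_at_def)
  from r(2) assms(2) have "\<forall>\<^sub>F y in nhds p. g y = (y - p) ^ k * r y" by eventually_elim simp
  with r(1) show ?thesis by (auto simp: ord_at_def)
qed

lemma ord_at_deriv: "ord_at p (Suc k) f \<Longrightarrow> ord_at p k (\<D> f)"
proof -
  assume "ord_at p (Suc k) f"
  then obtain r where r: "smooth_near p r" "r p \<noteq> 0" "\<forall>\<^sub>F y in nhds p. f y = (y - p) ^ Suc k * r y"
    by (auto simp: ord_at_def smooth_nonzero_near_def)
  have "\<forall>\<^sub>F y in nhds p. \<D> f y = (y - p) ^ k * (real (Suc k) * r y + (y - p) * \<D> r y)"
    using eventually_partial_deriv_cong[OF r(3), of 1] smooth_near_eventually[OF r(1)]
  proof eventually_elim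
    case (elim y)
    have "\<D> (\<lambda>y. (y - p) ^ Suc k * r y) y = (y - p) ^ k * (real (Suc k) * r y + (y - p) * \<D> r y)"
    proof (rule partial_deriv_real)
      have "((\<lambda>y. (y - p) ^ Suc k) has_real_derivative real (Suc k) * (y - p) ^ k) (at y)"
      proof -
        have "((\<lambda>y. y - p) has_real_derivative 1) (at y)" by (auto intro!: derivative_eq_intros)
        from DERIV_power[OF this, of "Suc k"] show ?thesis by (simp del: power_Suc)
      qed
      from DERIV_mult[OF this has_real_derivative_partial[OF elim(2)]]
      show "((\<lambda>y. (y - p) ^ Suc k * r y) has_real_derivative
          (y - p) ^ k * (real (Suc k) * r y + (y - p) * \<D> r y)) (at y)"
        by (simp only: power_Suc) (simp only: algebra_simps)
    qed
    with elim show ?case by simp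
  qed
  moreover have "smooth_nonzero_near p (\<lambda>y. real (Suc k) * r y + (y - p) * \<D> r y)"
    using r by (auto simp: smooth_nonzero_near_def simp del: of_nat_Suc intro!: smooth)
  ultimately show ?thesis by (auto simp: ord_at_def)
qed

lemma ord_at_not_flat: "ord_at p k f \<Longrightarrow> \<not> flat_at f p"
proof (induction k arbitrary: f)
  case 0
  then obtain r where "r p \<noteq> 0" "\<forall>\<^sub>F y in nhds p. f y = r y"
    by (auto simp: ord_at_def smooth_nonzero_near_def)
  then show ?case using eventually_nhds_x_imp_x[of "\<lambda>y. f y = r y" p] flat_at_zero[of f p] by auto
next
  case (Suc k)
  then show ?case using ord_at_deriv[OF Suc.prems] flat_at_partial[of f p 1] by auto
qed

text \<open>If some derivative is nonzero at \<open>p\<close>, then either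
  \<open>f p \<noteq> 0\<close>, or \<open>f\<close> is divisible by \<open>y - p\<close> and the
  quotient has a nonzero derivative of order one less.\<close>

lemma order_cases:
  assumes "smooth_near p f"
  obtains "flat_at f p" | k where "ord_at p k f"
proof -
  have "\<exists>k. ord_at p k f" if "(\<D> ^^ n) f p \<noteq> 0" "smooth_near p f" for n f
    using that
  proof (induction n arbitrary: f)
    case 0
    then show ?case using ord_at_0I by auto
  next
    case (Suc n)
    show ?case
    proof (cases "f p = 0")
      case False
      then show ?thesis using ord_at_0I Suc.prems by auto
    next
      case True
      then obtain q where q: "smooth_near p q" "\<forall>\<^sub>F y in nhds p. f y = (y - p) * q y"
        using hadamard_line[OF Suc.prems(2)] by auto
      have "foldr partial_deriv (replicate (Suc n) (1::real)) f p
          = foldr partial_deriv (replicate (Suc n) 1) (\<lambda>y. (y - p) * q y) p"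
        by (rule eventually_nhds_x_imp_x[OF eventually_foldr_partial_deriv_cong[OF q(2)]])
      then have "(\<D> ^^ Suc n) f p = (\<D> ^^ Suc n) (\<lambda>y. (y - p) * q y) p"
        by (subst (asm) (1 2) foldr_line_deriv) auto
      also have "\<dots> = real (Suc n) * (\<D> ^^ n) q p"
        using eventually_nhds_x_imp_x[OF line_deriv_pow_shift_mult[OF q(1), of n]] by simp
      finally obtain k where "ord_at p k q" using Suc.prems(1) Suc.IH[of q] q(1) by auto
      then have "ord_at p (1 + k) (\<lambda>y. (y - p) * q y)"
        by (intro ord_at_mult) (auto simp: ord_at_def smooth_nonzero_near_def intro!: smooth exI[of _ "\<lambda>_. 1"])
      then have "ord_at p (1 + k) f"
        by (rule ord_at_cong) (use q(2) in \<open>auto elim: eventually_mono\<close>)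
      then show ?thesis by blast
    qed
  qed
  then show ?thesis using that assms unfolding flat_at_line_iff by blast
qed

lemma ord_at_zero_iff: "ord_at p k f \<Longrightarrow> f p = 0 \<longleftrightarrow> k > 0"
  unfolding ord_at_def smooth_nonzero_near_def
  by (auto dest!: eventually_nhds_x_imp_x simp: power_0_left split: if_splits)

lemma ord_at_ge_2:
  assumes "ord_at p k f" "f p = 0" "\<D> f p = 0"
  shows "k \<ge> 2"
proof -
  obtain j where k: "k = Suc j" using ord_at_zero_iff[OF assms(1)] assms(2) by (cases k) auto
  then have "j > 0" using ord_at_zero_iff[OF ord_at_deriv] assms k by metis
  then show ?thesis using k by simp
qed

lemma ord_ge_cases:
  assumes "ord_ge p k f"
  obtains "flat_at f p" | j where "ord_at p (k + j) f"
proof -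
  obtain r where r: "smooth_near p r" "\<forall>\<^sub>F y in nhds p. f y = (y - p) ^ k * r y"
    using assms by (auto simp: ord_ge_def)
  from r(1) show ?thesis
  proof (cases rule: order_cases)
    case 1
    have "flat_at (\<lambda>y. r y * (y - p) ^ k) p"
      by (intro flat_at_mult 1 r smooth)
    then have "flat_at f p"
      using flat_at_cong[OF r(2)] by (simp add: mult.commute)
    then show ?thesis using that by blast
  next
    case (2 j)
    have "ord_at p k (\<lambda>y. (y - p) ^ k)"
      by (auto simp: ord_at_def smooth_nonzero_near_def intro!: smooth exI[of _ "\<lambda>_. 1"])
    from ord_at_mult[OF this 2] have "ord_at p (k + j) f"
      by (rule ord_at_cong) (use r(2) in \<open>auto elim: eventually_mono\<close>)
    then show ?thesis using that by blast
  qed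
qed

section \<open>Linear changes of coordinates\<close>

definition ldet :: "(real \<times> real \<Rightarrow> real \<times> real) \<Rightarrow> real"
  where "ldet L = fst (L (1, 0)) * snd (L (0, 1)) - snd (L (1, 0)) * fst (L (0, 1))"

lemma linear_plane:
  assumes "linear (L :: real \<times> real \<Rightarrow> real \<times> real)"
  shows "L x = fst x *\<^sub>R L (1, 0) + snd x *\<^sub>R L (0, 1)"
proof -
  have "L x = L (fst x *\<^sub>R (1, 0) + snd x *\<^sub>R (0, 1))" by simp
  then show ?thesis by (simp only: linear_add[OF assms] linear_scale[OF assms])
qed

lemma linear_plane_fst: "linear L \<Longrightarrow> fst (L x) = fst x * fst (L (1, 0)) + snd x * fst (L (0, 1))"
  and linear_plane_snd: "linear L \<Longrightarrow> snd (L x) = fst x * snd (L (1, 0)) + snd x * snd (L (0, 1))"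
  for L :: "real \<times> real \<Rightarrow> real \<times> real"
  using arg_cong[OF linear_plane[of L x], of fst] arg_cong[OF linear_plane[of L x], of snd] by auto

text \<open>The preimages of the basis vectors are the columns of the inverse matrix, and the two
  determinants multiply to 1.\<close>

lemma ldet_nonzero:
  assumes "linear L" "bij L"
  shows "ldet L \<noteq> 0"
proof -
  obtain p q where pq: "L p = (1, 0)" "L q = (0, 1)" using assms(2) by (metis bij_pointE)
  have "fst p * fst (L (1, 0)) + snd p * fst (L (0, 1)) = 1" "fst p * snd (L (1, 0)) + snd p * snd (L (0, 1)) = 0"
    "fst q * fst (L (1, 0)) + snd q * fst (L (0, 1)) = 0" "fst q * snd (L (1, 0)) + snd q * snd (L (0, 1)) = 1"
    using linear_plane_fst[OF assms(1), of p] linear_plane_snd[OF assms(1), of p]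
      linear_plane_fst[OF assms(1), of q] linear_plane_snd[OF assms(1), of q] pq by simp_all
  then have "ldet L * (fst p * snd q - snd p * fst q) = 1"
    unfolding ldet_def by algebra
  then show ?thesis by auto
qed

lemma smooth_near_linear [smooth]:
  fixes L :: "real \<times> real \<Rightarrow> real \<times> real"
  assumes "linear L"
  shows "smooth_near p (\<lambda>x. fst (L x))" "smooth_near p (\<lambda>x. snd (L x))"
  by (subst linear_plane_fst[OF assms] linear_plane_snd[OF assms], intro smooth)+

lemma isCont_linear_plane: "linear (L :: real \<times> real \<Rightarrow> real \<times> real) \<Longrightarrow> isCont (\<lambda>x. v + L x) x"
  by (intro continuous_intros linear_continuous_at) (simp add: linear_conv_bounded_linear)

lemma smooth_near_affine_compose:
  fixes v :: "real \<times> real" and L :: "real \<times> real \<Rightarrow> real \<times> real"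
  assumes "linear L" "smooth_near (v + L x) f"
  shows "smooth_near x (\<lambda>x. f (v + L x))"
  using smooth_near_compose_pair[of "\<lambda>x. fst v + fst (L x)" x "\<lambda>x. snd v + snd (L x)" f]
    assms smooth_near_linear[OF assms(1)] by (simp add: smooth plus_prod_def)

lemma partial_deriv_affine_compose:
  assumes "linear L" "smooth_near (v + L x) f"
  shows "partial_deriv b (\<lambda>x. f (v + L x)) x =
    fst (L b) * \<partial>\<^sub>1 f (v + L x) + snd (L b) * \<partial>\<^sub>2 f (v + L x)"
proof -
  have "((\<lambda>x. v + L x) has_derivative L) (at x)"
    using assms(1) by (auto intro!: derivative_eq_intros linear_imp_has_derivative)
  from has_derivative_compose[OF this has_derivative_partial_plane[OF assms(2)]]
  show ?thesis by (rule partial_deriv_eq)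
qed

text \<open>The Hessian matrix undergoes a congruence by the matrix of \<open>L\<close>. Symmetry of
  the mixed derivatives enters because \<open>hessian_det\<close> contains only one of them.\<close>

lemma hessian_det_affine_compose:
  assumes L: "linear L" and f: "smooth_near (v + L x) f"
  shows "hessian_det (\<lambda>x. f (v + L x)) x = (ldet L)\<^sup>2 * hessian_det f (v + L x)"
proof -
  have ev: "\<forall>\<^sub>F y in nhds x. smooth_near (v + L y) f"
    by (rule eventually_nhds_compose[OF isCont_linear_plane[OF L]]) (rule smooth_near_eventually[OF f])
  have d: "partial_deriv c (partial_deriv b (\<lambda>x. f (v + L x))) x =
     fst (L b) * (fst (L c) * \<partial>\<^sub>1 (\<partial>\<^sub>1 f) (v + L x) + snd (L c) * \<partial>\<^sub>2 (\<partial>\<^sub>1 f) (v + L x)) +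
     snd (L b) * (fst (L c) * \<partial>\<^sub>1 (\<partial>\<^sub>2 f) (v + L x) + snd (L c) * \<partial>\<^sub>2 (\<partial>\<^sub>2 f) (v + L x))" for b c
  proof -
    have "\<forall>\<^sub>F y in nhds x. partial_deriv b (\<lambda>x. f (v + L x)) y =
      fst (L b) * \<partial>\<^sub>1 f (v + L y) + snd (L b) * \<partial>\<^sub>2 f (v + L y)"
      using ev by eventually_elim (rule partial_deriv_affine_compose[OF L])
    from partial_deriv_cong[OF this, of c] show ?thesis
      using partial_deriv_affine_compose[OF L smooth_near_partial_plane(1)[OF f], of c]
        partial_deriv_affine_compose[OF L smooth_near_partial_plane(2)[OF f], of c]
        smooth_near_affine_compose[OF L smooth_near_partial_plane(1)[OF f]]
        smooth_near_affine_compose[OF L smooth_near_partial_plane(2)[OF f]]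
      by (simp add: partial_deriv_add partial_deriv_cmult smooth smooth_near_differentiable)
  qed
  show ?thesis
    unfolding hessian_det_def d partial_deriv_commute[OF f] ldet_def by algebra
qed

text \<open>The relation between \<open>f\<close> and \<open>g\<close> is local, so with zero
  coefficients this is also the congruence rule for \<open>hessian_det\<close>.\<close>

lemma hessian_det_add_affine:
  assumes f: "smooth_near x f" and g: "\<forall>\<^sub>F y in nhds x. g y = f y + (c + a * fst y + b * snd y)"
  shows "hessian_det g x = hessian_det f x"
proof -
  have aff: "\<partial>\<^sub>1 (\<lambda>y. c + a * fst y + b * snd y) y = a" "\<partial>\<^sub>2 (\<lambda>y. c + a * fst y + b * snd y) y = b"
    "smooth_near y (\<lambda>y. c + a * fst y + b * snd y)" for y
    by (auto intro!: smooth derivative_eq_intros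
        partial_deriv_eq[of _ "\<lambda>h. a * fst h + b * snd h", THEN trans])
  have d: "\<forall>\<^sub>F y in nhds x. \<partial>\<^sub>1 g y = \<partial>\<^sub>1 f y + a" "\<forall>\<^sub>F y in nhds x. \<partial>\<^sub>2 g y = \<partial>\<^sub>2 f y + b"
    using eventually_partial_deriv_cong[OF g, of "(1, 0)"] eventually_partial_deriv_cong[OF g, of "(0, 1)"]
      smooth_near_eventually[OF f]
    by (eventually_elim, simp add: partial_deriv_add smooth_near_differentiable aff)+
  show ?thesis
    unfolding hessian_det_def partial_deriv_cong[OF d(1)] partial_deriv_cong[OF d(2)]
    by (simp add: partial_deriv_add partial_deriv_const smooth_near_differentiable smooth f)
qed

lemma hessian_det_phi_at:
  assumes L: "linear L" and f: "smooth_near (v + L x) \<phi>"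
  shows "hessian_det (phi_at \<phi> v \<circ> L) x = (ldet L)\<^sup>2 * hessian_det \<phi> (v + L x)"
proof -
  have "(phi_at \<phi> v \<circ> L) y = \<phi> (v + L y) +
     (- \<phi> v + (- (L (1, 0) \<bullet> grad \<phi> v)) * fst y + (- (L (0, 1) \<bullet> grad \<phi> v)) * snd y)" for y
  proof -
    have "L y \<bullet> grad \<phi> v = fst y * (L (1, 0) \<bullet> grad \<phi> v) + snd y * (L (0, 1) \<bullet> grad \<phi> v)"
      using arg_cong[OF linear_plane[OF L, of y], of "\<lambda>z. z \<bullet> grad \<phi> v"] by (simp add: inner_add_left)
    then show ?thesis by (simp add: phi_at_def add.commute[of v])
  qed
  then have "\<forall>\<^sub>F y in nhds x. (phi_at \<phi> v \<circ> L) y = \<phi> (v + L y) +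
     (- \<phi> v + (- (L (1, 0) \<bullet> grad \<phi> v)) * fst y + (- (L (0, 1) \<bullet> grad \<phi> v)) * snd y)"
    by (intro always_eventually allI)
  from hessian_det_add_affine[OF smooth_near_affine_compose[OF L f] this]
  show ?thesis using hessian_det_affine_compose[OF L f] by (rule trans)
qed

section \<open>Mixed homogeneous functions in the half plane\<close>

text \<open>The general function of degree \<kappa> on the half plane \<open>x1 > 0\<close> for the
  dilations \<open>(r x1, r^\<gamma> x2)\<close>; \<open>g\<close> is its restriction to the line
  \<open>x1 = 1\<close>. The exponents arise as quotients of the original degree and weights, see
  \<open>normal_form_exists_axis\<close>.\<close>

definition qhom :: "real \<Rightarrow> real \<Rightarrow> (real \<Rightarrow> real) \<Rightarrow> real \<times> real \<Rightarrow> real"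
  where "qhom \<kappa> \<gamma> g x = fst x powr \<kappa> * g (snd x * fst x powr (- \<gamma>))"

text \<open>Invariant under the dilations; its level sets in the half plane are the homogeneity
  curves.\<close>

abbreviation qslope :: "real \<Rightarrow> real \<times> real \<Rightarrow> real"
  where "qslope \<gamma> x \<equiv> snd x * fst x powr (- \<gamma>)"

lemma smooth_near_qslope [smooth]: "fst x > 0 \<Longrightarrow> smooth_near x (qslope \<gamma>)"
  by (intro smooth)

lemma smooth_near_qhom:
  assumes "fst x > 0" "smooth_near (qslope \<gamma> x) g"
  shows "smooth_near x (qhom \<kappa> \<gamma> g)"
proof -
  have "smooth_near x (\<lambda>x. g (qslope \<gamma> x))"
    by (rule smooth_near_compose_real) (use assms in \<open>auto intro: smooth\<close>)
  then show ?thesis unfolding qhom_def by (intro smooth assms)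
qed

text \<open>Differentiation stays in the family and lowers the degree by the weight of the variable.
  The formula for \<open>\<partial>\<^sub>1\<close> is Euler's relation \<open>u \<partial>\<^sub>1
  f + \<gamma> w \<partial>\<^sub>2 f = \<kappa> f\<close> solved for its first term.\<close>

lemma partial_deriv_qhom:
  assumes "fst x > 0" "smooth_near (qslope \<gamma> x) g"
  shows "\<partial>\<^sub>2 (qhom \<kappa> \<gamma> g) x = qhom (\<kappa> - \<gamma>) \<gamma> (\<D> g) x"
    and "\<partial>\<^sub>1 (qhom \<kappa> \<gamma> g) x = qhom (\<kappa> - 1) \<gamma> (\<lambda>y. \<kappa> * g y - \<gamma> * y * \<D> g y) x"
proof -
  obtain u w where x: "x = (u, w)" by (cases x)
  have u: "u > 0" using assms x by simp
  have g: "(g has_real_derivative \<D> g (w * u powr (- \<gamma>))) (at (w * u powr (- \<gamma>)))"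
    using has_real_derivative_partial[OF assms(2)] x by simp
  note diff = smooth_near_differentiable[OF smooth_near_qhom[OF assms]]
  have "((\<lambda>t. (u + t) powr \<kappa>) has_real_derivative \<kappa> * u powr (\<kappa> - 1)) (at 0)" for \<kappa>
    using u by (auto intro!: derivative_eq_intros simp: powr_diff)
  note p = this
  have "((\<lambda>t. w * (u + t) powr (- \<gamma>)) has_real_derivative w * (- \<gamma> * u powr (- \<gamma> - 1))) (at 0)"
    by (rule DERIV_cmult[OF p])
  from DERIV_chain2[of g _ "\<lambda>t. w * (u + t) powr (- \<gamma>)", OF _ this] g
  have "((\<lambda>t. g (w * (u + t) powr (- \<gamma>))) has_real_derivative
     \<D> g (w * u powr (- \<gamma>)) * (w * (- \<gamma> * u powr (- \<gamma> - 1)))) (at 0)" by simp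
  note d1 = DERIV_mult[OF p[of \<kappa>] this]
  show "\<partial>\<^sub>1 (qhom \<kappa> \<gamma> g) x = qhom (\<kappa> - 1) \<gamma> (\<lambda>y. \<kappa> * g y - \<gamma> * y * \<D> g y) x"
  proof (rule partial_deriv_eqI[OF diff])
    have "u powr (- \<gamma> - 1) * u powr \<kappa> = u powr (\<kappa> - 1) * u powr (- \<gamma>)"
      by (simp flip: powr_add add: algebra_simps)
    then have "\<kappa> * u powr (\<kappa> - 1) * g (w * (u + 0) powr - \<gamma>) +
        \<D> g (w * u powr - \<gamma>) * (w * (- \<gamma> * u powr (- \<gamma> - 1))) * (u + 0) powr \<kappa> =
        qhom (\<kappa> - 1) \<gamma> (\<lambda>y. \<kappa> * g y - \<gamma> * y * \<D> g y) x"
      unfolding qhom_def x fst_conv snd_conv add_0_right by algebra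
    from d1[unfolded this] show "((\<lambda>t. qhom \<kappa> \<gamma> g (x + t *\<^sub>R (1, 0))) has_real_derivative
        qhom (\<kappa> - 1) \<gamma> (\<lambda>y. \<kappa> * g y - \<gamma> * y * \<D> g y) x) (at 0)"
      unfolding x qhom_def by simp
  qed
  have "((\<lambda>t. (w + t) * u powr (- \<gamma>)) has_real_derivative u powr (- \<gamma>)) (at 0)"
    by (auto intro!: derivative_eq_intros)
  from DERIV_chain2[of g _ "\<lambda>t. (w + t) * u powr (- \<gamma>)", OF _ this] g
  have "((\<lambda>t. g ((w + t) * u powr (- \<gamma>))) has_real_derivative
     \<D> g (w * u powr (- \<gamma>)) * u powr (- \<gamma>)) (at 0)" by simp
  note d2 = DERIV_cmult[OF this, of "u powr \<kappa>"]
  show "\<partial>\<^sub>2 (qhom \<kappa> \<gamma> g) x = qhom (\<kappa> - \<gamma>) \<gamma> (\<D> g) x"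
  proof (rule partial_deriv_eqI[OF diff])
    have *: "u powr (\<kappa> - \<gamma>) = u powr \<kappa> * u powr (- \<gamma>)"
      by (simp flip: powr_add)
    have "u powr \<kappa> * (\<D> g (w * u powr - \<gamma>) * u powr - \<gamma>) = qhom (\<kappa> - \<gamma>) \<gamma> (\<D> g) x"
      unfolding qhom_def x fst_conv snd_conv * by (simp only: mult_ac)
    with d2 show "((\<lambda>t. qhom \<kappa> \<gamma> g (x + t *\<^sub>R (0, 1))) has_real_derivative
        qhom (\<kappa> - \<gamma>) \<gamma> (\<D> g) x) (at 0)"
      unfolding x qhom_def by simp
  qed
qed

lemma eventually_qhom:
  assumes "fst x > 0" "smooth_near (qslope \<gamma> x) g"
  shows "\<forall>\<^sub>F z in nhds x. fst z > 0 \<and> smooth_near (qslope \<gamma> z) g"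
proof -
  have "isCont (qslope \<gamma>) x" using assms(1) by (intro smooth_near_isCont smooth)
  from eventually_nhds_compose[OF this smooth_near_eventually[OF assms(2)]]
  have "\<forall>\<^sub>F z in nhds x. smooth_near (qslope \<gamma> z) g" .
  moreover have "\<forall>\<^sub>F z in nhds x. fst z > 0"
    using assms(1) by (intro eventually_nhds_compose[where A = fst])
      (auto intro!: continuous_intros eventually_nhds_in_open[of "{0<..}", simplified])
  ultimately show ?thesis by eventually_elim simp
qed

text \<open>The function \<open>h\<close> of the overview, that is, the Hessian determinant of
  \<open>qhom \<kappa> \<gamma> g\<close> at \<open>(1, y)\<close>.\<close>

definition hess1 :: "real \<Rightarrow> real \<Rightarrow> (real \<Rightarrow> real) \<Rightarrow> real \<Rightarrow> real"
  where "hess1 \<kappa> \<gamma> g y = \<kappa> * (\<kappa> - 1) * g y * \<D> (\<D> g) y + \<gamma> * (1 - \<gamma>) * y * \<D> g y * \<D> (\<D> g) y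
    - (\<kappa> - \<gamma>)\<^sup>2 * (\<D> g y)\<^sup>2"

text \<open>The value of \<open>\<partial>\<^sub>1 (\<partial>\<^sub>1 (qhom \<kappa> \<gamma>
  g))\<close> at \<open>(1, y)\<close>.\<close>

definition qpart1 :: "real \<Rightarrow> real \<Rightarrow> (real \<Rightarrow> real) \<Rightarrow> real \<Rightarrow> real"
  where "qpart1 \<kappa> \<gamma> g y = \<kappa> * (\<kappa> - 1) * g y + \<gamma> * (\<gamma> + 1 - 2 * \<kappa>) * y * \<D> g y + \<gamma>\<^sup>2 * y\<^sup>2 * \<D> (\<D> g) y"

lemma second_partial_deriv_qhom:
  assumes "fst x > 0" "smooth_near (qslope \<gamma> x) g"
  shows "\<partial>\<^sub>2 (\<partial>\<^sub>2 (qhom \<kappa> \<gamma> g)) x = qhom (\<kappa> - 2 * \<gamma>) \<gamma> (\<D> (\<D> g)) x"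
    and "\<partial>\<^sub>1 (\<partial>\<^sub>2 (qhom \<kappa> \<gamma> g)) x = qhom (\<kappa> - \<gamma> - 1) \<gamma> (\<lambda>y. (\<kappa> - \<gamma>) * \<D> g y - \<gamma> * y * \<D> (\<D> g) y) x"
    and "\<partial>\<^sub>1 (\<partial>\<^sub>1 (qhom \<kappa> \<gamma> g)) x = qhom (\<kappa> - 2) \<gamma> (qpart1 \<kappa> \<gamma> g) x"
proof -
  have d: "\<forall>\<^sub>F z in nhds x. \<partial>\<^sub>2 (qhom \<kappa> \<gamma> g) z = qhom (\<kappa> - \<gamma>) \<gamma> (\<D> g) z"
    "\<forall>\<^sub>F z in nhds x. \<partial>\<^sub>1 (qhom \<kappa> \<gamma> g) z = qhom (\<kappa> - 1) \<gamma> (\<lambda>y. \<kappa> * g y - \<gamma> * y * \<D> g y) z"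
    using eventually_qhom[OF assms] by (eventually_elim, simp add: partial_deriv_qhom)+
  have sm: "smooth_near (qslope \<gamma> x) (\<D> g)" "smooth_near (qslope \<gamma> x) (\<lambda>y. \<kappa> * g y - \<gamma> * y * \<D> g y)"
    using assms by (auto intro!: smooth)
  show "\<partial>\<^sub>2 (\<partial>\<^sub>2 (qhom \<kappa> \<gamma> g)) x = qhom (\<kappa> - 2 * \<gamma>) \<gamma> (\<D> (\<D> g)) x"
    unfolding partial_deriv_cong[OF d(1)] by (simp add: partial_deriv_qhom assms sm)
  show "\<partial>\<^sub>1 (\<partial>\<^sub>2 (qhom \<kappa> \<gamma> g)) x = qhom (\<kappa> - \<gamma> - 1) \<gamma> (\<lambda>y. (\<kappa> - \<gamma>) * \<D> g y - \<gamma> * y * \<D> (\<D> g) y) x"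
    unfolding partial_deriv_cong[OF d(1)] by (simp add: partial_deriv_qhom assms sm)
  let ?y = "qslope \<gamma> x"
  have "\<D> (\<lambda>y. \<kappa> * g y - \<gamma> * y * \<D> g y) ?y = \<kappa> * \<D> g ?y - (\<gamma> * \<D> g ?y + \<gamma> * ?y * \<D> (\<D> g) ?y)"
    using assms(2)
    by (intro partial_deriv_real) (auto intro!: derivative_eq_intros has_real_derivative_partial smooth)
  then have "(\<kappa> - 1) * (\<kappa> * g ?y - \<gamma> * ?y * \<D> g ?y) -
      \<gamma> * ?y * \<D> (\<lambda>y. \<kappa> * g y - \<gamma> * y * \<D> g y) ?y = qpart1 \<kappa> \<gamma> g ?y"
    unfolding qpart1_def by algebra
  then show "\<partial>\<^sub>1 (\<partial>\<^sub>1 (qhom \<kappa> \<gamma> g)) x = qhom (\<kappa> - 2) \<gamma> (qpart1 \<kappa> \<gamma> g) x"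
    unfolding partial_deriv_cong[OF d(2)] partial_deriv_qhom(2)[OF assms(1) sm(2)]
    by (simp add: qhom_def)
qed

lemma hessian_det_qhom:
  assumes "fst x > 0" "smooth_near (qslope \<gamma> x) g"
  shows "hessian_det (qhom \<kappa> \<gamma> g) x = fst x powr (2 * \<kappa> - 2 * \<gamma> - 2) * hess1 \<kappa> \<gamma> g (qslope \<gamma> x)"
proof -
  let ?u = "fst x" and ?y = "qslope \<gamma> x"
  have p: "?u powr (\<kappa> - 2) * ?u powr (\<kappa> - 2 * \<gamma>) = ?u powr (2 * \<kappa> - 2 * \<gamma> - 2)"
    "?u powr (\<kappa> - \<gamma> - 1) * ?u powr (\<kappa> - \<gamma> - 1) = ?u powr (2 * \<kappa> - 2 * \<gamma> - 2)"
    by (simp_all flip: powr_add add: algebra_simps)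
  have "hessian_det (qhom \<kappa> \<gamma> g) x =
    (?u powr (\<kappa> - 2) * ?u powr (\<kappa> - 2 * \<gamma>)) * (qpart1 \<kappa> \<gamma> g ?y * \<D> (\<D> g) ?y) -
    (?u powr (\<kappa> - \<gamma> - 1) * ?u powr (\<kappa> - \<gamma> - 1)) * ((\<kappa> - \<gamma>) * \<D> g ?y - \<gamma> * ?y * \<D> (\<D> g) ?y)\<^sup>2"
    unfolding hessian_det_def second_partial_deriv_qhom[OF assms]
    by (simp only: qhom_def power2_eq_square mult_ac)
  \<comment> \<open>The terms \<open>\<gamma>\<^sup>2 y\<^sup>2 (g'')\<^sup>2\<close> of the product
    and of the square cancel, so \<open>hess1\<close> is linear in the second derivative.\<close>
  also have "\<dots> = ?u powr (2 * \<kappa> - 2 * \<gamma> - 2) * hess1 \<kappa> \<gamma> g ?y"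
    unfolding p hess1_def qpart1_def by algebra
  finally show ?thesis .
qed

section \<open>Second-order Taylor expansions\<close>

lemma taylor2_line:
  assumes "smooth_near p f"
  obtains w where "smooth_near p w" "\<forall>\<^sub>F y in nhds p. f y = f p + (y - p) * \<D> f p + (y - p)\<^sup>2 * w y"
    "w p = \<D> (\<D> f) p / 2"
proof -
  obtain q where q: "smooth_near p q" "\<forall>\<^sub>F y in nhds p. f y = f p + (y - p) * q y" "q p = \<D> f p"
    using assms by (rule hadamard_line)
  obtain w where w: "smooth_near p w" "\<forall>\<^sub>F y in nhds p. q y = q p + (y - p) * w y" "w p = \<D> q p"
    using q(1) by (rule hadamard_line)
  have "\<forall>\<^sub>F y in nhds p. \<D> f y = q y + (y - p) * \<D> q y"
    using eventually_partial_deriv_cong[OF q(2), of 1] smooth_near_eventually[OF q(1)]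
  proof eventually_elim
    case (elim y)
    have "\<D> (\<lambda>y. f p + (y - p) * q y) y = q y + (y - p) * \<D> q y"
      by (rule partial_deriv_real) (auto intro!: derivative_eq_intros has_real_derivative_partial elim)
    with elim show ?case by simp
  qed
  from partial_deriv_cong[OF this, of 1] have "\<D> (\<D> f) p = \<D> (\<lambda>y. q y + (y - p) * \<D> q y) p" .
  also have "\<dots> = \<D> q p + \<D> q p"
    by (rule partial_deriv_real) (auto intro!: derivative_eq_intros has_real_derivative_partial smooth q)
  finally have "w p = \<D> (\<D> f) p / 2" using w(3) by simp
  moreover have "\<forall>\<^sub>F y in nhds p. f y = f p + (y - p) * \<D> f p + (y - p)\<^sup>2 * w y"
    using q(2) w(2) by eventually_elim (simp add: q(3) algebra_simps power2_eq_square)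
  ultimately show ?thesis using that w(1) by blast
qed

text \<open>The value \<open>a * (a - 1) / 2\<close> keeps two functions from vanishing later: with
  \<open>a = \<gamma>\<close> it gives \<open>\<psi> 0 \<noteq> 0\<close>, with
  \<open>a = \<kappa>\<close> it gives \<open>r\<^sub>1 0 \<noteq> 0\<close> in
  \<open>normal_forms_cylinder\<close>.\<close>

lemma powr_taylor2:
  obtains w where "smooth_near 0 w" "\<forall>\<^sub>F t in nhds 0. (1 + t) powr a = 1 + a * t + t\<^sup>2 * w t"
    "w 0 = a * (a - 1) / 2"
proof -
  have d: "\<forall>\<^sub>F t in nhds 0. \<D> (\<lambda>t. (1 + t) powr a) t = a * (1 + t) powr (a - 1)" for a
    using eventually_nhds_in_open[of "{-1<..}" "0::real"]
    by (auto elim!: eventually_mono intro!: partial_deriv_real derivative_eq_intros simp: powr_diff)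
  have "smooth_near 0 (\<lambda>t::real. (1 + t) powr a)" for a by (intro smooth) auto
  then obtain w where w: "smooth_near 0 w" "w 0 = \<D> (\<D> (\<lambda>t. (1 + t) powr a)) 0 / 2"
    "\<forall>\<^sub>F t in nhds 0. (1 + t) powr a = 1 + t * \<D> (\<lambda>t. (1 + t) powr a) 0 + t\<^sup>2 * w t"
    using taylor2_line[of 0 "\<lambda>t. (1 + t) powr a"] by auto
  have "\<D> (\<D> (\<lambda>t. (1 + t) powr a)) 0 = \<D> (\<lambda>t. a * (1 + t) powr (a - 1)) 0"
    by (rule partial_deriv_cong[OF d])
  also have "\<dots> = a * (a - 1)"
    by (auto intro!: partial_deriv_real derivative_eq_intros)
  finally have "w 0 = a * (a - 1) / 2" using w by simp
  moreover have "\<D> (\<lambda>t. (1 + t) powr a) 0 = a"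
    using eventually_nhds_x_imp_x[OF d] by simp
  ultimately show ?thesis using that w by (auto simp: mult.commute)
qed

section \<open>Coordinates adapted to the homogeneity curve\<close>

text \<open>Inverse of \<open>(z1, z2) \<mapsto> (a z1 + b z2, z2 - m z1)\<close> when the
  determinant \<open>a + b m\<close> is nonzero. With \<open>m = \<gamma> y0\<close>, the slope of
  \<open>w = y0 u^\<gamma>\<close> at \<open>u = 1\<close>, the new first axis is tangent to the
  homogeneity curve; \<open>a\<close> and \<open>b\<close> remain free to choose the second
  axis.\<close>

definition coordL :: "real \<Rightarrow> real \<Rightarrow> real \<Rightarrow> real \<times> real \<Rightarrow> real \<times> real"
  where "coordL a b m X = ((fst X - b * snd X) / (a + b * m), (m * fst X + a * snd X) / (a + b * m))"

lemma linear_coordL: "linear (coordL a b m)"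
  by (rule linearI) (auto simp: coordL_def algebra_simps add_divide_distrib diff_divide_distrib)

lemma coordL_eqs:
  assumes "a + b * m \<noteq> 0"
  shows "a * fst (coordL a b m X) + b * snd (coordL a b m X) = fst X"
    and "snd (coordL a b m X) - m * fst (coordL a b m X) = snd X"
proof -
  have "a * fst (coordL a b m X) + b * snd (coordL a b m X) = ((a + b * m) * fst X) / (a + b * m)"
    unfolding coordL_def fst_conv snd_conv times_divide_eq_right add_divide_distrib [symmetric]
    by (rule arg_cong2[where f = "(/)"]) (auto simp: algebra_simps)
  then show "a * fst (coordL a b m X) + b * snd (coordL a b m X) = fst X" using assms by simp
  have "snd (coordL a b m X) - m * fst (coordL a b m X) = ((a + b * m) * snd X) / (a + b * m)"
    unfolding coordL_def fst_conv snd_conv times_divide_eq_right diff_divide_distrib [symmetric]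
    by (rule arg_cong2[where f = "(/)"]) (auto simp: algebra_simps)
  then show "snd (coordL a b m X) - m * fst (coordL a b m X) = snd X" using assms by simp
qed

lemma bij_coordL:
  assumes "a + b * m \<noteq> 0"
  shows "bij (coordL a b m)"
proof -
  have inj: "inj (coordL a b m)"
    by (rule injI) (metis coordL_eqs[OF assms] prod_eqI)
  moreover have "surj (coordL a b m)"
    using linear_injective_imp_surjective[OF linear_coordL inj] by simp
  ultimately show ?thesis by (simp add: bij_def)
qed

text \<open>More than equality of zero sets: \<open>y - y0\<close> and the root function differ by a
  nonvanishing factor, so orders in \<open>y - y0\<close> become exponents of the root function.
  Straight curves are covered by the zero function as \<psi>.\<close>

definition curve_coords :: "real \<Rightarrow> real \<Rightarrow> (real \<times> real \<Rightarrow> real \<times> real) \<Rightarrow> (real \<Rightarrow> real) \<Rightarrow> bool"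
  where "curve_coords \<gamma> y0 L \<psi> \<longleftrightarrow> linear L \<and> bij L \<and> smooth_near 0 \<psi> \<and>
    (\<exists>e. smooth_nonzero_near 0 e \<and> (\<forall>\<^sub>F X in nhds 0.
       qslope \<gamma> ((1, y0) + L X) - y0 = (snd X - (fst X)\<^sup>2 * \<psi> (fst X)) * e X))"

lemma partial_deriv_qslope:
  assumes "fst x > 0"
  shows "\<partial>\<^sub>1 (qslope \<gamma>) x = - \<gamma> * snd x * fst x powr (- \<gamma> - 1)" "\<partial>\<^sub>2 (qslope \<gamma>) x = fst x powr (- \<gamma>)"
proof -
  have sm: "smooth_near p (\<lambda>y::real. y)" for p by (intro smooth)
  have D: "\<D> (\<lambda>y. y) y = 1" for y by (rule partial_deriv_real) auto
  have ev: "\<forall>\<^sub>F z in nhds x. qslope \<gamma> z = qhom 0 \<gamma> (\<lambda>y. y) z"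
    using eventually_qhom[OF assms sm] by eventually_elim (simp add: qhom_def)
  show "\<partial>\<^sub>1 (qslope \<gamma>) x = - \<gamma> * snd x * fst x powr (- \<gamma> - 1)"
  proof -
    have "fst x powr (- \<gamma> - 1) = fst x powr (0 - 1) * fst x powr (- \<gamma>)"
      by (subst powr_add [symmetric], rule arg_cong2[where f = "(powr)"]) auto
    then show ?thesis
      unfolding partial_deriv_cong[OF ev] partial_deriv_qhom[OF assms sm] D qhom_def by simp
  qed
  show "\<partial>\<^sub>2 (qslope \<gamma>) x = fst x powr (- \<gamma>)"
    unfolding partial_deriv_cong[OF ev] partial_deriv_qhom[OF assms sm] D by (simp add: qhom_def)
qed

text \<open>\<open>hadamard\<close> in the second direction divides \<open>y - y0\<close>, which is
  zero on the root by hypothesis, by the root function. The quotient is 1 at the origin because the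
  differential of \<open>y - y0\<close> there is \<open>z2 - \<gamma> y0 z1\<close>, the second new
  coordinate.\<close>

lemma curve_coordsI:
  assumes P: "a + b * (\<gamma> * y0) \<noteq> 0" and \<psi>: "smooth_near 0 \<psi>"
    and root: "\<forall>\<^sub>F s in nhds 0. qslope \<gamma> ((1, y0) + coordL a b (\<gamma> * y0) (s, s\<^sup>2 * \<psi> s)) = y0"
  shows "curve_coords \<gamma> y0 (coordL a b (\<gamma> * y0)) \<psi>"
proof -
  let ?L = "coordL a b (\<gamma> * y0)"
  let ?E = "\<lambda>X. qslope \<gamma> ((1, y0) + ?L X) - y0"
  let ?l = "\<lambda>X. snd X - (fst X)\<^sup>2 * \<psi> (fst X)"
  have L0: "?L 0 = 0" using linear_0[OF linear_coordL] .
  have smq: "smooth_near ((1, y0) + ?L 0) (qslope \<gamma>)" by (intro smooth) (simp add: L0)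
  have smE': "smooth_near 0 (\<lambda>X. qslope \<gamma> ((1, y0) + ?L X))"
    by (rule smooth_near_affine_compose[OF linear_coordL smq])
  then have smE: "smooth_near 0 ?E" by (rule smooth_near_diff[OF _ smooth_near_const])
  have "smooth_near (0::real \<times> real) (\<lambda>X. \<psi> (fst X))"
    by (rule smooth_near_compose_real) (use \<psi> in \<open>auto intro: smooth\<close>)
  then have sml: "smooth_near 0 ?l" by (intro smooth)
  obtain e where e: "smooth_near 0 e" "e 0 = \<partial>\<^sub>2 ?E 0"
    "\<forall>\<^sub>F X in nhds 0. ?E X - ?E (X - ?l X *\<^sub>R (0, 1)) = ?l X * e X"
    using hadamard[OF smE sml _ Basis_plane(2)] by auto
  have "\<partial>\<^sub>2 ?E 0 = \<partial>\<^sub>2 (\<lambda>X. qslope \<gamma> ((1, y0) + ?L X)) 0"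
    using partial_deriv_add[OF smooth_near_differentiable[OF smE'] smooth_near_differentiable[OF smooth_near_const], of "(0, 1)" "- y0"]
    by (simp add: partial_deriv_const)
  also have "\<dots> = snd (?L (0, 1)) - \<gamma> * y0 * fst (?L (0, 1))"
    by (subst partial_deriv_affine_compose[OF linear_coordL smq]) (simp add: L0 partial_deriv_qslope)
  also have "\<dots> = 1" using coordL_eqs(2)[OF P, of "(0, 1)"] by simp
  finally have "smooth_nonzero_near 0 e" using e by (simp add: smooth_nonzero_near_def)
  moreover have "\<forall>\<^sub>F X in nhds (0::real \<times> real). ?E (fst X, (fst X)\<^sup>2 * \<psi> (fst X)) = 0"
    using eventually_nhds_compose[where A = fst and p = "0::real\<times>real", OF _ root[folded fst_zero[where 'a = real and 'b = real]]]
    by (auto intro!: continuous_intros elim: eventually_mono)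
  with e(3) have "\<forall>\<^sub>F X in nhds 0. ?E X = ?l X * e X"
  proof eventually_elim
    case (elim X)
    have "X - ?l X *\<^sub>R (0, 1) = (fst X, (fst X)\<^sup>2 * \<psi> (fst X))" by (cases X) simp
    with elim show ?case by simp
  qed
  ultimately show ?thesis
    unfolding curve_coords_def using linear_coordL bij_coordL[OF P] \<psi> by blast
qed

text \<open>In both cases the curve \<open>w = y0 u^\<gamma>\<close> lies on its tangent
  line.\<close>

lemma curve_coords_straight:
  assumes P: "a + b * (\<gamma> * y0) \<noteq> 0" and "\<gamma> = 1 \<or> y0 = 0"
  shows "curve_coords \<gamma> y0 (coordL a b (\<gamma> * y0)) (\<lambda>_. 0)"
proof (rule curve_coordsI[OF P smooth_near_const])
  let ?P = "a + b * (\<gamma> * y0)"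
  have "isCont (\<lambda>s. 1 + s / ?P) 0" by (intro continuous_intros) (use P in auto)
  then have "\<forall>\<^sub>F s in nhds 0. 1 + s / ?P > 0"
    by (rule eventually_nhds_compose[where P = "\<lambda>u. u > 0"])
      (auto intro: eventually_nhds_in_open[of "{0<..}", simplified])
  then show "\<forall>\<^sub>F s in nhds 0. qslope \<gamma> ((1, y0) + coordL a b (\<gamma> * y0) (s, s\<^sup>2 * 0)) = y0"
  proof eventually_elim
    case (elim s)
    have "y0 + \<gamma> * y0 * s / ?P = y0 * (1 + s / ?P)" using assms(2) by (auto simp: algebra_simps)
    then show ?case using elim assms(2) by (auto simp: coordL_def powr_minus)
  qed
qed

lemma curve_coords_curved:
  assumes P: "a + b * (\<gamma> * y0) \<noteq> 0" and "\<gamma> > 0" "\<gamma> \<noteq> 1" "y0 \<noteq> 0"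
  obtains \<psi> where "curve_coords \<gamma> y0 (coordL a b (\<gamma> * y0)) \<psi>" "\<psi> 0 \<noteq> 0"
proof -
  let ?P = "a + b * (\<gamma> * y0)" and ?L = "coordL a b (\<gamma> * y0)"
  \<comment> \<open>The new first coordinate of the curve point
    \<open>(1 + t, y0 (1 + t)^\<gamma>)\<close> relative to \<open>(1, y0)\<close>. Its inverse
    \<open>U\<close> lets that coordinate parametrise the curve.\<close>
  define Q where "Q t = a * t + b * y0 * ((1 + t) powr \<gamma> - 1)" for t
  have smQ: "smooth_near 0 Q" unfolding Q_def by (intro smooth) auto
  have Q0: "Q 0 = 0" by (simp add: Q_def)
  have DQ: "(Q has_real_derivative ?P) (at 0)"
    unfolding Q_def by (auto intro!: derivative_eq_intros)
  then have "\<D> Q 0 \<noteq> 0" using P by (simp add: partial_deriv_real)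
  then obtain U where U: "smooth_near 0 U" "U 0 = 0" "\<forall>\<^sub>F s in nhds 0. Q (U s) = s"
    using smooth_inverse_function[OF smQ] Q0 by metis
  obtain z where z: "smooth_near 0 z" "\<forall>\<^sub>F s in nhds 0. U s = s * z s" "z 0 = \<D> U 0"
    using hadamard_line[OF U(1)] U(2) by auto
  have "((\<lambda>s. Q (U s)) has_real_derivative ?P * \<D> U 0) (at 0)"
    by (rule DERIV_chain2[OF _ has_real_derivative_partial[OF U(1)]]) (simp add: U(2) DQ)
  then have "\<D> (\<lambda>s. Q (U s)) 0 = ?P * \<D> U 0" by (rule partial_deriv_real)
  moreover have "\<D> (\<lambda>s. Q (U s)) 0 = 1"
    unfolding partial_deriv_cong[OF U(3)] by (rule partial_deriv_real) auto
  ultimately have z0: "z 0 \<noteq> 0" using z(3) by auto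
  obtain w where w: "smooth_near 0 w" "\<forall>\<^sub>F t in nhds 0. (1 + t) powr \<gamma> = 1 + \<gamma> * t + t\<^sup>2 * w t"
    "w 0 = \<gamma> * (\<gamma> - 1) / 2" by (rule powr_taylor2)
  \<comment> \<open>The new second coordinate of the curve point is
    \<open>y0 ((1 + t)^\<gamma> - 1 - \<gamma> t) = y0 t\<^sup>2 w t\<close> with
    \<open>t = U s = s * z s\<close>; division by \<open>s\<^sup>2\<close> gives
    \<open>\<psi> s\<close>.\<close>
  define \<psi> where "\<psi> s = y0 * w (U s) * (z s)\<^sup>2" for s
  have "smooth_near 0 (\<lambda>s. w (U s))"
    by (rule smooth_near_compose_real) (use w U in auto)
  then have sm: "smooth_near 0 \<psi>" unfolding \<psi>_def by (intro smooth z)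
  have "\<forall>\<^sub>F s in nhds 0. (1 + U s) powr \<gamma> = 1 + \<gamma> * U s + (U s)\<^sup>2 * w (U s)"
    using eventually_nhds_compose[OF smooth_near_isCont[OF U(1)], of "\<lambda>t. (1 + t) powr \<gamma> = 1 + \<gamma> * t + t\<^sup>2 * w t"]
      w(2) U(2) by simp
  moreover have "\<forall>\<^sub>F s in nhds 0. U s > -1"
    by (rule eventually_nhds_compose[OF smooth_near_isCont[OF U(1)]])
      (use eventually_nhds_in_open[of "{-1<..}" "0::real"] U(2) in simp)
  ultimately have root: "\<forall>\<^sub>F s in nhds 0. qslope \<gamma> ((1, y0) + ?L (s, s\<^sup>2 * \<psi> s)) = y0"
    using U(3) z(2)
  proof eventually_elim
    case (elim s)
    let ?X = "(s, s\<^sup>2 * \<psi> s)"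
    have \<psi>: "s\<^sup>2 * \<psi> s = y0 * ((1 + U s) powr \<gamma> - 1) - \<gamma> * y0 * U s"
      using elim(1,4) unfolding \<psi>_def by algebra
    have "a * U s + b * (y0 * ((1 + U s) powr \<gamma> - 1)) = s" using elim(3) by (simp add: Q_def)
    note s = this [symmetric]
    have n1: "s - b * (s\<^sup>2 * \<psi> s) = ?P * U s"
      unfolding \<psi> by (subst (1) s) (simp add: algebra_simps)
    have n2: "\<gamma> * y0 * s + a * (s\<^sup>2 * \<psi> s) = ?P * (y0 * ((1 + U s) powr \<gamma> - 1))"
      unfolding \<psi> by (subst (1) s) (simp add: algebra_simps)
    have "fst (?L ?X) = U s" "snd (?L ?X) = y0 * ((1 + U s) powr \<gamma> - 1)"
      unfolding coordL_def fst_conv snd_conv n1 n2 using P by simp_all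
    then show ?case using elim(2) by (simp add: algebra_simps powr_minus)
  qed
  have "w 0 \<noteq> 0" unfolding w(3) using assms by simp
  then have "\<psi> 0 \<noteq> 0" using z0 assms by (simp add: \<psi>_def U(2))
  with curve_coordsI[OF P sm root] that show ?thesis by blast
qed

lemma curve_coords_smooth:
  assumes "curve_coords \<gamma> y0 L \<psi>"
  shows "smooth_near 0 (\<lambda>X. qslope \<gamma> ((1, y0) + L X))" "qslope \<gamma> ((1, y0) + L 0) = y0"
proof -
  have L: "linear L" using assms by (simp add: curve_coords_def)
  have "smooth_near ((1, y0) + L 0) (qslope \<gamma>)" by (intro smooth) (simp add: linear_0[OF L])
  then show "smooth_near 0 (\<lambda>X. qslope \<gamma> ((1, y0) + L X))" by (rule smooth_near_affine_compose[OF L])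
  show "qslope \<gamma> ((1, y0) + L 0) = y0" by (simp add: linear_0[OF L])
qed

text \<open>Powers of \<open>y - y0\<close> pull back to powers of the root function. The exponent
  \<kappa> is arbitrary because the function and its Hessian determinant, which have different
  degrees, are both treated this way.\<close>

lemma curve_coords_ord_at:
  assumes L: "curve_coords \<gamma> y0 L \<psi>" and h: "ord_at y0 k h"
  obtains q where "smooth_nonzero_near 0 q"
    "\<forall>\<^sub>F X in nhds 0. (fst ((1, y0) + L X)) powr \<kappa> * h (qslope \<gamma> ((1, y0) + L X)) =
       (snd X - (fst X)\<^sup>2 * \<psi> (fst X)) ^ k * q X"
proof -
  let ?y = "\<lambda>X. qslope \<gamma> ((1, y0) + L X)"
  have lin: "linear L" using L by (simp add: curve_coords_def)
  obtain e where e: "smooth_nonzero_near 0 e" "\<forall>\<^sub>F X in nhds 0. ?y X - y0 = (snd X - (fst X)\<^sup>2 * \<psi> (fst X)) * e X"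
    using L by (auto simp: curve_coords_def)
  obtain r where r: "smooth_near y0 r" "r y0 \<noteq> 0" "\<forall>\<^sub>F y in nhds y0. h y = (y - y0) ^ k * r y"
    using h by (auto simp: ord_at_def smooth_nonzero_near_def)
  note y = curve_coords_smooth[OF L]
  have sr: "smooth_near 0 (\<lambda>X. r (?y X))" by (rule smooth_near_compose_real) (use y r in auto)
  have ev: "\<forall>\<^sub>F X in nhds 0. h (?y X) = (?y X - y0) ^ k * r (?y X)"
    by (rule eventually_nhds_compose[OF smooth_near_isCont[OF y(1)]]) (use r(3) y(2) in simp)
  let ?q = "\<lambda>X. (fst ((1, y0) + L X)) powr \<kappa> * (e X ^ k * r (?y X))"
  have "smooth_nonzero_near 0 ?q"
    using e(1) r(2) y(2) sr lin
    by (auto simp: smooth_nonzero_near_def linear_0[OF lin] intro!: smooth)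
  moreover have "\<forall>\<^sub>F X in nhds 0. (fst ((1, y0) + L X)) powr \<kappa> * h (?y X) =
       (snd X - (fst X)\<^sup>2 * \<psi> (fst X)) ^ k * ?q X"
    using ev e(2)
  proof eventually_elim
    case (elim X)
    show ?case unfolding elim(1) unfolding elim(2) by (simp add: power_mult_distrib mult_ac)
  qed
  ultimately show ?thesis using that by blast
qed

lemma flat_at_qhom_linear:
  fixes L :: "real \<times> real \<Rightarrow> real \<times> real"
  assumes L: "linear L" and h: "flat_at h y0" "smooth_near y0 h"
  shows "flat_at (\<lambda>X. (fst ((1, y0) + L X)) powr \<kappa> * h (qslope \<gamma> ((1, y0) + L X))) 0"
proof -
  have "smooth_near ((1, y0) + L 0) (qslope \<gamma>)" by (intro smooth) (simp add: linear_0[OF L])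
  then have y: "smooth_near 0 (\<lambda>X. qslope \<gamma> ((1, y0) + L X))" by (rule smooth_near_affine_compose[OF L])
  have y0: "qslope \<gamma> ((1, y0) + L 0) = y0" by (simp add: linear_0[OF L])
  have "smooth_near 0 (\<lambda>X. (fst ((1, y0) + L X)) powr \<kappa>)"
    using L by (auto simp: linear_0[OF L] intro!: smooth)
  with flat_at_compose_mult[of 0 "\<lambda>X. qslope \<gamma> ((1, y0) + L X)" h "\<lambda>X. (fst ((1, y0) + L X)) powr \<kappa>"]
    y y0 h show ?thesis by (simp add: mult.commute)
qed

section \<open>Assembling the normal forms\<close>

text \<open>In contrast to \<open>has_normal_form\<close>, \<psi> is an argument and the root
  condition is left out; \<open>normal_form_transfer\<close> derives that condition from
  \<open>curve_coords\<close>.\<close>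

primrec nf_germ :: "nf_case \<Rightarrow> (real \<times> real \<Rightarrow> real) \<Rightarrow> (real \<Rightarrow> real) \<Rightarrow> bool"
  where
    "nf_germ NF_i f \<psi> \<longleftrightarrow> (\<exists>k r \<phi>'. normal_form_i f k r \<phi>')"
  | "nf_germ NF_ii f \<psi> \<longleftrightarrow> (\<exists>k r\<^sub>1 r\<^sub>2 q. normal_form_ii f k r\<^sub>1 r\<^sub>2 q)"
  | "nf_germ NF_iii f \<psi> \<longleftrightarrow> (\<exists>k r\<^sub>1 r\<^sub>2 q. normal_form_iii f k r\<^sub>1 r\<^sub>2 q)"
  | "nf_germ NF_iv f \<psi> \<longleftrightarrow> (\<exists>k r\<^sub>1 r\<^sub>2 q. normal_form_iv f k \<psi> r\<^sub>1 r\<^sub>2 q)"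
  | "nf_germ NF_v f \<psi> \<longleftrightarrow> (\<exists>k r\<^sub>1 r\<^sub>2 q. normal_form_v f k \<psi> r\<^sub>1 r\<^sub>2 q)"
  | "nf_germ NF_vi f \<psi> \<longleftrightarrow> (\<exists>k r q. normal_form_vi f k \<psi> r q)"

text \<open>Common conclusion of the existence lemmas in adapted coordinates, with base point
  \<open>(1, y0)\<close>. The clause for \<gamma> = 1 prepares the claim on equal weights, as
  \<gamma> is their quotient.\<close>

definition admits_nf :: "real \<Rightarrow> real \<Rightarrow> (real \<times> real \<Rightarrow> real) \<Rightarrow> bool"
  where "admits_nf \<gamma> y0 \<Phi> \<longleftrightarrow> (\<exists>n L \<psi>. linear L \<and> bij L \<and> nf_germ n (phi_at \<Phi> (1, y0) \<circ> L) \<psi> \<and>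
     (n \<in> {NF_iv, NF_v, NF_vi} \<longrightarrow> curve_coords \<gamma> y0 L \<psi>) \<and> (\<gamma> = 1 \<longrightarrow> n \<in> {NF_i, NF_ii}))"

text \<open>\<open>phi_at\<close> removes the affine Taylor part. A function that vanishes to second
  order at \<open>v\<close> and differs from \<Phi> by an affine function is therefore what
  remains.\<close>

lemma phi_at_local:
  fixes L :: "real \<times> real \<Rightarrow> real \<times> real"
  assumes L: "linear L" and \<Psi>: "smooth_near v \<Psi>" "\<Psi> v = 0" "\<partial>\<^sub>1 \<Psi> v = 0" "\<partial>\<^sub>2 \<Psi> v = 0"
    and ev: "\<forall>\<^sub>F x in nhds v. \<Phi> x = \<Psi> x + (c + a * fst x + b * snd x)"
  shows "\<forall>\<^sub>F X in nhds 0. (phi_at \<Phi> v \<circ> L) X = \<Psi> (v + L X)"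
proof -
  have aff: "\<partial>\<^sub>1 (\<lambda>y. c + a * fst y + b * snd y) v = a" "\<partial>\<^sub>2 (\<lambda>y. c + a * fst y + b * snd y) v = b"
    by (auto intro!: derivative_eq_intros partial_deriv_eq[of _ "\<lambda>h. a * fst h + b * snd h", THEN trans])
  have smaff: "smooth_near v (\<lambda>y. c + a * fst y + b * snd y)" by (intro smooth)
  have D: "\<partial>\<^sub>1 \<Phi> v = a" "\<partial>\<^sub>2 \<Phi> v = b"
    unfolding partial_deriv_cong[OF ev]
      partial_deriv_add[OF smooth_near_differentiable[OF \<Psi>(1)] smooth_near_differentiable[OF smaff]] aff
    using \<Psi> by auto
  have V: "\<Phi> v = c + a * fst v + b * snd v" using eventually_nhds_x_imp_x[OF ev] \<Psi> by simp
  have "\<forall>\<^sub>F X in nhds 0. \<Phi> (v + L X) = \<Psi> (v + L X) + (c + a * fst (v + L X) + b * snd (v + L X))"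
    by (rule eventually_nhds_compose[OF isCont_linear_plane[OF L]]) (use ev in \<open>simp add: linear_0[OF L]\<close>)
  then show ?thesis
    by eventually_elim
      (simp add: phi_at_def grad_def D V inner_prod_def algebra_simps)
qed

definition germ_qhom :: "(real \<times> real \<Rightarrow> real) \<Rightarrow> real \<Rightarrow> real \<Rightarrow> real \<Rightarrow> (real \<Rightarrow> real) \<Rightarrow> bool"
  where "germ_qhom \<Phi> \<kappa> \<gamma> y0 g \<longleftrightarrow> smooth_near y0 g \<and>
    (\<exists>c a b. \<forall>\<^sub>F x in nhds (1, y0). \<Phi> x = qhom \<kappa> \<gamma> g x + (c + a * fst x + b * snd x))"

lemma germ_qhom_hessian:
  assumes rep: "germ_qhom \<Phi> \<kappa> \<gamma> y0 g" and L: "linear L"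
  shows "\<forall>\<^sub>F X in nhds 0. hessian_det (phi_at \<Phi> (1, y0) \<circ> L) X = (ldet L)\<^sup>2 *
    (fst ((1, y0) + L X) powr (2 * \<kappa> - 2 * \<gamma> - 2) * hess1 \<kappa> \<gamma> g (qslope \<gamma> ((1, y0) + L X)))"
proof -
  obtain c a b where g: "smooth_near y0 g"
    and ev: "\<forall>\<^sub>F x in nhds (1, y0). \<Phi> x = qhom \<kappa> \<gamma> g x + (c + a * fst x + b * snd x)"
    using rep by (auto simp: germ_qhom_def)
  have "\<forall>\<^sub>F x in nhds (1, y0). smooth_near x \<Phi> \<and> hessian_det \<Phi> x =
      fst x powr (2 * \<kappa> - 2 * \<gamma> - 2) * hess1 \<kappa> \<gamma> g (qslope \<gamma> x)"
    using eventually_eventually[of _ "(1, y0)", THEN iffD2, OF ev] eventually_qhom[of "(1, y0)" \<gamma> g, simplified, OF g]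
  proof eventually_elim
    case (elim x)
    have sm: "smooth_near x (qhom \<kappa> \<gamma> g)" using elim by (auto intro: smooth_near_qhom)
    then have "smooth_near x (\<lambda>x. qhom \<kappa> \<gamma> g x + (c + a * fst x + b * snd x))" by (intro smooth)
    then have "smooth_near x \<Phi>"
      by (rule smooth_near_cong) (use elim in \<open>auto elim: eventually_mono\<close>)
    then show ?case using hessian_det_add_affine[OF sm elim(1)] hessian_det_qhom[of x \<gamma> g \<kappa>] elim by simp
  qed
  then have "\<forall>\<^sub>F X in nhds 0. smooth_near ((1, y0) + L X) \<Phi> \<and> hessian_det \<Phi> ((1, y0) + L X) =
      fst ((1, y0) + L X) powr (2 * \<kappa> - 2 * \<gamma> - 2) * hess1 \<kappa> \<gamma> g (qslope \<gamma> ((1, y0) + L X))"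
    by (intro eventually_nhds_compose[OF isCont_linear_plane[OF L]]) (simp add: linear_0[OF L])
  then show ?thesis
    by eventually_elim (simp add: hessian_det_phi_at[OF L])
qed

lemma smooth_near_hess1: "smooth_near y0 g \<Longrightarrow> smooth_near y0 (hess1 \<kappa> \<gamma> g)"
  unfolding hess1_def by (intro smooth)

lemma germ_qhom_hessian_ord_at:
  assumes rep: "germ_qhom \<Phi> \<kappa> \<gamma> y0 g" and L: "curve_coords \<gamma> y0 L \<psi>" and h: "ord_at y0 m (hess1 \<kappa> \<gamma> g)"
  obtains q where "smooth_nonzero_near 0 q" "\<forall>\<^sub>F X in nhds 0. hessian_det (phi_at \<Phi> (1, y0) \<circ> L) X =
    (snd X - (fst X)\<^sup>2 * \<psi> (fst X)) ^ m * q X"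
proof -
  have lin: "linear L" "bij L" using L by (auto simp: curve_coords_def)
  obtain q where q: "smooth_nonzero_near 0 q"
    "\<forall>\<^sub>F X in nhds 0. (fst ((1, y0) + L X)) powr (2 * \<kappa> - 2 * \<gamma> - 2) * hess1 \<kappa> \<gamma> g (qslope \<gamma> ((1, y0) + L X)) =
       (snd X - (fst X)\<^sup>2 * \<psi> (fst X)) ^ m * q X"
    by (rule curve_coords_ord_at[OF L h])
  have "smooth_nonzero_near 0 (\<lambda>X. (ldet L)\<^sup>2 * q X)"
    using q(1) ldet_nonzero[OF lin] by (auto simp: smooth_nonzero_near_def intro: smooth)
  moreover have "\<forall>\<^sub>F X in nhds 0. hessian_det (phi_at \<Phi> (1, y0) \<circ> L) X =
    (snd X - (fst X)\<^sup>2 * \<psi> (fst X)) ^ m * ((ldet L)\<^sup>2 * q X)"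
    using germ_qhom_hessian[OF rep lin(1)] q(2) by eventually_elim (simp only: mult_ac)
  ultimately show ?thesis using that by blast
qed

lemma germ_qhom_hessian_flat:
  assumes rep: "germ_qhom \<Phi> \<kappa> \<gamma> y0 g" and L: "linear L" and h: "flat_at (hess1 \<kappa> \<gamma> g) y0"
  shows "flat_at (hessian_det (phi_at \<Phi> (1, y0) \<circ> L)) 0"
proof -
  have g: "smooth_near y0 g" using rep by (simp add: germ_qhom_def)
  let ?f = "\<lambda>X. fst ((1, y0) + L X) powr (2 * \<kappa> - 2 * \<gamma> - 2) * hess1 \<kappa> \<gamma> g (qslope \<gamma> ((1, y0) + L X))"
  have fl: "flat_at (\<lambda>y. (ldet L)\<^sup>2 * hess1 \<kappa> \<gamma> g y) y0"
    using flat_at_mult[OF h smooth_near_hess1[OF g] smooth_near_const, of "(ldet L)\<^sup>2"]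
    by (simp add: mult.commute)
  have "smooth_near y0 (\<lambda>y. (ldet L)\<^sup>2 * hess1 \<kappa> \<gamma> g y)" by (intro smooth smooth_near_hess1 g)
  from flat_at_qhom_linear[OF L fl this, where \<kappa> = "2 * \<kappa> - 2 * \<gamma> - 2" and \<gamma> = \<gamma>]
  have "flat_at (\<lambda>X. (ldet L)\<^sup>2 * ?f X) 0" by (simp only: mult.left_commute)
  then show ?thesis using flat_at_cong[OF germ_qhom_hessian[OF rep L]] by simp
qed

lemma ord_ge_cmult: "ord_ge p k f \<Longrightarrow> ord_ge p k (\<lambda>y. c * f y)"
  using ord_ge_mult[OF smooth_near_ord_ge_0[OF smooth_near_const]] by simp

lemma ord_at_cmult: "ord_at p k f \<Longrightarrow> c \<noteq> 0 \<Longrightarrow> ord_at p k (\<lambda>y. c * f y)"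
  using ord_at_mult[OF ord_at_0I[OF smooth_near_const]] by simp

text \<open>The term \<open>\<gamma> (1-\<gamma>) y G' G''\<close> has order at least
  \<open>2 n + 1\<close>, the other two at least \<open>2 n + 2\<close>. With
  \<open>k = n + 2\<close> these are \<open>2 k - 3\<close>, the exponent in (vi), where
  \<open>\<gamma> (1-\<gamma>) y0 \<noteq> 0\<close>, and \<open>2 k - 2\<close>, the least exponent
  in (i), where that coefficient vanishes at \<open>y0\<close>.\<close>

lemma hess1_ord:
  assumes G: "ord_at y0 (n + 2) G"
  shows "ord_ge y0 (2 * n + 1) (hess1 \<kappa> \<gamma> G)"
    and "\<gamma> = 1 \<or> y0 = 0 \<Longrightarrow> ord_ge y0 (2 * n + 2) (hess1 \<kappa> \<gamma> G)"
    and "\<gamma> > 0 \<Longrightarrow> \<gamma> \<noteq> 1 \<Longrightarrow> y0 \<noteq> 0 \<Longrightarrow> ord_at y0 (2 * n + 1) (hess1 \<kappa> \<gamma> G)"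
proof -
  have G1: "ord_at y0 (n + 1) (\<D> G)" using G by (intro ord_at_deriv) simp
  have G2: "ord_at y0 n (\<D> (\<D> G))" using G by (intro ord_at_deriv) simp
  have smy: "smooth_near y0 (\<lambda>y. \<gamma> * (1 - \<gamma>) * y)" by (intro smooth)
  let ?T = "\<lambda>y. \<gamma> * (1 - \<gamma>) * y * (\<D> G y * \<D> (\<D> G) y)"
  let ?R = "\<lambda>y. \<kappa> * (\<kappa> - 1) * (G y * \<D> (\<D> G) y) + (- ((\<kappa> - \<gamma>)\<^sup>2)) * (\<D> G y * \<D> G y)"
  have eq: "hess1 \<kappa> \<gamma> G = (\<lambda>y. ?T y + ?R y)"
    by (rule ext) (simp add: hess1_def power2_eq_square mult.assoc)
  have R: "ord_ge y0 (2 * n + 2) ?R"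
    using ord_ge_mult[OF ord_at_imp_ge[OF G] ord_at_imp_ge[OF G2]]
      ord_ge_mult[OF ord_at_imp_ge[OF G1] ord_at_imp_ge[OF G1]]
    by (intro ord_ge_add ord_ge_cmult) (simp_all add: mult_2)
  have T0: "ord_at y0 (2 * n + 1) (\<lambda>y. \<D> G y * \<D> (\<D> G) y)"
    using ord_at_mult[OF G1 G2] by (simp add: mult_2)
  from ord_ge_mult[OF smooth_near_ord_ge_0[OF smy] ord_at_imp_ge[OF T0]]
  show "ord_ge y0 (2 * n + 1) (hess1 \<kappa> \<gamma> G)"
    unfolding eq using ord_ge_mono[OF R, of "2 * n + 1"] by (intro ord_ge_add[of _ _ ?T]) simp_all
  show "ord_ge y0 (2 * n + 2) (hess1 \<kappa> \<gamma> G)" if "\<gamma> = 1 \<or> y0 = 0"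
  proof -
    have "ord_ge y0 1 (\<lambda>y. \<gamma> * (1 - \<gamma>) * y)"
      using that by (intro smooth_near_ord_ge_1 smy) auto
    from ord_ge_mult[OF this ord_at_imp_ge[OF T0]] show ?thesis
      unfolding eq using R by (intro ord_ge_add[of _ _ ?T]) simp_all
  qed
  show "ord_at y0 (2 * n + 1) (hess1 \<kappa> \<gamma> G)" if "\<gamma> > 0" "\<gamma> \<noteq> 1" "y0 \<noteq> 0"
  proof -
    have "ord_at y0 0 (\<lambda>y. \<gamma> * (1 - \<gamma>) * y)"
      using that by (intro ord_at_0I smy) auto
    from ord_at_mult[OF this T0] show ?thesis
      unfolding eq using R by (intro ord_at_add_ge) simp_all
  qed
qed

text \<open>A flat \<open>G\<close> leaves \<open>(fst X)\<^sup>2 * R X\<close> plus a flat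
  function. This is form (i) with \<open>k = 2\<close> once the interchange \<open>W\<close> has
  moved the square to the second coordinate.\<close>

lemma normal_form_i_flat:
  fixes L :: "real \<times> real \<Rightarrow> real \<times> real"
  assumes "linear L" "bij L" and rep: "germ_qhom \<Phi> \<kappa> \<gamma> y0 g" "flat_at (hess1 \<kappa> \<gamma> g) y0"
    and R: "smooth_nonzero_near 0 R" and G: "flat_at G y0" "smooth_near y0 G"
    and F: "\<forall>\<^sub>F X in nhds 0. (phi_at \<Phi> (1, y0) \<circ> L) X = (fst X)\<^sup>2 * R X + qhom \<kappa> \<gamma> G ((1, y0) + L X)"
  shows "admits_nf \<gamma> y0 \<Phi>"
proof -
  define W where "W X = (snd X, fst X)" for X :: "real \<times> real"
  have W: "linear W" "bij W" "W 0 = 0"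
    unfolding W_def by (auto intro!: linearI o_bij[of "\<lambda>x. (snd x, fst x)"] simp: zero_prod_def)
  have lin: "linear (L \<circ> W)" "bij (L \<circ> W)"
    using W assms linear_compose bij_comp by blast+
  have "isCont (\<lambda>X. 0 + W X) 0" using isCont_linear_plane[OF W(1)] .
  then have "\<forall>\<^sub>F X in nhds 0. (phi_at \<Phi> (1, y0) \<circ> L) (0 + W X) =
      (fst (0 + W X))\<^sup>2 * R (0 + W X) + qhom \<kappa> \<gamma> G ((1, y0) + L (0 + W X))"
    by (rule eventually_nhds_compose) (use F W(3) in simp)
  then have F': "\<forall>\<^sub>F X in nhds 0. (phi_at \<Phi> (1, y0) \<circ> (L \<circ> W)) X =
      (snd X)\<^sup>2 * R (W X) + qhom \<kappa> \<gamma> G ((1, y0) + (L \<circ> W) X)"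
    by (simp add: W_def)
  have L0: "L (W 0) = 0" using W(3) linear_0[OF assms(1)] by simp
  have "flat_at (\<lambda>X. qhom \<kappa> \<gamma> G ((1, y0) + (L \<circ> W) X)) 0"
    unfolding qhom_def by (rule flat_at_qhom_linear[OF lin(1) G])
  moreover have "smooth_near 0 (\<lambda>X. qhom \<kappa> \<gamma> G ((1, y0) + (L \<circ> W) X))"
    by (rule smooth_near_affine_compose[OF lin(1)]) (use G in \<open>simp add: L0 smooth_near_qhom\<close>)
  moreover have "smooth_nonzero_near 0 (\<lambda>X. R (W X))"
    using R smooth_near_affine_compose[OF W(1), of 0 0 R] W(3) by (simp add: smooth_nonzero_near_def)
  ultimately have "normal_form_i (phi_at \<Phi> (1, y0) \<circ> (L \<circ> W)) 2 (\<lambda>X. R (W X))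
      (\<lambda>X. qhom \<kappa> \<gamma> G ((1, y0) + (L \<circ> W) X))"
    unfolding normal_form_i_def using F' germ_qhom_hessian_flat[OF rep(1) lin(1) rep(2)] by simp
  then show ?thesis unfolding admits_nf_def using lin by (intro exI[of _ NF_i] exI[of _ "L \<circ> W"]) auto
qed

text \<open>Two independent alternatives: whether \<psi> is zero separates (ii), (iii) from (iv),
  (v), and the shape of \<open>R\<close> decides within each pair.\<close>

lemma normal_forms_ii_to_v:
  assumes L: "curve_coords \<gamma> y0 L \<psi>" and \<psi>: "\<psi> = (\<lambda>_. 0) \<or> \<psi> 0 \<noteq> 0 \<and> \<gamma> \<noteq> 1"
    and rep: "germ_qhom \<Phi> \<kappa> \<gamma> y0 g" "ord_at y0 (k - 2) (hess1 \<kappa> \<gamma> g)"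
    and R: "smooth_nonzero_near 0 R" and k: "k \<ge> 3" and G: "ord_at y0 k G"
    and F: "\<forall>\<^sub>F X in nhds 0. (phi_at \<Phi> (1, y0) \<circ> L) X = (fst X)\<^sup>2 * R X + qhom \<kappa> \<gamma> G ((1, y0) + L X)"
    and cases: "(\<exists>r. smooth_nonzero_near 0 r \<and> (\<forall>\<^sub>F X in nhds 0. R X = r (fst X))) \<or>
      (geometric_jet k R \<and> \<gamma> \<noteq> 1)"
  shows "admits_nf \<gamma> y0 \<Phi>"
proof -
  let ?F = "phi_at \<Phi> (1, y0) \<circ> L"
  let ?l = "\<lambda>X. snd X - (fst X)\<^sup>2 * \<psi> (fst X)"
  have lin: "linear L" "bij L" "smooth_near 0 \<psi>" using L by (auto simp: curve_coords_def)
  obtain q where q: "smooth_nonzero_near 0 q" "\<forall>\<^sub>F X in nhds 0. hessian_det ?F X = ?l X ^ (k - 2) * q X"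
    by (rule germ_qhom_hessian_ord_at[OF rep(1) L rep(2)])
  obtain r\<^sub>2 where r\<^sub>2: "smooth_nonzero_near 0 r\<^sub>2"
    "\<forall>\<^sub>F X in nhds 0. fst ((1, y0) + L X) powr \<kappa> * G (qslope \<gamma> ((1, y0) + L X)) = ?l X ^ k * r\<^sub>2 X"
    by (rule curve_coords_ord_at[OF L G])
  have F': "\<forall>\<^sub>F X in nhds 0. ?F X = (fst X)\<^sup>2 * R X + ?l X ^ k * r\<^sub>2 X"
    using F r\<^sub>2(2) by eventually_elim (simp add: qhom_def)
  consider r where "smooth_nonzero_near 0 r" "\<forall>\<^sub>F X in nhds 0. ?F X = (fst X)\<^sup>2 * r (fst X) + ?l X ^ k * r\<^sub>2 X"
    | "geometric_jet k R" "\<gamma> \<noteq> 1"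
  proof -
    have "\<forall>\<^sub>F X in nhds 0. ?F X = (fst X)\<^sup>2 * r (fst X) + ?l X ^ k * r\<^sub>2 X"
      if "\<forall>\<^sub>F X in nhds 0. R X = r (fst X)" for r
      using F' that by eventually_elim simp
    then show ?thesis using cases that by blast
  qed
  then show ?thesis
  proof cases
    case (1 r)
    show ?thesis
    proof (cases "\<psi> = (\<lambda>_. 0)")
      case True
      have "normal_form_ii ?F k r r\<^sub>2 q"
        using 1 q r\<^sub>2(1) k True by (simp add: normal_form_ii_def)
      then show ?thesis using lin unfolding admits_nf_def
        by (intro exI[of _ NF_ii] exI[of _ L]) auto
    next
      case False
      then have "normal_form_iv ?F k \<psi> r r\<^sub>2 q"
        using 1 q r\<^sub>2(1) k \<psi> lin by (auto simp: normal_form_iv_def smooth_nonzero_near_def)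
      then show ?thesis using lin L False \<psi> unfolding admits_nf_def
        by (intro exI[of _ NF_iv] exI[of _ L] exI[of _ \<psi>]) auto
    qed
  next
    case 2
    show ?thesis
    proof (cases "\<psi> = (\<lambda>_. 0)")
      case True
      have "normal_form_iii ?F k R r\<^sub>2 q"
        using 2 q r\<^sub>2(1) k True F' R by (simp add: normal_form_iii_def)
      then show ?thesis using lin 2 unfolding admits_nf_def
        by (intro exI[of _ NF_iii] exI[of _ L]) auto
    next
      case False
      then have "normal_form_v ?F k \<psi> R r\<^sub>2 q"
        using 2 q r\<^sub>2(1) k \<psi> lin F' R by (auto simp: normal_form_v_def smooth_nonzero_near_def)
      then show ?thesis using lin L 2 unfolding admits_nf_def
        by (intro exI[of _ NF_v] exI[of _ L] exI[of _ \<psi>]) auto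
    qed
  qed
qed

section \<open>Normal forms when \<open>(\<kappa>-\<gamma>) g'(y0) = 0\<close>\<close>

lemma ord_at_base:
  assumes "smooth_near y0 G" "G y0 = 0" "\<D> G y0 = 0"
  shows "qhom \<kappa> \<gamma> G (1, y0) = 0" "\<partial>\<^sub>1 (qhom \<kappa> \<gamma> G) (1, y0) = 0" "\<partial>\<^sub>2 (qhom \<kappa> \<gamma> G) (1, y0) = 0"
  using assms by (simp_all add: partial_deriv_qhom) (simp_all add: qhom_def)

lemma curve_coords_cases:
  assumes "a + b * (\<gamma> * y0) \<noteq> 0" "\<gamma> > 0"
  obtains "\<gamma> = 1 \<or> y0 = 0" "curve_coords \<gamma> y0 (coordL a b (\<gamma> * y0)) (\<lambda>_. 0)"
  | \<psi> where "\<gamma> \<noteq> 1" "y0 \<noteq> 0" "curve_coords \<gamma> y0 (coordL a b (\<gamma> * y0)) \<psi>" "\<psi> 0 \<noteq> 0"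
proof (cases "\<gamma> = 1 \<or> y0 = 0")
  case True
  then show ?thesis using curve_coords_straight[OF assms(1)] that(1) by blast
next
  case False
  then obtain \<psi> where "curve_coords \<gamma> y0 (coordL a b (\<gamma> * y0)) \<psi>" "\<psi> 0 \<noteq> 0"
    using curve_coords_curved[OF assms] by blast
  with False that(2) show ?thesis by blast
qed

text \<open>Here \<open>phi_at\<close> is a nonvanishing function times the root function to the
  power \<open>n + 2\<close>. The Hessian exponent comes from \<open>hess1_ord\<close>; a straight
  curve gives (i), a curved one (vi).\<close>

lemma normal_forms_i_vi:
  assumes \<gamma>: "\<gamma> > 0" and rep: "germ_qhom \<Phi> \<kappa> \<gamma> y0 G" and G: "ord_at y0 (n + 2) G"
  shows "admits_nf \<gamma> y0 \<Phi>"
proof -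
  let ?L = "coordL 1 0 (\<gamma> * y0)" and ?F = "phi_at \<Phi> (1, y0) \<circ> coordL 1 0 (\<gamma> * y0)"
  have lin: "linear ?L" "bij ?L" by (auto intro: linear_coordL bij_coordL)
  obtain c a b where smG: "smooth_near y0 G"
    and ev: "\<forall>\<^sub>F x in nhds (1, y0). \<Phi> x = qhom \<kappa> \<gamma> G x + (c + a * fst x + b * snd x)"
    using rep by (auto simp: germ_qhom_def)
  have "ord_at y0 (n + 1) (\<D> G)" using G by (intro ord_at_deriv) simp
  then have G0: "G y0 = 0" "\<D> G y0 = 0" using ord_at_zero_iff G by auto
  have F: "\<forall>\<^sub>F X in nhds 0. ?F X = qhom \<kappa> \<gamma> G ((1, y0) + ?L X)"
    by (rule phi_at_local[OF lin(1) _ _ _ _ ev])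
      (use smooth_near_qhom[of "(1, y0)" \<gamma> G \<kappa>] smG ord_at_base[OF smG G0] in auto)
  have pull: "\<exists>r. smooth_nonzero_near 0 r \<and>
      (\<forall>\<^sub>F X in nhds 0. ?F X = (snd X - (fst X)\<^sup>2 * \<psi> (fst X)) ^ (n + 2) * r X)"
    if cc: "curve_coords \<gamma> y0 ?L \<psi>" for \<psi>
  proof -
    obtain r where "smooth_nonzero_near 0 r" "\<forall>\<^sub>F X in nhds 0. fst ((1, y0) + ?L X) powr \<kappa> *
        G (qslope \<gamma> ((1, y0) + ?L X)) = (snd X - (fst X)\<^sup>2 * \<psi> (fst X)) ^ (n + 2) * r X"
      by (rule curve_coords_ord_at[OF cc G])
    then show ?thesis using F by (intro exI[of _ r]) (auto simp: qhom_def elim: eventually_elim2)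
  qed
  have "(1::real) + 0 * (\<gamma> * y0) \<noteq> 0" by simp
  from this \<gamma> show ?thesis
  proof (cases rule: curve_coords_cases)
    case 1
    note cc = 1(2)
    obtain r where r: "smooth_nonzero_near 0 r" "\<forall>\<^sub>F X in nhds 0. ?F X = (snd X) ^ (n + 2) * r X"
      using pull[OF 1(2)] by auto
    have nf: "normal_form_i ?F (n + 2) r (\<lambda>_. 0)" if
      "flat_at (hessian_det ?F) 0 \<or> (\<exists>k' q. smooth_nonzero_near 0 q \<and>
        (\<forall>\<^sub>F X in nhds 0. hessian_det ?F X = snd X ^ (k' + 2 * (n + 2) - 2) * q X))"
    proof -
      have "foldr partial_deriv bs (\<lambda>_. 0) = (\<lambda>_::real\<times>real. 0)" for bs
        by (induction bs) (auto simp: partial_deriv_const)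
      then have "flat_at (\<lambda>_::real\<times>real. 0) 0" by (simp add: flat_at_iff)
      then show ?thesis using that r by (simp add: normal_form_i_def smooth_near_const)
    qed
    from hess1_ord(2)[OF G 1(1), of \<kappa>] have "normal_form_i ?F (n + 2) r (\<lambda>_. 0)"
    proof (cases rule: ord_ge_cases)
      case 1
      then show ?thesis using germ_qhom_hessian_flat[OF rep lin(1)] nf by blast
    next
      case (2 j)
      obtain q where q: "smooth_nonzero_near 0 q"
        "\<forall>\<^sub>F X in nhds 0. hessian_det ?F X = (snd X - (fst X)\<^sup>2 * 0) ^ (2 * n + 2 + j) * q X"
        by (rule germ_qhom_hessian_ord_at[OF rep cc 2])
      have "j + 2 * (n + 2) - 2 = 2 * n + 2 + j" by simp
      with q(2) have "\<forall>\<^sub>F X in nhds 0. hessian_det ?F X = snd X ^ (j + 2 * (n + 2) - 2) * q X"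
        by (simp only: mult_zero_right diff_zero)
      with q(1) show ?thesis by (intro nf disjI2 exI[of _ j] exI[of _ q] conjI)
    qed
    then show ?thesis using lin unfolding admits_nf_def by (intro exI[of _ NF_i] exI[of _ ?L]) auto
  next
    case (2 \<psi>)
    obtain r where r: "smooth_nonzero_near 0 r"
      "\<forall>\<^sub>F X in nhds 0. ?F X = (snd X - (fst X)\<^sup>2 * \<psi> (fst X)) ^ (n + 2) * r X"
      using pull[OF 2(3)] by auto
    obtain q where q: "smooth_nonzero_near 0 q"
      "\<forall>\<^sub>F X in nhds 0. hessian_det ?F X = (snd X - (fst X)\<^sup>2 * \<psi> (fst X)) ^ (2 * n + 1) * q X"
      by (rule germ_qhom_hessian_ord_at[OF rep 2(3) hess1_ord(3)[OF G \<gamma> 2(1,2)]])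
    have "2 * (n + 2) - 3 = 2 * n + 1" by simp
    then have "normal_form_vi ?F (n + 2) \<psi> r q"
      using r q 2 unfolding normal_form_vi_def by (auto simp: smooth_nonzero_near_def curve_coords_def)
    then show ?thesis using lin 2 unfolding admits_nf_def by (intro exI[of _ NF_vi] exI[of _ ?L] exI[of _ \<psi>]) auto
  qed
qed

lemma line_deriv_add_const:
  assumes "smooth_near y0 G"
  shows "\<forall>\<^sub>F y in nhds y0. \<D> (\<lambda>y. G y + c) y = \<D> G y"
  using smooth_near_eventually[OF assms]
  by eventually_elim (simp add: partial_deriv_add partial_deriv_const smooth_near_differentiable)

text \<open>Up to affine terms the constant \<open>d\<close> contributes
  \<open>d (u^\<kappa> - 1 - \<kappa> (u - 1))\<close>, whose graph is a cylinder. If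
  \<open>G\<close> has finite order \<open>k\<close>, then the summand
  \<open>\<kappa> (\<kappa>-1) d G''\<close> of the Hessian function has order \<open>k - 2\<close>
  and dominates \<open>hess1 \<kappa> \<gamma> G\<close>, of order at least \<open>2 k - 3\<close>;
  \<open>G''(y0) = 0\<close> gives \<open>k \<ge> 3\<close>.\<close>

lemma normal_forms_cylinder:
  assumes \<gamma>: "\<gamma> > 0" and rep: "germ_qhom \<Phi> \<kappa> \<gamma> y0 (\<lambda>y. G y + d)" and smG: "smooth_near y0 G"
    and G0: "G y0 = 0" "\<D> G y0 = 0" "\<D> (\<D> G) y0 = 0" and B: "\<kappa> * (\<kappa> - 1) * d \<noteq> 0"
  shows "admits_nf \<gamma> y0 \<Phi>"
proof -
  let ?L = "coordL 1 0 (\<gamma> * y0)" and ?F = "phi_at \<Phi> (1, y0) \<circ> coordL 1 0 (\<gamma> * y0)"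
  have lin: "linear ?L" "bij ?L" by (auto intro: linear_coordL bij_coordL)
  obtain c a b where
    ev: "\<forall>\<^sub>F x in nhds (1, y0). \<Phi> x = qhom \<kappa> \<gamma> (\<lambda>y. G y + d) x + (c + a * fst x + b * snd x)"
    using rep by (auto simp: germ_qhom_def)
  obtain w where w: "smooth_near 0 w" "\<forall>\<^sub>F t in nhds 0. (1 + t) powr \<kappa> = 1 + \<kappa> * t + t\<^sup>2 * w t"
    "w 0 = \<kappa> * (\<kappa> - 1) / 2" by (rule powr_taylor2)
  let ?\<Psi> = "\<lambda>x. qhom \<kappa> \<gamma> G x + d * (fst x powr \<kappa> - 1 - \<kappa> * (fst x - 1))"
  have "\<forall>\<^sub>F x in nhds (1, y0). \<Phi> x = ?\<Psi> x + ((c + d - \<kappa> * d) + (a + \<kappa> * d) * fst x + b * snd x)"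
    using ev by eventually_elim (simp add: qhom_def algebra_simps)
  have smq: "smooth_near (1, y0) (qhom \<kappa> \<gamma> G)"
    using smooth_near_qhom[of "(1, y0)" \<gamma> G] smG by simp
  have smd: "smooth_near (1, y0) (\<lambda>x. d * (fst x powr \<kappa> - 1 - \<kappa> * (fst x - 1)))"
    by (intro smooth) simp
  have dd: "((\<lambda>x. d * (fst x powr \<kappa> - 1 - \<kappa> * (fst x - 1))) has_derivative (\<lambda>h. 0)) (at (1, y0))"
    by (auto intro!: derivative_eq_intros)
  have pd: "partial_deriv b ?\<Psi> (1, y0) = partial_deriv b (qhom \<kappa> \<gamma> G) (1, y0) +
      partial_deriv b (\<lambda>x. d * (fst x powr \<kappa> - 1 - \<kappa> * (fst x - 1))) (1, y0)" for b
    by (rule partial_deriv_add[OF smooth_near_differentiable[OF smq] smooth_near_differentiable[OF smd]])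
  have F: "\<forall>\<^sub>F X in nhds 0. ?F X = ?\<Psi> ((1, y0) + ?L X)"
    by (rule phi_at_local[OF lin(1) _ _ _ _ \<open>\<forall>\<^sub>F x in nhds (1, y0). _ = ?\<Psi> _ + _\<close>])
      (use smq smd ord_at_base[OF smG G0(1,2)] partial_deriv_eq[OF dd] in \<open>auto intro: smooth simp: pd\<close>)
  \<comment> \<open>With \<open>a = 1\<close> and \<open>b = 0\<close> the first coordinate is kept,
    so the contribution of \<open>d\<close> depends on it alone, as (ii) and (iv) require.\<close>
  have fstL: "fst (?L X) = fst X" for X by (simp add: coordL_def)
  have "\<forall>\<^sub>F X in nhds (0 :: real \<times> real). (1 + fst X) powr \<kappa> = 1 + \<kappa> * fst X + (fst X)\<^sup>2 * w (fst X)"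
    using eventually_nhds_compose[where A = fst and p = "0 :: real \<times> real", OF _ w(2)[folded fst_zero[where 'a = real and 'b = real]]]
    by (auto intro!: continuous_intros)
  then have F': "\<forall>\<^sub>F X in nhds 0. ?F X = (fst X)\<^sup>2 * (d * w (fst X)) + qhom \<kappa> \<gamma> G ((1, y0) + ?L X)"
    using F by eventually_elim (simp add: fstL algebra_simps)
  have r: "smooth_nonzero_near 0 (\<lambda>t. d * w t)"
    unfolding smooth_nonzero_near_def w(3) using w(1) B by (auto intro: smooth)
  have "smooth_near (0::real\<times>real) (\<lambda>X. w (fst X))"
    by (rule smooth_near_compose_real) (use w in \<open>auto intro: smooth\<close>)
  then have R: "smooth_nonzero_near (0::real\<times>real) (\<lambda>X. d * w (fst X))"
    using r by (auto simp: smooth_nonzero_near_def intro: smooth)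
  note D = line_deriv_add_const[OF smG, of d]
  have hess: "\<forall>\<^sub>F y in nhds y0. hess1 \<kappa> \<gamma> (\<lambda>y. G y + d) y = \<kappa> * (\<kappa> - 1) * d * \<D> (\<D> G) y + hess1 \<kappa> \<gamma> G y"
    using D eventually_partial_deriv_cong[OF D, of 1]
    by eventually_elim (simp add: hess1_def algebra_simps)
  from smG show ?thesis
  proof (cases rule: order_cases)
    case 1
    have f1: "flat_at (\<D> G) y0" by (rule flat_at_partial[OF 1]) simp
    have f2: "flat_at (\<D> (\<D> G)) y0" by (rule flat_at_partial[OF f1]) simp
    have "flat_at (\<lambda>y. \<D> (\<D> G) y * (\<kappa> * (\<kappa> - 1) * d + \<kappa> * (\<kappa> - 1) * G y + \<gamma> * (1 - \<gamma>) * y * \<D> G y)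
        + \<D> G y * (- ((\<kappa> - \<gamma>)\<^sup>2) * \<D> G y)) y0"
      by (intro flat_at_add flat_at_mult f1 f2 smooth smG)
    also have "(\<lambda>y. \<D> (\<D> G) y * (\<kappa> * (\<kappa> - 1) * d + \<kappa> * (\<kappa> - 1) * G y + \<gamma> * (1 - \<gamma>) * y * \<D> G y)
        + \<D> G y * (- ((\<kappa> - \<gamma>)\<^sup>2) * \<D> G y)) = (\<lambda>y. \<kappa> * (\<kappa> - 1) * d * \<D> (\<D> G) y + hess1 \<kappa> \<gamma> G y)"
      by (rule ext) (simp add: hess1_def algebra_simps power2_eq_square)
    finally have "flat_at (hess1 \<kappa> \<gamma> (\<lambda>y. G y + d)) y0"
      using flat_at_cong[OF hess] by simp
    from normal_form_i_flat[OF lin rep this R 1 smG F'] show ?thesis .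
  next
    case (2 k)
    have "k \<noteq> 2" "k \<ge> 2"
    proof -
      show "k \<ge> 2" using ord_at_ge_2[OF 2] G0 by simp
      show "k \<noteq> 2"
      proof
        assume "k = 2"
        then have "ord_at y0 (Suc (Suc 0)) G" using 2 by (simp add: numeral_2_eq_2)
        from ord_at_zero_iff[OF ord_at_deriv[OF ord_at_deriv[OF this]]] G0 show False by simp
      qed
    qed
    then have "k = (k - 3) + 1 + 2" by simp
    then obtain n where n: "k = n + 1 + 2" by blast
    have G2: "ord_at y0 (n + 1) (\<D> (\<D> G))"
      using 2 n by (intro ord_at_deriv) simp
    have "ord_ge y0 (Suc (n + 1)) (hess1 \<kappa> \<gamma> G)"
      by (rule ord_ge_mono[OF hess1_ord(1)[OF 2[unfolded n]]]) simp
    from ord_at_add_ge[OF ord_at_cmult[OF G2 B] this]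
    have "ord_at y0 (n + 1) (hess1 \<kappa> \<gamma> (\<lambda>y. G y + d))"
      by (rule ord_at_cong) (use hess in \<open>auto elim: eventually_mono\<close>)
    then have h: "ord_at y0 (k - 2) (hess1 \<kappa> \<gamma> (\<lambda>y. G y + d))" using n by simp
    have "(1::real) + 0 * (\<gamma> * y0) \<noteq> 0" by simp
    from this \<gamma> obtain \<psi> where \<psi>: "\<psi> = (\<lambda>_. 0) \<or> \<psi> 0 \<noteq> 0 \<and> \<gamma> \<noteq> 1" "curve_coords \<gamma> y0 ?L \<psi>"
      by (cases rule: curve_coords_cases) blast+
    have "\<exists>r. smooth_nonzero_near 0 r \<and> (\<forall>\<^sub>F X in nhds (0::real\<times>real). d * w (fst X) = r (fst X))"
      using r by (intro exI[of _ "\<lambda>t. d * w t"]) simp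
    then show ?thesis
      using n by (intro normal_forms_ii_to_v[OF \<psi>(2,1) rep h R _ 2 F']) auto
  qed
qed

section \<open>Developable mixed homogeneous graphs\<close>

lemma partial_deriv_powr:
  assumes "smooth_near x f" "f x > 0"
  shows "partial_deriv b (\<lambda>x. f x powr a) x = a * f x powr (a - 1) * partial_deriv b f x"
proof -
  have "((\<lambda>y. y powr a) has_derivative (\<lambda>h. a * f x powr (a - 1) * h)) (at (f x))"
    using has_real_derivative_powr[OF assms(2), of a] by (simp add: has_field_derivative_def)
  moreover have "(f has_derivative frechet_derivative f (at x)) (at x)"
    using smooth_near_differentiable[OF assms(1)] by (simp add: frechet_derivative_works)
  ultimately have "((\<lambda>x. f x powr a) has_derivative (\<lambda>h. a * f x powr (a - 1) * frechet_derivative f (at x) h)) (at x)"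
    by (rule has_derivative_compose[rotated])
  from partial_deriv_eq[OF this] show ?thesis by (simp add: partial_deriv_def)
qed

lemma powr_shift: "(x::real) > 0 \<Longrightarrow> x powr a = x powr (a - 1) * x"
  using powr_add[of x "a - 1" 1] by simp

text \<open>The developable surface is the envelope of the planes
  \<open>x \<mapsto> p1 s\<^bsup>\<kappa>-1\<^esup> x\<^sub>1 + p2 s\<^bsup>\<kappa>-\<gamma>\<^esup> x\<^sub>2 + c0 s\<^bsup>\<kappa>\<^esup>\<close>, the dilates of one tangent plane.  On the line
  \<open>x\<^sub>1 = 1\<close> the ruling with parameter \<open>s\<close> passes through \<open>(1, y)\<close> for \<open>s = S y\<close>.\<close>

locale developable =
  fixes \<kappa> \<gamma> y0 p1 p2 c0 :: real and S :: "real \<Rightarrow> real" and l l' P :: real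
  defines "l \<equiv> (\<kappa> - 1) * p1" and "l' \<equiv> (\<kappa> - \<gamma>) * p2" and "P \<equiv> l + l' * (\<gamma> * y0)"
  assumes l': "l' \<noteq> 0" and P: "P \<noteq> 0" and c0: "\<kappa> * c0 = - (l + l' * y0)"
    and smS: "smooth_near y0 S" and S1: "S y0 = 1"
    and ruling: "\<forall>\<^sub>F y in nhds y0. l * S y powr (\<kappa> - 1) + l' * y * S y powr (\<kappa> - \<gamma>) + \<kappa> * c0 * S y powr \<kappa> = 0"
    and inverse: "\<forall>\<^sub>F s in nhds 1. S (- (l * s powr (\<gamma> - 1) + \<kappa> * c0 * s powr \<gamma>) / l') = s"
begin

text \<open>Height over \<open>(1, y)\<close> of the enveloping plane with parameter
  \<open>S y\<close>. The assumption \<open>ruling\<close> is the envelope condition: its left side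
  is \<open>s\<close> times the derivative in \<open>s\<close> of \<open>p1 s^(\<kappa>-1) + p2 y
  s^(\<kappa>-\<gamma>) + c0 s^\<kappa>\<close> at \<open>s = S y\<close>.\<close>

definition g0 :: "real \<Rightarrow> real"
  where "g0 y = p1 * S y powr (\<kappa> - 1) + p2 * y * S y powr (\<kappa> - \<gamma>) + c0 * S y powr \<kappa>"

lemma near_S: "\<forall>\<^sub>F y in nhds y0. smooth_near y S \<and> S y > 0 \<and>
    l * S y powr (\<kappa> - 1) + l' * y * S y powr (\<kappa> - \<gamma>) + \<kappa> * c0 * S y powr \<kappa> = 0"
proof -
  have "\<forall>\<^sub>F y in nhds y0. S y > 0"
    by (rule eventually_nhds_compose[OF smooth_near_isCont[OF smS]])
      (use eventually_nhds_in_open[of "{0<..}" "1::real"] S1 in simp)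
  then show ?thesis using smooth_near_eventually[OF smS] ruling by eventually_elim simp
qed

lemma smooth_g0: "smooth_near y0 g0"
  unfolding g0_def by (intro smooth smS) (simp_all add: S1)

lemma DERIV_S_powr:
  assumes "smooth_near y S" "S y > 0"
  shows "((\<lambda>y. S y powr a) has_real_derivative a * S y powr (a - 1) * \<D> S y) (at y)"
  using has_real_derivative_partial[of y "\<lambda>y. S y powr a"] partial_deriv_powr[OF assms, of 1 a] assms
  by (auto intro: smooth)

text \<open>Envelope theorem: by \<open>ruling\<close> the terms with the derivative of
  \<open>S\<close> add up to zero, so the surface has the gradient of the enveloping plane. The
  second identity is the component \<open>\<partial>\<^sub>1\<close> at
  \<open>(1, y)\<close>.\<close>

lemma near_g0: "\<forall>\<^sub>F y in nhds y0. \<D> g0 y = p2 * S y powr (\<kappa> - \<gamma>) \<and>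
    \<kappa> * g0 y - \<gamma> * y * \<D> g0 y = p1 * S y powr (\<kappa> - 1)"
  using near_S
proof eventually_elim
  case (elim y)
  then have S: "smooth_near y S" "S y > 0" by auto
  let ?A = "S y powr (\<kappa> - 1 - 1)" and ?B = "S y powr (\<kappa> - \<gamma> - 1)" and ?C = "S y powr (\<kappa> - 1)"
  note sh = powr_shift[OF S(2), of "\<kappa> - 1"] powr_shift[OF S(2), of "\<kappa> - \<gamma>"] powr_shift[OF S(2), of \<kappa>]
  have "(l * ?A + l' * y * ?B + \<kappa> * c0 * ?C) * S y = 0"
    using elim sh by algebra
  then have z: "l * ?A + l' * y * ?B + \<kappa> * c0 * ?C = 0" using S by simp
  have "(g0 has_real_derivative
      p1 * ((\<kappa> - 1) * ?A * \<D> S y) + (p2 * y * ((\<kappa> - \<gamma>) * ?B * \<D> S y) + p2 * S y powr (\<kappa> - \<gamma>)) +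
      c0 * (\<kappa> * ?C * \<D> S y)) (at y)"
    unfolding g0_def
    by (rule derivative_eq_intros DERIV_S_powr[OF S] refl)+ simp
  then have "\<D> g0 y = p1 * ((\<kappa> - 1) * ?A * \<D> S y) + (p2 * y * ((\<kappa> - \<gamma>) * ?B * \<D> S y) + p2 * S y powr (\<kappa> - \<gamma>)) +
      c0 * (\<kappa> * ?C * \<D> S y)" by (rule partial_deriv_real)
  also have "\<dots> = p2 * S y powr (\<kappa> - \<gamma>)"
    using z unfolding l_def l'_def by algebra
  finally have D: "\<D> g0 y = p2 * S y powr (\<kappa> - \<gamma>)" .
  moreover have "\<kappa> * g0 y - \<gamma> * y * \<D> g0 y = p1 * S y powr (\<kappa> - 1)"
    using elim unfolding D unfolding g0_def l_def l'_def by algebra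
  ultimately show ?case by blast
qed

text \<open>Both components of the gradient depend on the single parameter \<open>S\<close>, so the
  Hessian matrix is degenerate. The computation eliminates the derivative of \<open>S\<close> from
  the two differentiated identities of \<open>near_g0\<close>.\<close>

lemma hess1_g0: "\<forall>\<^sub>F y in nhds y0. hess1 \<kappa> \<gamma> g0 y = 0"
proof -
  have ev: "\<forall>\<^sub>F y in nhds y0. \<D> g0 y = p2 * S y powr (\<kappa> - \<gamma>)"
    "\<forall>\<^sub>F y in nhds y0. \<kappa> * g0 y - \<gamma> * y * \<D> g0 y = p1 * S y powr (\<kappa> - 1)"
    using near_g0 by (auto elim: eventually_mono)
  show ?thesis
    using near_S near_g0 eventually_partial_deriv_cong[OF ev(1), of 1] eventually_partial_deriv_cong[OF ev(2), of 1]
      smooth_near_eventually[OF smooth_g0]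
  proof eventually_elim
    case (elim y)
    then have S: "smooth_near y S" "S y > 0" by auto
    let ?A = "S y powr (\<kappa> - 1 - 1)" and ?B = "S y powr (\<kappa> - \<gamma> - 1)"
    note sh = powr_shift[OF S(2), of "\<kappa> - 1"] powr_shift[OF S(2), of "\<kappa> - \<gamma>"]
    have "\<D> (\<D> g0) y = p2 * ((\<kappa> - \<gamma>) * ?B * \<D> S y)"
      unfolding elim(3) by (intro partial_deriv_real DERIV_cmult DERIV_S_powr S)
    moreover have "\<D> (\<lambda>y. p1 * S y powr (\<kappa> - 1)) y = p1 * ((\<kappa> - 1) * ?A * \<D> S y)"
      by (intro partial_deriv_real DERIV_cmult DERIV_S_powr S)
    moreover have "\<D> (\<lambda>y. \<kappa> * g0 y - \<gamma> * y * \<D> g0 y) y = \<kappa> * \<D> g0 y - (\<gamma> * \<D> g0 y + \<gamma> * y * \<D> (\<D> g0) y)"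
      using elim(5) by (intro partial_deriv_real)
        (auto intro!: derivative_eq_intros has_real_derivative_partial smooth)
    ultimately have
      "\<kappa> * \<D> g0 y - (\<gamma> * \<D> g0 y + \<gamma> * y * \<D> (\<D> g0) y) = p1 * ((\<kappa> - 1) * ?A * \<D> S y)"
      "\<D> (\<D> g0) y = p2 * ((\<kappa> - \<gamma>) * ?B * \<D> S y)"
      using elim(4) by simp_all
    moreover have "\<kappa> * g0 y - \<gamma> * y * \<D> g0 y = p1 * (?A * S y)" "\<D> g0 y = p2 * (?B * S y)"
      using elim(2) sh by auto
    ultimately show ?case unfolding hess1_def by algebra
  qed
qed

lemma g0_base: "g0 y0 = p1 + p2 * y0 + c0" "\<D> g0 y0 = p2"
  using eventually_nhds_x_imp_x[OF near_g0] by (simp_all add: g0_def S1)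

text \<open>\<open>hess1\<close> is quadratic, so for \<open>d = g - g0\<close> the difference of
  the two values is \<open>A d'' + B d' + C d\<close>. The last two terms have higher order than
  \<open>d''\<close>, and \<open>A y0 \<noteq> 0\<close> by the last hypothesis.\<close>

lemma hess1_order:
  assumes g: "smooth_near y0 g" "g y0 = p1 + p2 * y0 + c0" "\<D> g y0 = p2"
    and a: "\<kappa> * (\<kappa> - 1) * g y0 + \<gamma> * (1 - \<gamma>) * y0 * \<D> g y0 \<noteq> 0"
  obtains "flat_at (\<lambda>y. g y - g0 y) y0" "flat_at (hess1 \<kappa> \<gamma> g) y0"
  | k where "k \<ge> 2" "ord_at y0 k (\<lambda>y. g y - g0 y)" "ord_at y0 (k - 2) (hess1 \<kappa> \<gamma> g)"
proof -
  define d where "d = (\<lambda>y. g y - g0 y)"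
  have smd: "smooth_near y0 d" unfolding d_def by (intro smooth g smooth_g0)
  have dd: "\<forall>\<^sub>F y in nhds y0. \<D> d y = \<D> g y - \<D> g0 y"
    using smooth_near_eventually[OF g(1)] smooth_near_eventually[OF smooth_g0] unfolding d_def
    by eventually_elim (auto intro!: partial_deriv_real derivative_eq_intros has_real_derivative_partial)
  have ddd: "\<forall>\<^sub>F y in nhds y0. \<D> (\<D> d) y = \<D> (\<D> g) y - \<D> (\<D> g0) y"
    using eventually_partial_deriv_cong[OF dd, of 1] smooth_near_eventually[OF g(1)] smooth_near_eventually[OF smooth_g0]
    by eventually_elim (auto intro!: partial_deriv_real derivative_eq_intros has_real_derivative_partial smooth)
  define A where "A y = \<kappa> * (\<kappa> - 1) * g y + \<gamma> * (1 - \<gamma>) * y * \<D> g y" for y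
  define B where "B y = \<gamma> * (1 - \<gamma>) * y * \<D> (\<D> g0) y - (\<kappa> - \<gamma>)\<^sup>2 * (\<D> g y + \<D> g0 y)" for y
  define C where "C y = \<kappa> * (\<kappa> - 1) * \<D> (\<D> g0) y" for y
  have h: "\<forall>\<^sub>F y in nhds y0. \<D> (\<D> d) y * A y + (\<D> d y * B y + d y * C y) = hess1 \<kappa> \<gamma> g y"
    using dd ddd hess1_g0
  proof eventually_elim
    case (elim y)
    have "\<D> (\<D> d) y * A y + (\<D> d y * B y + d y * C y) = hess1 \<kappa> \<gamma> g y - hess1 \<kappa> \<gamma> g0 y"
      using elim(1,2) fun_cong[OF d_def, of y] unfolding A_def B_def C_def hess1_def by algebra
    with elim show ?case by simp
  qed
  have sm: "smooth_near y0 A" "smooth_near y0 B" "smooth_near y0 C"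
    unfolding A_def B_def C_def by (intro smooth g smooth_g0)+
  have d0: "d y0 = 0" "\<D> d y0 = 0"
    using eventually_nhds_x_imp_x[OF dd] g g0_base by (simp_all add: d_def)
  from smd show ?thesis
  proof (cases rule: order_cases)
    case 1
    have f1: "flat_at (\<D> d) y0" by (rule flat_at_partial[OF 1]) simp
    have f2: "flat_at (\<D> (\<D> d)) y0" by (rule flat_at_partial[OF f1]) simp
    have "flat_at (\<lambda>y. \<D> (\<D> d) y * A y + (\<D> d y * B y + d y * C y)) y0"
      by (intro flat_at_add flat_at_mult 1 f1 f2 sm smooth smd)
    then have "flat_at (hess1 \<kappa> \<gamma> g) y0" using flat_at_cong[OF h] by simp
    then show ?thesis using that(1) 1 by (simp add: d_def)
  next
    case (2 k)
    have k: "k \<ge> 2" using ord_at_ge_2[OF 2] d0 by simp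
    then have "k = Suc (Suc (k - 2))" by simp
    then obtain n where n: "k = Suc (Suc n)" by blast
    have o1: "ord_at y0 (Suc n) (\<D> d)" by (rule ord_at_deriv[OF 2[unfolded n]])
    have o2: "ord_at y0 n (\<D> (\<D> d))" by (rule ord_at_deriv[OF o1])
    have "ord_at y0 n (\<lambda>y. \<D> (\<D> d) y * A y)"
      using ord_at_mult[OF o2 ord_at_0I[OF sm(1)]] a by (simp add: A_def)
    moreover have "ord_ge y0 (Suc n) (\<lambda>y. \<D> d y * B y)"
      using ord_ge_mult[OF ord_at_imp_ge[OF o1] smooth_near_ord_ge_0[OF sm(2)]] by simp
    moreover have "ord_ge y0 (Suc n) (\<lambda>y. d y * C y)"
      using ord_ge_mult[OF ord_ge_mono[OF ord_at_imp_ge[OF 2], of "Suc n"] smooth_near_ord_ge_0[OF sm(3)]] n by simp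
    ultimately have "ord_at y0 n (\<lambda>y. \<D> (\<D> d) y * A y + (\<D> d y * B y + d y * C y))"
      by (intro ord_at_add_ge ord_ge_add)
    then have "ord_at y0 (k - 2) (hess1 \<kappa> \<gamma> g)"
      using ord_at_cong[OF _ h] n by simp
    then show ?thesis using that(2)[OF k] 2 by (simp add: d_def)
  qed
qed

end

text \<open>Two divisions by the first coordinate. The third conclusion is kept because
  \<open>normal_form_A\<close> computes \<open>R\<close> on the ruling from the second
  derivative.\<close>

lemma vanish2_fst:
  fixes A :: "real \<times> real \<Rightarrow> real"
  assumes A: "smooth_near 0 A" and z: "\<forall>\<^sub>F t in nhds 0. A (0, t) = 0 \<and> \<partial>\<^sub>1 A (0, t) = 0"
  obtains R where "smooth_near 0 R" "\<forall>\<^sub>F X in nhds 0. A X = (fst X)\<^sup>2 * R X"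
    "\<forall>\<^sub>F t in nhds 0. \<partial>\<^sub>1 (\<partial>\<^sub>1 A) (0, t) = 2 * R (0, t)"
proof -
  have iso: "isCont (\<lambda>t::real. (0::real, t)) 0" by (intro continuous_intros)
  have line: "\<forall>\<^sub>F t in nhds 0. Q (0, t)" if "\<forall>\<^sub>F X in nhds (0::real\<times>real). Q X" for Q
    by (rule eventually_nhds_compose[OF iso]) (use that in \<open>simp add: zero_prod_def\<close>)
  have snd0: "\<forall>\<^sub>F X in nhds (0::real\<times>real). Q (snd X)" if "\<forall>\<^sub>F t in nhds 0. Q t" for Q
    using eventually_nhds_compose[where A = snd and p = "0 :: real \<times> real", OF _ that[folded snd_zero[where 'a = real and 'b = real]]]
    by (auto intro!: continuous_intros)
  have had: "\<exists>q. smooth_near 0 q \<and> (\<forall>\<^sub>F X in nhds 0. f X = fst X * q X)"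
    if f: "smooth_near 0 f" "\<forall>\<^sub>F t in nhds 0. f (0, t) = 0" for f :: "real \<times> real \<Rightarrow> real"
  proof -
    obtain q where q: "smooth_near 0 q" "\<forall>\<^sub>F X in nhds 0. f X - f (X - fst X *\<^sub>R (1, 0)) = fst X * q X"
      using hadamard[OF f(1) smooth_near_fst _ Basis_plane(1)] by auto
    have "\<forall>\<^sub>F X in nhds 0. f X = fst X * q X"
      using q(2) snd0[OF f(2)]
    proof eventually_elim
      case (elim X)
      have "X - fst X *\<^sub>R (1, 0) = (0, snd X)" by (cases X) simp
      with elim show ?case by simp
    qed
    with q(1) show ?thesis by blast
  qed
  have D: "\<forall>\<^sub>F X in nhds 0. \<partial>\<^sub>1 f X = q X + fst X * \<partial>\<^sub>1 q X"
    if "smooth_near 0 q" "\<forall>\<^sub>F X in nhds 0. f X = fst X * q X" for f q :: "real \<times> real \<Rightarrow> real"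
    using eventually_partial_deriv_cong[OF that(2), of "(1, 0)"] smooth_near_eventually[OF that(1)]
  proof eventually_elim
    case (elim X)
    have "((\<lambda>X. fst X * q X) has_derivative (\<lambda>h. fst X * (fst h * \<partial>\<^sub>1 q X + snd h * \<partial>\<^sub>2 q X) + fst h * q X)) (at X)"
      by (rule derivative_eq_intros has_derivative_partial_plane[OF elim(2)] refl)+
    from partial_deriv_eq[OF this, of "(1, 0)"] elim show ?case by simp
  qed
  obtain q where q: "smooth_near 0 q" "\<forall>\<^sub>F X in nhds 0. A X = fst X * q X"
    using had[OF A eventually_mono[OF z]] by blast
  note D1 = D[OF q]
  have "\<forall>\<^sub>F t in nhds 0. q (0, t) = 0"
    using line[OF D1] z by eventually_elim simp
  then obtain R where R: "smooth_near 0 R" "\<forall>\<^sub>F X in nhds 0. q X = fst X * R X"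
    using had[OF q(1)] by auto
  note D2 = D[OF R]
  have "\<forall>\<^sub>F X in nhds 0. \<partial>\<^sub>1 (\<partial>\<^sub>1 A) X = 2 * \<partial>\<^sub>1 q X + fst X * \<partial>\<^sub>1 (\<partial>\<^sub>1 q) X"
    using eventually_partial_deriv_cong[OF D1, of "(1, 0)"] smooth_near_eventually[OF q(1)]
  proof eventually_elim
    case (elim X)
    have "((\<lambda>X. q X + fst X * \<partial>\<^sub>1 q X) has_derivative (\<lambda>h. (fst h * \<partial>\<^sub>1 q X + snd h * \<partial>\<^sub>2 q X) +
       (fst X * (fst h * \<partial>\<^sub>1 (\<partial>\<^sub>1 q) X + snd h * \<partial>\<^sub>2 (\<partial>\<^sub>1 q) X) + fst h * \<partial>\<^sub>1 q X))) (at X)"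
      by (rule derivative_eq_intros has_derivative_partial_plane elim smooth refl)+
    from partial_deriv_eq[OF this, of "(1, 0)"] elim show ?case by simp
  qed
  from line[OF this] line[OF D2] have "\<forall>\<^sub>F t in nhds 0. \<partial>\<^sub>1 (\<partial>\<^sub>1 A) (0, t) = 2 * R (0, t)"
    by eventually_elim simp
  moreover have "\<forall>\<^sub>F X in nhds 0. A X = (fst X)\<^sup>2 * R X"
    using q(2) R(2) by eventually_elim (simp add: power2_eq_square)
  ultimately show ?thesis using that R(1) by blast
qed

text \<open>Repeated differentiation of the constant \<open>R(0, t) (d0 + d1 t)\<close> gives
  \<open>R^(n+1) (d0 + d1 t) + (n + 1) d1 R^(n) = 0\<close>, with derivatives in \<open>t\<close>.
  At \<open>t = 0\<close> this is the recursion with \<open>c = - d1 / d0\<close>.\<close>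

lemma geometric_jetI:
  assumes R: "smooth_near 0 R" and D: "d0 \<noteq> 0" "d1 \<noteq> 0"
    and eq: "\<forall>\<^sub>F t in nhds 0. R (0, t) * (d0 + d1 * t) = C"
  shows "geometric_jet k R"
proof -
  have iso: "isCont (\<lambda>t::real. (0::real, t)) 0" by (intro continuous_intros)
  have smn: "smooth_near 0 ((\<partial>\<^sub>2 ^^ n) R)" for n
    by (induction n) (auto intro: smooth R)
  define u where "u n t = (\<partial>\<^sub>2 ^^ n) R (0, t)" for n t
  have near: "\<forall>\<^sub>F t in nhds 0. (u n has_real_derivative u (Suc n) t) (at t)" for n
  proof -
    have "\<forall>\<^sub>F t in nhds 0. smooth_near (0, t) ((\<partial>\<^sub>2 ^^ n) R)"
      by (rule eventually_nhds_compose[OF iso])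
        (use smooth_near_eventually[OF smn[of n]] in \<open>simp add: zero_prod_def\<close>)
    then show ?thesis
    proof eventually_elim
      case (elim t)
      have "((\<lambda>s. (0::real, s)) has_derivative (\<lambda>s. (0, s))) (at t)"
        by (auto intro!: derivative_eq_intros)
      from has_derivative_compose[OF this has_derivative_partial_plane[OF elim]]
      show ?case
        by (simp add: u_def[abs_def] has_field_derivative_def mult.commute[of _ "\<partial>\<^sub>2 ((\<partial>\<^sub>2 ^^ n) R) (0, t)"])
    qed
  qed
  have step: "\<forall>\<^sub>F t in nhds 0. u (Suc n) t * (d0 + d1 * t) + real (Suc n) * d1 * u n t = 0" for n
  proof (induction n)
    case 0
    have "\<forall>\<^sub>F t in nhds 0. u 0 t * (d0 + d1 * t) = C" using eq by (simp add: u_def)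
    from eventually_partial_deriv_cong[OF this, of 1] near[of 0] show ?case
    proof eventually_elim
      case (elim t)
      have "\<D> (\<lambda>t. u 0 t * (d0 + d1 * t)) t = u (Suc 0) t * (d0 + d1 * t) + real (Suc 0) * d1 * u 0 t"
        by (rule partial_deriv_real) (auto intro!: derivative_eq_intros elim(2))
      with elim(1) show ?case by (simp add: partial_deriv_const)
    qed
  next
    case (Suc n)
    from eventually_partial_deriv_cong[OF Suc.IH, of 1] near[of n] near[of "Suc n"] show ?case
    proof eventually_elim
      case (elim t)
      have "\<D> (\<lambda>t. u (Suc n) t * (d0 + d1 * t) + real (Suc n) * d1 * u n t) t =
         (u (Suc n) t * d1 + u (Suc (Suc n)) t * (d0 + d1 * t)) + real (Suc n) * d1 * u (Suc n) t"
        by (rule partial_deriv_real) (auto intro!: derivative_eq_intros elim(2,3))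
      with elim(1) show ?case by (simp add: partial_deriv_const algebra_simps)
    qed
  qed
  have "(\<partial>\<^sub>2 ^^ Suc n) R 0 = (- d1 / d0) * real (Suc n) * (\<partial>\<^sub>2 ^^ n) R 0" for n
  proof -
    have "(\<partial>\<^sub>2 ^^ Suc n) R 0 * d0 = - (real (Suc n) * d1 * (\<partial>\<^sub>2 ^^ n) R 0)"
      using eventually_nhds_x_imp_x[OF step[of n]] unfolding u_def zero_prod_def by simp
    then have "(\<partial>\<^sub>2 ^^ Suc n) R 0 = - (real (Suc n) * d1 * (\<partial>\<^sub>2 ^^ n) R 0) / d0"
      using D by (metis nonzero_mult_div_cancel_right)
    then show ?thesis by (simp only: minus_divide_left times_divide_eq_left times_divide_eq_right mult_ac mult_minus_left mult_minus_right)
  qed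
  then have "(\<partial>\<^sub>2 ^^ j) R 0 = (- d1 / d0) * real j * (\<partial>\<^sub>2 ^^ (j - 1)) R 0" if "j \<in> {1..k - 1}" for j
    using that by (cases j) (simp_all del: funpow.simps of_nat_Suc)
  then show ?thesis unfolding geometric_jet_def using D by (intro exI[of _ "- d1 / d0"]) simp
qed

lemma zero_partial2_const:
  fixes A :: "real \<times> real \<Rightarrow> real"
  assumes A: "smooth_near 0 A" and z: "\<forall>\<^sub>F X in nhds 0. \<partial>\<^sub>2 A X = 0"
  shows "\<forall>\<^sub>F X in nhds 0. A X = A (fst X, 0)"
proof -
  obtain T where T: "open T" "0 \<in> T" "\<And>X. X \<in> T \<Longrightarrow> smooth_near X A \<and> \<partial>\<^sub>2 A X = 0"
    using eventually_conj[OF smooth_near_eventually[OF A] z] unfolding eventually_nhds by blast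
  obtain e where e: "e > 0" "ball 0 e \<subseteq> T" using T by (meson open_contains_ball)
  have "A X = A (fst X, 0)" if X: "X \<in> ball 0 e" for X
  proof -
    obtain a b where ab: "X = (a, b)" by (cases X)
    have in_ball: "(a, t * b) \<in> T" if "t \<in> {0..1}" for t
    proof -
      have "norm (t * b) \<le> norm b" using that by (simp add: abs_mult mult_left_le_one_le)
      then have "norm (a, t * b) \<le> norm (a, b)"
        unfolding norm_prod_def by (intro real_sqrt_le_mono add_mono power_mono) auto
      then show ?thesis using X ab by (intro subsetD[OF e(2)]) simp
    qed
    have "((\<lambda>t. A (a, t * b)) has_derivative (\<lambda>h. 0)) (at t within {0..1})" if "t \<in> {0..1}" for t
    proof -
      have "((\<lambda>t. (a, t * b)) has_derivative (\<lambda>h. (0, h * b))) (at t)"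
        by (auto intro!: derivative_eq_intros)
      note dc = this
      have sm: "smooth_near (a, t * b) A" and z: "\<partial>\<^sub>2 A (a, t * b) = 0" using T(3)[OF in_ball[OF that]] by auto
      from has_derivative_compose[OF dc has_derivative_partial_plane[OF sm]]
      have "((\<lambda>t. A (a, t * b)) has_derivative (\<lambda>h. 0)) (at t)" by (simp add: z)
      then show ?thesis by (rule has_derivative_at_withinI)
    qed
    then have "A (a, 1 * b) = A (a, 0 * b)"
      by (intro has_derivative_zero_unique[of "{0..1}" "\<lambda>t. A (a, t * b)"]) auto
    then show ?thesis by (simp add: ab)
  qed
  then show ?thesis using e unfolding eventually_nhds by (intro exI[of _ "ball 0 e"]) auto
qed

section \<open>Expansion of the developable surface along its ruling\<close>

context developable
begin

text \<open>The first new coordinate is \<open>l z1 + l' z2\<close>. It vanishes on the ruling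
  through \<open>(1, y0)\<close>, the line \<open>l x1 + l' x2 + \<kappa> c0 = 0\<close>, which thus
  becomes the second axis.\<close>

abbreviation L :: "real \<times> real \<Rightarrow> real \<times> real"
  where "L \<equiv> coordL l l' (\<gamma> * y0)"

abbreviation pt :: "real \<times> real \<Rightarrow> real \<times> real"
  where "pt X \<equiv> (1, y0) + L X"

text \<open>Parameter of the ruling through \<open>pt X\<close>: equal to \<open>S\<close> on the
  line \<open>x1 = 1\<close>, and of degree one under the dilations.\<close>

definition \<sigma> :: "real \<times> real \<Rightarrow> real"
  where "\<sigma> X = fst (pt X) * S (qslope \<gamma> (pt X))"

text \<open>The developable surface minus its tangent plane at the base point.\<close>

definition A :: "real \<times> real \<Rightarrow> real"
  where "A X = qhom \<kappa> \<gamma> g0 (pt X) - (c0 + p1 * fst (pt X) + p2 * snd (pt X))"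

lemma P': "l + l' * (\<gamma> * y0) \<noteq> 0"
  using P by (simp add: P_def)

lemma L0: "L 0 = 0" using linear_0[OF linear_coordL] .

lemma smooth_slope: "smooth_near 0 (\<lambda>X. qslope \<gamma> (pt X))"
proof (rule smooth_near_affine_compose[OF linear_coordL])
  show "smooth_near ((1, y0) + L 0) (qslope \<gamma>)" by (intro smooth) (simp add: L0)
qed

lemma smooth_pt: "smooth_near X (\<lambda>X. fst (pt X))" "smooth_near X (\<lambda>X. snd (pt X))"
  unfolding fst_add snd_add by (intro smooth linear_coordL)+

lemma smooth_\<sigma>: "smooth_near 0 \<sigma>"
proof -
  have "smooth_near 0 (\<lambda>X. S (qslope \<gamma> (pt X)))"
    by (rule smooth_near_compose_real[OF _ smooth_slope]) (simp add: L0 smS)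
  then show ?thesis unfolding \<sigma>_def by (rule smooth_near_mult[OF smooth_pt(1)])
qed

lemma smooth_A: "smooth_near 0 A"
proof -
  have "smooth_near 0 (\<lambda>X. qhom \<kappa> \<gamma> g0 (pt X))"
    by (rule smooth_near_affine_compose[OF linear_coordL])
      (use smooth_g0 in \<open>simp add: L0 smooth_near_qhom\<close>)
  then show ?thesis unfolding A_def by (intro smooth smooth_pt)
qed

text \<open>Homogeneity carries \<open>near_S\<close> and \<open>near_g0\<close> from the line
  \<open>x1 = 1\<close> to a neighbourhood of \<open>(1, y0)\<close>. In the last clause the
  gradient is that of the plane with parameter \<open>\<sigma> X\<close> minus that of the plane
  with parameter 1.\<close>

lemma near_pt: "\<forall>\<^sub>F X in nhds 0. fst (pt X) > 0 \<and> smooth_near X \<sigma> \<and> \<sigma> X > 0 \<and>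
    l * fst (pt X) * \<sigma> X powr (\<kappa> - 1) + l' * snd (pt X) * \<sigma> X powr (\<kappa> - \<gamma>) + \<kappa> * c0 * \<sigma> X powr \<kappa> = 0 \<and>
    qhom \<kappa> \<gamma> g0 (pt X) = p1 * fst (pt X) * \<sigma> X powr (\<kappa> - 1) + p2 * snd (pt X) * \<sigma> X powr (\<kappa> - \<gamma>) + c0 * \<sigma> X powr \<kappa> \<and>
    (\<forall>b. partial_deriv b A X = fst (L b) * (p1 * \<sigma> X powr (\<kappa> - 1) - p1) + snd (L b) * (p2 * \<sigma> X powr (\<kappa> - \<gamma>) - p2))"
proof -
  have "\<forall>\<^sub>F X in nhds 0. fst (pt X) > 0 \<and> smooth_near (qslope \<gamma> (pt X)) g0"
    by (rule eventually_nhds_compose[OF isCont_linear_plane[OF linear_coordL]])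
      (use eventually_qhom[of "(1, y0)" \<gamma> g0] smooth_g0 in \<open>simp add: L0\<close>)
  moreover have "\<forall>\<^sub>F X in nhds 0. (smooth_near (qslope \<gamma> (pt X)) S \<and> S (qslope \<gamma> (pt X)) > 0 \<and>
      l * S (qslope \<gamma> (pt X)) powr (\<kappa> - 1) + l' * (qslope \<gamma> (pt X)) * S (qslope \<gamma> (pt X)) powr (\<kappa> - \<gamma>) +
        \<kappa> * c0 * S (qslope \<gamma> (pt X)) powr \<kappa> = 0) \<and>
      \<D> g0 (qslope \<gamma> (pt X)) = p2 * S (qslope \<gamma> (pt X)) powr (\<kappa> - \<gamma>) \<and>
      \<kappa> * g0 (qslope \<gamma> (pt X)) - \<gamma> * (qslope \<gamma> (pt X)) * \<D> g0 (qslope \<gamma> (pt X)) =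
        p1 * S (qslope \<gamma> (pt X)) powr (\<kappa> - 1)"
    by (rule eventually_nhds_compose[OF smooth_near_isCont[OF smooth_slope]])
      (use eventually_conj[OF near_S near_g0] in \<open>simp add: L0\<close>)
  ultimately show ?thesis using smooth_near_eventually[OF smooth_\<sigma>]
  proof eventually_elim
    case (elim X)
    let ?u = "fst (pt X)" and ?w = "snd (pt X)" and ?y = "qslope \<gamma> (pt X)"
    have u: "?u > 0" and S: "S ?y > 0" using elim by auto
    have \<sigma>p: "\<sigma> X powr a = ?u powr a * S ?y powr a" for a
      unfolding \<sigma>_def using u S by (simp add: powr_mult)
    have e1: "?u powr \<kappa> = ?u * ?u powr (\<kappa> - 1)" using powr_shift[OF u, of \<kappa>] by simp
    have e2: "?u powr \<kappa> * ?u powr (- \<gamma>) = ?u powr (\<kappa> - \<gamma>)" by (simp flip: powr_add)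
    have "?u powr \<kappa> * (l * S ?y powr (\<kappa> - 1) + l' * ?y * S ?y powr (\<kappa> - \<gamma>) + \<kappa> * c0 * S ?y powr \<kappa>) = 0"
      using elim by simp
    moreover have "?u powr \<kappa> * (l * S ?y powr (\<kappa> - 1) + l' * ?y * S ?y powr (\<kappa> - \<gamma>) + \<kappa> * c0 * S ?y powr \<kappa>)
       = l * ?u * \<sigma> X powr (\<kappa> - 1) + l' * ?w * \<sigma> X powr (\<kappa> - \<gamma>) + \<kappa> * c0 * \<sigma> X powr \<kappa>"
      unfolding \<sigma>p e2 [symmetric] using e1 by algebra
    moreover have "qhom \<kappa> \<gamma> g0 (pt X) = p1 * ?u * \<sigma> X powr (\<kappa> - 1) + p2 * ?w * \<sigma> X powr (\<kappa> - \<gamma>) + c0 * \<sigma> X powr \<kappa>"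
      unfolding qhom_def g0_def \<sigma>p e2 [symmetric] using e1 by algebra
    moreover have "partial_deriv b A X = fst (L b) * (p1 * \<sigma> X powr (\<kappa> - 1) - p1) +
        snd (L b) * (p2 * \<sigma> X powr (\<kappa> - \<gamma>) - p2)" for b
    proof -
      have sm: "smooth_near (pt X) (qhom \<kappa> \<gamma> g0)" using elim by (auto intro: smooth_near_qhom)
      let ?B = "\<lambda>x. qhom \<kappa> \<gamma> g0 x - (c0 + p1 * fst x + p2 * snd x)"
      have smB: "smooth_near (pt X) ?B" by (intro smooth sm)
      have dB: "(?B has_derivative (\<lambda>h. (fst h * \<partial>\<^sub>1 (qhom \<kappa> \<gamma> g0) (pt X) + snd h * \<partial>\<^sub>2 (qhom \<kappa> \<gamma> g0) (pt X))
          - (p1 * fst h + p2 * snd h))) (at (pt X))"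
        by (rule derivative_eq_intros has_derivative_partial_plane[OF sm] refl)+ simp
      have "partial_deriv b A X = fst (L b) * \<partial>\<^sub>1 ?B (pt X) + snd (L b) * \<partial>\<^sub>2 ?B (pt X)"
        unfolding A_def using partial_deriv_affine_compose[OF linear_coordL smB, of b] .
      also have "\<partial>\<^sub>1 ?B (pt X) = \<partial>\<^sub>1 (qhom \<kappa> \<gamma> g0) (pt X) - p1"
        using partial_deriv_eq[OF dB, of "(1, 0)"] by simp
      also have "\<partial>\<^sub>2 ?B (pt X) = \<partial>\<^sub>2 (qhom \<kappa> \<gamma> g0) (pt X) - p2"
        using partial_deriv_eq[OF dB, of "(0, 1)"] by simp
      also have "\<partial>\<^sub>1 (qhom \<kappa> \<gamma> g0) (pt X) = p1 * \<sigma> X powr (\<kappa> - 1)"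
      proof -
        have "\<partial>\<^sub>1 (qhom \<kappa> \<gamma> g0) (pt X) = ?u powr (\<kappa> - 1) * (\<kappa> * g0 ?y - \<gamma> * ?y * \<D> g0 ?y)"
          using elim partial_deriv_qhom(2)[of "pt X" \<gamma> g0 \<kappa>] unfolding qhom_def by blast
        also have "\<kappa> * g0 ?y - \<gamma> * ?y * \<D> g0 ?y = p1 * S ?y powr (\<kappa> - 1)" using elim by blast
        finally show ?thesis unfolding \<sigma>p by (simp only: mult_ac)
      qed
      also have "\<partial>\<^sub>2 (qhom \<kappa> \<gamma> g0) (pt X) = p2 * \<sigma> X powr (\<kappa> - \<gamma>)"
      proof -
        have "\<partial>\<^sub>2 (qhom \<kappa> \<gamma> g0) (pt X) = ?u powr (\<kappa> - \<gamma>) * \<D> g0 ?y"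
          using elim partial_deriv_qhom(1)[of "pt X" \<gamma> g0 \<kappa>] unfolding qhom_def by blast
        also have "\<D> g0 ?y = p2 * S ?y powr (\<kappa> - \<gamma>)" using elim by blast
        finally show ?thesis unfolding \<sigma>p by (simp only: mult_ac)
      qed
      finally show ?thesis .
    qed
    ultimately show ?case using elim(3) u S by (auto simp: \<sigma>_def)
  qed
qed

text \<open>On the line \<open>l u + l' w + \<kappa> c0 = 0\<close> the slope
  \<open>w u^(-\<gamma>)\<close> is the argument of \<open>S\<close> in the assumption
  \<open>inverse\<close> for \<open>s = 1 / u\<close>. Hence \<open>S\<close> is
  \<open>1 / u\<close> there and \<sigma> is 1.\<close>

lemma \<sigma>_ruling: "\<forall>\<^sub>F t in nhds 0. \<sigma> (0, t) = 1"
proof -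
  have sm: "smooth_near (0::real) (\<lambda>t. fst (pt (0, t)))"
    unfolding coordL_def by (simp, intro smooth) (use P' in auto)
  have f0: "fst (pt (0, 0)) = 1" using L0 by (simp add: zero_prod_def)
  have c1: "isCont (\<lambda>t. fst (pt (0, t))) 0" by (rule smooth_near_isCont[OF sm])
  have "isCont (\<lambda>t. inverse (fst (pt (0, t)))) 0"
    using f0 by (intro smooth_near_isCont smooth sm) simp
  from eventually_nhds_compose[OF this, of "\<lambda>s. S (- (l * s powr (\<gamma> - 1) + \<kappa> * c0 * s powr \<gamma>) / l') = s"]
  have "\<forall>\<^sub>F t in nhds 0. S (- (l * inverse (fst (pt (0, t))) powr (\<gamma> - 1) + \<kappa> * c0 * inverse (fst (pt (0, t))) powr \<gamma>) / l')
      = inverse (fst (pt (0, t)))"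
    using inverse f0 by simp
  moreover have "\<forall>\<^sub>F t in nhds 0. fst (pt (0, t)) > 0"
    by (rule eventually_nhds_compose[OF c1])
      (use eventually_nhds_in_open[of "{0<..}" "1::real"] f0 in simp)
  ultimately show ?thesis
  proof eventually_elim
    case (elim t)
    let ?u = "fst (pt (0, t))" and ?w = "snd (pt (0, t))"
    have "l * fst (L (0, t)) + l' * snd (L (0, t)) = 0"
      using coordL_eqs(1)[OF P', of "(0, t)"] by simp
    then have "l * ?u + l' * ?w + \<kappa> * c0 = 0"
      unfolding c0 by (simp add: algebra_simps)
    then have w: "- (l * ?u + \<kappa> * c0) / l' = ?w"
      using l' by (simp add: field_simps)
    have "inverse ?u = ?u powr (- 1)" using elim(2) by (simp add: powr_minus)
    then have ip: "inverse ?u powr a = ?u powr (- a)" for a by (simp only: powr_powr) simp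
    have i: "inverse ?u powr \<gamma> = ?u powr (- \<gamma>)" "inverse ?u powr (\<gamma> - 1) = ?u * ?u powr (- \<gamma>)"
      unfolding ip using powr_shift[OF elim(2), of "1 - \<gamma>"] by (simp_all add: mult.commute)
    have "- (l * inverse ?u powr (\<gamma> - 1) + \<kappa> * c0 * inverse ?u powr \<gamma>) / l' =
        (- (l * ?u + \<kappa> * c0) / l') * ?u powr (- \<gamma>)"
      unfolding i by (simp add: algebra_simps)
    then have "S (qslope \<gamma> (pt (0, t))) = inverse ?u" using elim(1) unfolding w by simp
    then show ?case using elim(2) by (simp only: \<sigma>_def) simp
  qed
qed

text \<open>Where \<sigma> = 1, both \<open>A\<close> and its gradient vanish, whence the square. On
  the ruling \<open>R\<close> is half of \<open>\<partial>\<^sub>1 \<sigma>\<close>, and implicit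
  differentiation of the ruling equation turns this into the reciprocal of an affine
  function.\<close>

lemma normal_form_A:
  obtains R where "smooth_nonzero_near 0 R" "\<forall>\<^sub>F X in nhds 0. A X = (fst X)\<^sup>2 * R X"
    "(\<exists>r. smooth_nonzero_near 0 r \<and> (\<forall>\<^sub>F X in nhds 0. R X = r (fst X))) \<or>
      (\<forall>k. geometric_jet k R) \<and> \<gamma> \<noteq> 1"
proof -
  have iso: "isCont (\<lambda>t::real. (0::real, t)) 0" by (intro continuous_intros)
  have line: "\<forall>\<^sub>F t in nhds 0. Q (0, t)" if "\<forall>\<^sub>F X in nhds (0::real\<times>real). Q X" for Q
    by (rule eventually_nhds_compose[OF iso]) (use that in \<open>simp add: zero_prod_def\<close>)
  \<comment> \<open>The rate of change of \<open>(\<kappa>-1) l u + (\<kappa>-\<gamma>) l' w\<close>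
    along the ruling, where \<open>(u, w)\<close> moves by \<open>(- l', l) t / P\<close>.\<close>
  define d1 where "d1 = l * l' * (1 - \<gamma>) / P"
  have "\<forall>\<^sub>F t in nhds 0. A (0, t) = 0 \<and> \<partial>\<^sub>1 A (0, t) = 0"
    using line[OF near_pt] \<sigma>_ruling by eventually_elim (simp add: A_def)
  then obtain R where R: "smooth_near 0 R" "\<forall>\<^sub>F X in nhds 0. A X = (fst X)\<^sup>2 * R X"
    "\<forall>\<^sub>F t in nhds 0. \<partial>\<^sub>1 (\<partial>\<^sub>1 A) (0, t) = 2 * R (0, t)"
    using vanish2_fst[OF smooth_A] by blast
  have dA: "\<forall>\<^sub>F X in nhds 0. \<partial>\<^sub>1 A X =
      fst (L (1, 0)) * (p1 * \<sigma> X powr (\<kappa> - 1) - p1) + snd (L (1, 0)) * (p2 * \<sigma> X powr (\<kappa> - \<gamma>) - p2)"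
    using near_pt by eventually_elim blast
  have ru: "\<forall>\<^sub>F X in nhds 0. l * fst (pt X) * \<sigma> X powr (\<kappa> - 1) + l' * snd (pt X) * \<sigma> X powr (\<kappa> - \<gamma>) + \<kappa> * c0 * \<sigma> X powr \<kappa> = 0"
    using near_pt by eventually_elim blast
  have e: "l * fst (L (1, 0)) + l' * snd (L (1, 0)) = 1"
    using coordL_eqs(1)[OF P', of "(1, 0)"] by simp
  have key: "\<forall>\<^sub>F t in nhds 0. R (0, t) * (- P + d1 * t) = - 1 / 2"
    using line[OF near_pt] \<sigma>_ruling R(3) line[OF eventually_partial_deriv_cong[OF dA, of "(1, 0)"]]
      line[OF eventually_partial_deriv_cong[OF ru, of "(1, 0)"]]
  proof eventually_elim
    case (elim t)
    let ?X = "(0::real, t)"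
    let ?s = "\<partial>\<^sub>1 \<sigma> ?X"
    have \<sigma>: "smooth_near ?X \<sigma>" "\<sigma> ?X > 0" "\<sigma> ?X = 1" using elim by auto
    have smp: "smooth_near ?X (\<lambda>X. \<sigma> X powr a)" for a using \<sigma> by (intro smooth) auto
    have dp: "\<partial>\<^sub>1 (\<lambda>X. \<sigma> X powr a) ?X = a * ?s" for a
      using partial_deriv_powr[OF \<sigma>(1,2)] \<sigma>(3) by simp
    have dpt: "\<partial>\<^sub>1 (\<lambda>X. fst (pt X)) ?X = fst (L (1, 0))" "\<partial>\<^sub>1 (\<lambda>X. snd (pt X)) ?X = snd (L (1, 0))"
      using partial_deriv_affine_compose[where L = L and v = "(1, y0)" and x = ?X and b = "(1, 0)", OF linear_coordL smooth_near_fst]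
        partial_deriv_affine_compose[where L = L and v = "(1, y0)" and x = ?X and b = "(1, 0)", OF linear_coordL smooth_near_snd]
      by (simp_all add: partial_deriv_eq[OF has_derivative_fst[OF has_derivative_ident]]
          partial_deriv_eq[OF has_derivative_snd[OF has_derivative_ident]] del: fst_add snd_add)
    note hp = has_derivative_partial_plane[OF smp] has_derivative_partial_plane[OF smooth_pt(1)]
      has_derivative_partial_plane[OF smooth_pt(2)]
    let ?D = "\<lambda>f h. fst h * \<partial>\<^sub>1 f ?X + snd h * \<partial>\<^sub>2 f ?X"
    let ?x = "\<lambda>X. fst (pt X)" and ?y = "\<lambda>X. snd (pt X)" and ?p = "\<lambda>a X. \<sigma> X powr a"
    have "((\<lambda>X. fst (L (1, 0)) * (p1 * ?p (\<kappa> - 1) X - p1) + snd (L (1, 0)) * (p2 * ?p (\<kappa> - \<gamma>) X - p2)) has_derivative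
        (\<lambda>h. fst (L (1, 0)) * (p1 * ?D (?p (\<kappa> - 1)) h) + snd (L (1, 0)) * (p2 * ?D (?p (\<kappa> - \<gamma>)) h))) (at ?X)"
      by (rule derivative_eq_intros hp refl)+ simp
    note dA' = partial_deriv_eq[OF this, of "(1, 0)"]
    have "((\<lambda>X. l * ?x X * ?p (\<kappa> - 1) X + l' * ?y X * ?p (\<kappa> - \<gamma>) X + \<kappa> * c0 * ?p \<kappa> X) has_derivative
        (\<lambda>h. (l * ?x ?X * ?D (?p (\<kappa> - 1)) h + l * ?D ?x h * ?p (\<kappa> - 1) ?X) +
          (l' * ?y ?X * ?D (?p (\<kappa> - \<gamma>)) h + l' * ?D ?y h * ?p (\<kappa> - \<gamma>) ?X) + \<kappa> * c0 * ?D (?p \<kappa>) h)) (at ?X)"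
      by (rule derivative_eq_intros hp refl)+ simp
    note dru = partial_deriv_eq[OF this, of "(1, 0)"]
    have "\<partial>\<^sub>1 (\<partial>\<^sub>1 A) ?X = fst (L (1, 0)) * (p1 * ((\<kappa> - 1) * ?s)) + snd (L (1, 0)) * (p2 * ((\<kappa> - \<gamma>) * ?s))"
      unfolding elim(4) dA' by (simp add: dp)
    \<comment> \<open>The coefficient of \<open>?s\<close> is
      \<open>l * fst (L (1, 0)) + l' * snd (L (1, 0))\<close>, which is 1.\<close>
    also have "\<dots> = ?s" using e unfolding l_def l'_def by algebra
    finally have s: "?s = 2 * R ?X" using elim by simp
    have "0 = \<partial>\<^sub>1 (\<lambda>X. l * fst (pt X) * \<sigma> X powr (\<kappa> - 1) + l' * snd (pt X) * \<sigma> X powr (\<kappa> - \<gamma>) + \<kappa> * c0 * \<sigma> X powr \<kappa>) ?X"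
      using elim(5) by (simp add: partial_deriv_const)
    also have "\<dots> = (l * fst (pt ?X) * ((\<kappa> - 1) * ?s) + l * fst (L (1, 0))) +
       (l' * snd (pt ?X) * ((\<kappa> - \<gamma>) * ?s) + l' * snd (L (1, 0))) + \<kappa> * c0 * (\<kappa> * ?s)"
      unfolding dru dpt by (simp add: dp \<sigma>(3))
    also have "\<dots> = 1 + ?s * (- P + d1 * t)"
    proof -
      define \<tau> where "\<tau> = t / P"
      have "fst (pt ?X) = 1 - l' * \<tau>" "snd (pt ?X) = y0 + l * \<tau>" "d1 * t = l * l' * (1 - \<gamma>) * \<tau>"
        by (simp_all add: coordL_def P_def \<tau>_def d1_def)
      then show ?thesis using e c0 P_def by algebra
    qed
    finally show ?case using s by simp
  qed
  have R0: "R 0 \<noteq> 0"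
    using eventually_nhds_x_imp_x[OF key] by (auto simp: zero_prod_def)
  show ?thesis
  proof (cases "d1 = 0")
    case False
    then have "\<forall>k. geometric_jet k R" using geometric_jetI[OF R(1) _ False key] P by simp
    moreover have "\<gamma> \<noteq> 1" using False by (auto simp: d1_def)
    ultimately show ?thesis using that[of R] R R0 by (simp add: smooth_nonzero_near_def)
  next
    case True
    \<comment> \<open>The cylindrical case: \<open>A\<close> does not depend on the second
      coordinate. If \<gamma> = 1, the two powers of \<sigma> agree and their coefficients cancel;
      if \<open>l = 0\<close>, then \<kappa> = 1 or \<open>p1 = 0\<close>, and the only remaining
      bracket vanishes.\<close>
    then have c: "l = 0 \<or> \<gamma> = 1" using l' P by (simp add: d1_def)
    have w: "fst (L (0, 1)) = - l' / P" "snd (L (0, 1)) = l / P" by (simp_all add: coordL_def P_def)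
    have "\<forall>\<^sub>F X in nhds 0. \<partial>\<^sub>2 A X = 0"
      using near_pt
    proof eventually_elim
      case (elim X)
      then have "\<partial>\<^sub>2 A X = (- l' * (p1 * \<sigma> X powr (\<kappa> - 1) - p1) + l * (p2 * \<sigma> X powr (\<kappa> - \<gamma>) - p2)) / P"
        by (simp add: w diff_divide_distrib)
      also have "- l' * (p1 * \<sigma> X powr (\<kappa> - 1) - p1) + l * (p2 * \<sigma> X powr (\<kappa> - \<gamma>) - p2) = 0"
      proof (cases "\<gamma> = 1")
        case True
        then show ?thesis by (simp add: l_def l'_def algebra_simps)
      next
        case False
        then have "\<kappa> = 1 \<or> p1 = 0" "l = 0" using c by (auto simp: l_def)
        then show ?thesis using elim by (auto simp: powr_zero_eq_one)
      qed
      finally show ?case by simp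
    qed
    from zero_partial2_const[OF smooth_A this]
    have const: "\<forall>\<^sub>F X in nhds 0. A X = A (fst X, 0)" .
    have "isCont (\<lambda>X::real\<times>real. (fst X, 0::real)) 0" by (intro continuous_intros)
    from eventually_nhds_compose[OF this, of "\<lambda>X. A X = (fst X)\<^sup>2 * R X"] R(2)
    have "\<forall>\<^sub>F X in nhds (0::real\<times>real). A (fst X, 0) = (fst X)\<^sup>2 * R (fst X, 0)"
      by (simp add: zero_prod_def)
    with const have eq: "\<forall>\<^sub>F X in nhds 0. A X = (fst X)\<^sup>2 * R (fst X, 0)" by eventually_elim simp
    have s1: "smooth_nonzero_near 0 (\<lambda>t. R (t, 0))"
      using smooth_near_compose_pair[of "\<lambda>t::real. t" 0 "\<lambda>t. 0" R] R R0
      by (simp add: smooth_nonzero_near_def smooth zero_prod_def)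
    have s2: "smooth_nonzero_near 0 (\<lambda>X::real\<times>real. R (fst X, 0))"
      using smooth_near_compose_pair[of fst "0::real\<times>real" "\<lambda>t. 0" R] R R0
      by (simp add: smooth_nonzero_near_def smooth zero_prod_def)
    show ?thesis
      by (rule that[OF s2 eq], intro disjI1 exI[of _ "\<lambda>t. R (t, 0)"] conjI s1) simp
  qed
qed

end

section \<open>Existence of a normal form\<close>

lemma eventually_fst_pos: "\<forall>\<^sub>F x in nhds (1, y0 :: real). fst x > (0::real)"
  by (rule eventually_mono[OF eventually_qhom[of "(1, y0)" 1 "\<lambda>_. 0"]]) (auto intro: smooth)

lemma normal_forms_developable:
  assumes \<gamma>: "\<gamma> > 0" and rep: "germ_qhom \<Phi> \<kappa> \<gamma> y0 g" and h: "hess1 \<kappa> \<gamma> g y0 = 0"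
    and nz: "(\<kappa> - \<gamma>) * \<D> g y0 \<noteq> 0"
  shows "admits_nf \<gamma> y0 \<Phi>"
proof -
  obtain c a b where g: "smooth_near y0 g"
    and ev: "\<forall>\<^sub>F x in nhds (1, y0). \<Phi> x = qhom \<kappa> \<gamma> g x + (c + a * fst x + b * snd x)"
    using rep by (auto simp: germ_qhom_def)
  \<comment> \<open>\<open>p1\<close> and \<open>p2\<close> are the partial derivatives of
    \<open>qhom \<kappa> \<gamma> g\<close> at \<open>(1, y0)\<close>, and \<open>c0\<close> is the
    constant term of the tangent plane there.\<close>
  define p1 where "p1 = \<kappa> * g y0 - \<gamma> * y0 * \<D> g y0"
  define p2 where "p2 = \<D> g y0"
  define c0 where "c0 = g y0 - p1 - p2 * y0"
  define l where "l \<equiv> (\<kappa> - 1) * p1"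
  define l' where "l' \<equiv> (\<kappa> - \<gamma>) * p2"
  define P where "P \<equiv> l + l' * (\<gamma> * y0)"
  have l': "l' \<noteq> 0" using nz by (simp add: l'_def p2_def)
  have P: "P = \<kappa> * (\<kappa> - 1) * g y0 + \<gamma> * (1 - \<gamma>) * y0 * \<D> g y0"
    unfolding P_def l_def l'_def p1_def p2_def by algebra
  have "P * \<D> (\<D> g) y0 = l'\<^sup>2"
    using h unfolding P hess1_def l'_def p2_def by algebra
  then have Pnz: "P \<noteq> 0" using l' by auto
  have c0: "\<kappa> * c0 = - (l + l' * y0)"
    unfolding c0_def l_def l'_def p1_def p2_def by algebra
  \<comment> \<open>\<open>Y s\<close> is the height at which the ruling with parameter
    \<open>s\<close> meets the line \<open>x1 = 1\<close>. Its derivative at 1 is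
    \<open>P / l'\<close>, so it has a smooth inverse, which is \<open>S\<close>.\<close>
  define Y where "Y s = - (l * s powr (\<gamma> - 1) + \<kappa> * c0 * s powr \<gamma>) / l'" for s
  have smY: "smooth_near 1 Y" unfolding Y_def by (intro smooth) (use l' in auto)
  have "- (l + \<kappa> * c0) = l' * y0" using c0 by simp
  then have Y1: "Y 1 = y0" using l' by (simp add: Y_def)
  have "(Y has_real_derivative - (l * ((\<gamma> - 1) * 1 powr (\<gamma> - 1 - 1)) + \<kappa> * c0 * (\<gamma> * 1 powr (\<gamma> - 1))) / l') (at 1)"
    unfolding Y_def by (intro DERIV_cdivide DERIV_minus DERIV_add DERIV_cmult has_real_derivative_powr) auto
  moreover have "- (l * ((\<gamma> - 1) * 1 powr (\<gamma> - 1 - 1)) + \<kappa> * c0 * (\<gamma> * 1 powr (\<gamma> - 1))) = P"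
    unfolding P_def c0 by (simp add: algebra_simps)
  ultimately have "\<D> Y 1 \<noteq> 0" using Pnz l' by (simp add: partial_deriv_real)
  then obtain S where S: "smooth_near y0 S" "S y0 = 1" "\<forall>\<^sub>F s in nhds 1. S (Y s) = s" "\<forall>\<^sub>F y in nhds y0. Y (S y) = y"
    using smooth_inverse_function[OF smY] Y1 by metis
  have "\<forall>\<^sub>F y in nhds y0. S y > 0"
    by (rule eventually_nhds_compose[OF smooth_near_isCont[OF S(1)]])
      (use eventually_nhds_in_open[of "{0<..}" "1::real"] S(2) in simp)
  then have ruling: "\<forall>\<^sub>F y in nhds y0.
      l * S y powr (\<kappa> - 1) + l' * y * S y powr (\<kappa> - \<gamma>) + \<kappa> * c0 * S y powr \<kappa> = 0"
    using S(4)
  proof eventually_elim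
    case (elim y)
    have "l' * y = - (l * S y powr (\<gamma> - 1) + \<kappa> * c0 * S y powr \<gamma>)"
      using elim(2) l' by (simp add: Y_def field_simps)
    then have "l' * y * S y powr (\<kappa> - \<gamma>) =
        - (l * (S y powr (\<gamma> - 1) * S y powr (\<kappa> - \<gamma>)) + \<kappa> * c0 * (S y powr \<gamma> * S y powr (\<kappa> - \<gamma>)))"
      unfolding \<open>l' * y = _\<close> by (simp add: algebra_simps)
    also have "S y powr (\<gamma> - 1) * S y powr (\<kappa> - \<gamma>) = S y powr (\<kappa> - 1)"
      by (simp flip: powr_add)
    also have "S y powr \<gamma> * S y powr (\<kappa> - \<gamma>) = S y powr \<kappa>"
      by (simp flip: powr_add)
    finally show ?case by simp
  qed
  interpret D: developable \<kappa> \<gamma> y0 p1 p2 c0 S l l' P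
    using l' Pnz c0 S ruling by unfold_locales (auto simp: l_def l'_def P_def Y_def)
  have lin: "linear D.L" "bij D.L" using linear_coordL bij_coordL[OF D.P'] by auto
  let ?\<Psi> = "\<lambda>x. qhom \<kappa> \<gamma> g x - (c0 + p1 * fst x + p2 * snd x)"
  have smq: "smooth_near (1, y0) (qhom \<kappa> \<gamma> g)"
    using g by (intro smooth_near_qhom) auto
  then have sm\<Psi>: "smooth_near (1, y0) ?\<Psi>" by (intro smooth)
  have d: "(?\<Psi> has_derivative (\<lambda>h. (fst h * \<partial>\<^sub>1 (qhom \<kappa> \<gamma> g) (1, y0) + snd h * \<partial>\<^sub>2 (qhom \<kappa> \<gamma> g) (1, y0))
          - (p1 * fst h + p2 * snd h))) (at (1, y0))"
    by (rule derivative_eq_intros has_derivative_partial_plane[OF smq] refl)+ simp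
  have pq: "\<partial>\<^sub>1 (qhom \<kappa> \<gamma> g) (1, y0) = p1" "\<partial>\<^sub>2 (qhom \<kappa> \<gamma> g) (1, y0) = p2"
    using g by (simp_all add: partial_deriv_qhom) (simp_all add: qhom_def p1_def p2_def)
  have "\<forall>\<^sub>F x in nhds (1, y0). \<Phi> x = ?\<Psi> x + ((c + c0) + (a + p1) * fst x + (b + p2) * snd x)"
    using ev by eventually_elim (simp add: algebra_simps)
  note loc = phi_at_local[OF lin(1) sm\<Psi> _ _ _ this]
  have F: "\<forall>\<^sub>F X in nhds 0. (phi_at \<Phi> (1, y0) \<circ> D.L) X = ?\<Psi> ((1, y0) + D.L X)"
    by (rule loc) (use partial_deriv_eq[OF d] pq in \<open>simp_all add: qhom_def c0_def\<close>)
  obtain R where R: "smooth_nonzero_near 0 R" "\<forall>\<^sub>F X in nhds 0. D.A X = (fst X)\<^sup>2 * R X"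
    "(\<exists>r. smooth_nonzero_near 0 r \<and> (\<forall>\<^sub>F X in nhds 0. R X = r (fst X))) \<or> (\<forall>k. geometric_jet k R) \<and> \<gamma> \<noteq> 1"
    by (rule D.normal_form_A)
  let ?G = "\<lambda>y. g y - D.g0 y"
  have smG: "smooth_near y0 ?G" by (intro smooth g D.smooth_g0)
  have F': "\<forall>\<^sub>F X in nhds 0. (phi_at \<Phi> (1, y0) \<circ> D.L) X = (fst X)\<^sup>2 * R X + qhom \<kappa> \<gamma> ?G ((1, y0) + D.L X)"
    using F R(2) by eventually_elim (simp add: D.A_def qhom_def algebra_simps)
  have "\<kappa> * (\<kappa> - 1) * g y0 + \<gamma> * (1 - \<gamma>) * y0 * \<D> g y0 \<noteq> 0" using Pnz P by simp
  moreover have "g y0 = p1 + p2 * y0 + c0" "\<D> g y0 = p2" by (simp_all add: c0_def p2_def)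
  moreover note g
  ultimately consider "flat_at ?G y0" "flat_at (hess1 \<kappa> \<gamma> g) y0"
    | k where "k \<ge> 2" "ord_at y0 k ?G" "ord_at y0 (k - 2) (hess1 \<kappa> \<gamma> g)"
    using D.hess1_order by blast
  then show ?thesis
  proof cases
    case 1
    show ?thesis by (rule normal_form_i_flat[OF lin rep 1(2) R(1) 1(1) smG F'])
  next
    case (2 k)
    \<comment> \<open>\<open>h\<close> vanishes at \<open>y0\<close>, so its order
      \<open>k - 2\<close> is positive.\<close>
    have "k \<ge> 3"
      using ord_at_zero_iff[OF 2(3)] h by simp
    from D.P' \<gamma> obtain \<psi> where \<psi>: "\<psi> = (\<lambda>_. 0) \<or> \<psi> 0 \<noteq> 0 \<and> \<gamma> \<noteq> 1" "curve_coords \<gamma> y0 D.L \<psi>"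
      by (cases rule: curve_coords_cases) blast+
    show ?thesis
      by (rule normal_forms_ii_to_v[OF \<psi>(2,1) rep 2(3) R(1) \<open>k \<ge> 3\<close> 2(2) F']) (use R(3) in blast)
  qed
qed

lemma qhom_normal_form:
  assumes \<gamma>: "\<gamma> > 0" and g: "smooth_near y0 g"
    and ev: "\<forall>\<^sub>F x in nhds (1, y0). \<Phi> x = qhom \<kappa> \<gamma> g x" and h: "hess1 \<kappa> \<gamma> g y0 = 0"
    and ft: "\<not> (flat_at (\<D> (\<D> g)) y0 \<and> flat_at (qpart1 \<kappa> \<gamma> g) y0)"
  shows "admits_nf \<gamma> y0 \<Phi>"
proof (cases "(\<kappa> - \<gamma>) * \<D> g y0 = 0")
  case False
  have "\<forall>\<^sub>F x in nhds (1, y0). \<Phi> x = qhom \<kappa> \<gamma> g x + (0 + 0 * fst x + 0 * snd x)" using ev by simp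
  then have "germ_qhom \<Phi> \<kappa> \<gamma> y0 g" using g unfolding germ_qhom_def by blast
  then show ?thesis using normal_forms_developable[OF \<gamma> _ h False] by blast
next
  case True
  define g1 where "g1 = \<D> g y0"
  \<comment> \<open>Chosen such that \<open>g = G + d + g1 y\<close> with \<open>G\<close> vanishing
    to second order at \<open>y0\<close>.\<close>
  define d where "d = g y0 - g1 * y0"
  define G where "G = (\<lambda>y. g y - d - g1 * y)"
  have z: "(\<kappa> - \<gamma>) * g1 = 0" using True by (simp add: g1_def)
  have smG: "smooth_near y0 G" unfolding G_def by (intro smooth g)
  have DG: "\<forall>\<^sub>F y in nhds y0. \<D> G y = \<D> g y - g1"
    using smooth_near_eventually[OF g] unfolding G_def
    by eventually_elim (auto intro!: partial_deriv_real derivative_eq_intros has_real_derivative_partial)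
  have DDG: "\<forall>\<^sub>F y in nhds y0. \<D> (\<D> G) y = \<D> (\<D> g) y"
    using smooth_near_eventually[OF g] eventually_partial_deriv_cong[OF DG, of 1]
    by eventually_elim (auto intro!: partial_deriv_real derivative_eq_intros has_real_derivative_partial smooth)
  have G0: "G y0 = 0" "\<D> G y0 = 0" "\<D> (\<D> G) y0 = \<D> (\<D> g) y0"
    using eventually_nhds_x_imp_x[OF DG] eventually_nhds_x_imp_x[OF DDG] by (simp_all add: G_def d_def g1_def)
  have pos: "\<forall>\<^sub>F x in nhds (1, y0). fst x > (0::real)"
    by (rule eventually_fst_pos)
  have ev': "\<forall>\<^sub>F x in nhds (1, y0). \<Phi> x = qhom \<kappa> \<gamma> G x + d * fst x powr \<kappa> + g1 * snd x"
    using ev pos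
  proof eventually_elim
    case (elim x)
    \<comment> \<open>The linear term of \<open>g\<close> contributes
      \<open>g1 u^(\<kappa>-\<gamma>) w\<close>; this is the linear function \<open>g1 w\<close>, as
      \<kappa> = \<gamma> unless \<open>g1 = 0\<close>.\<close>
    have "g1 * (fst x powr \<kappa> * qslope \<gamma> x) = g1 * snd x"
    proof (cases "g1 = 0")
      case False
      then have "\<kappa> = \<gamma>" using z by simp
      then show ?thesis using elim by (simp add: powr_minus)
    qed simp
    then show ?case using elim(1) by (simp add: qhom_def G_def algebra_simps)
  qed
  \<comment> \<open>All terms of \<open>h(y0)\<close> that contain \<open>g1\<close> carry the
    factor \<open>(\<kappa>-\<gamma>) g1\<close>, which is zero. For
    \<open>\<kappa> (\<kappa>-1) d \<noteq> 0\<close> this yields the condition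
    \<open>G''(y0) = 0\<close> of \<open>normal_forms_cylinder\<close>.\<close>
  have B: "\<kappa> * (\<kappa> - 1) * d * \<D> (\<D> G) y0 = 0"
    using h z unfolding G0(3) hess1_def g1_def d_def by algebra
  show ?thesis
  proof (cases "\<kappa> * (\<kappa> - 1) * d = 0")
    case False
    have "\<forall>\<^sub>F x in nhds (1, y0). \<Phi> x = qhom \<kappa> \<gamma> (\<lambda>y. G y + d) x + (0 + 0 * fst x + g1 * snd x)"
      using ev' by eventually_elim (simp add: qhom_def algebra_simps)
    moreover have "smooth_near y0 (\<lambda>y. G y + d)" by (intro smooth smG)
    ultimately have "germ_qhom \<Phi> \<kappa> \<gamma> y0 (\<lambda>y. G y + d)"
      unfolding germ_qhom_def by blast
    then show ?thesis
      by (rule normal_forms_cylinder[OF \<gamma> _ smG G0(1,2) _ False]) (use B False in simp)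
  next
    case B0: True
    \<comment> \<open>\<open>d u^\<kappa>\<close> is affine here: it is \<open>d u\<close> for
      \<kappa> = 1, the constant \<open>d\<close> for \<kappa> = 0, and zero otherwise.\<close>
    define a where "a = (if \<kappa> = 1 then d else 0)"
    define c where "c = (if \<kappa> = 0 then d else 0)"
    have "\<forall>\<^sub>F x in nhds (1, y0). \<Phi> x = qhom \<kappa> \<gamma> G x + (c + a * fst x + g1 * snd x)"
      using ev' pos by eventually_elim (use B0 in \<open>auto simp: a_def c_def\<close>)
    then have rep: "germ_qhom \<Phi> \<kappa> \<gamma> y0 G" unfolding germ_qhom_def using smG by blast
    from smG show ?thesis
    proof (cases rule: order_cases)
      \<comment> \<open>This contradicts \<open>ft\<close>: a flat \<open>G\<close> makes
        \<open>g''\<close> flat, and also \<open>qpart1 \<kappa> \<gamma> g\<close>, to which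
        \<open>d + g1 y\<close> contributes nothing by \<open>B0\<close> and
        \<open>z\<close>.\<close>
      case 1
      have f1: "flat_at (\<D> G) y0" by (rule flat_at_partial[OF 1]) simp
      have f2: "flat_at (\<D> (\<D> G)) y0" by (rule flat_at_partial[OF f1]) simp
      have "flat_at (\<D> (\<D> g)) y0" using f2 flat_at_cong[OF DDG] by simp
      moreover have "flat_at (qpart1 \<kappa> \<gamma> g) y0"
      proof -
        have "flat_at (\<lambda>y. G y * (\<kappa> * (\<kappa> - 1)) + (\<D> G y * (\<gamma> * (\<gamma> + 1 - 2 * \<kappa>) * y) + \<D> (\<D> G) y * (\<gamma>\<^sup>2 * y\<^sup>2))) y0"
          by (intro flat_at_add flat_at_mult 1 f1 f2 smG smooth)
        moreover have "\<forall>\<^sub>F y in nhds y0. G y * (\<kappa> * (\<kappa> - 1)) + (\<D> G y * (\<gamma> * (\<gamma> + 1 - 2 * \<kappa>) * y) +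
            \<D> (\<D> G) y * (\<gamma>\<^sup>2 * y\<^sup>2)) = qpart1 \<kappa> \<gamma> g y"
          using DG DDG
        proof eventually_elim
          case (elim y)
          have "G y = g y - d - g1 * y" by (simp add: G_def)
          then show ?case using elim B0 z unfolding qpart1_def by algebra
        qed
        ultimately show ?thesis by (rule flat_at_transfer)
      qed
      ultimately show ?thesis using ft by blast
    next
      case (2 k)
      have "k \<ge> 2" using ord_at_ge_2[OF 2] G0 by simp
      then have "k = (k - 2) + 2" by simp
      then obtain n where "k = n + 2" by blast
      then show ?thesis using normal_forms_i_vi[OF \<gamma> rep] 2 by blast
    qed
  qed
qed

section \<open>Passage from adapted to original coordinates\<close>

lemma phi_at_linear:
  assumes T: "linear T" and \<phi>: "smooth_near v \<phi>" and v: "T w = v"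
  shows "phi_at \<phi> v \<circ> (T \<circ> L) = phi_at (\<lambda>x. \<phi> (T x)) w \<circ> L"
proof
  fix x
  have "smooth_near (0 + T w) \<phi>" using \<phi> v by simp
  note d = partial_deriv_affine_compose[OF T this]
  have "L x \<bullet> grad (\<lambda>x. \<phi> (T x)) w = T (L x) \<bullet> grad \<phi> v"
    using d[of "(1, 0)"] d[of "(0, 1)"] v
    by (simp add: grad_def inner_prod_def linear_plane_fst[OF T, of "L x"] linear_plane_snd[OF T, of "L x"] algebra_simps)
  then show "(phi_at \<phi> v \<circ> (T \<circ> L)) x = (phi_at (\<lambda>x. \<phi> (T x)) w \<circ> L) x"
    by (simp add: phi_at_def linear_add[OF T] v)
qed

lemma smooth_on_smooth_near: "smooth_on S f \<Longrightarrow> open S \<Longrightarrow> p \<in> S \<Longrightarrow> smooth_near p f"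
  by (auto simp: smooth_near_def)

text \<open>The factor in \<open>curve_coords\<close> is nonzero near the origin, so the root is the
  set \<open>y = y0\<close>, which the hypothesis \<open>curve\<close> identifies with the
  homogeneity curve.\<close>

lemma normal_form_transfer:
  assumes T: "linear T" "bij T" "T (1, y0) = v" and \<phi>: "smooth_near v \<phi>"
    and nf: "admits_nf \<gamma> y0 (\<lambda>x. \<phi> (T x))"
    and curve: "\<And>x. fst x > 0 \<Longrightarrow> T x \<in> homogeneity_curve \<alpha>\<^sub>1 \<alpha>\<^sub>2 v \<longleftrightarrow> qslope \<gamma> x = y0"
  obtains n L where "linear L" "bij L" "has_normal_form n \<alpha>\<^sub>1 \<alpha>\<^sub>2 \<phi> v L" "\<gamma> = 1 \<Longrightarrow> n \<in> {NF_i, NF_ii}"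
proof -
  obtain n L \<psi> where n: "linear L" "bij L" "nf_germ n (phi_at (\<lambda>x. \<phi> (T x)) (1, y0) \<circ> L) \<psi>"
    "n \<in> {NF_iv, NF_v, NF_vi} \<longrightarrow> curve_coords \<gamma> y0 L \<psi>" "\<gamma> = 1 \<longrightarrow> n \<in> {NF_i, NF_ii}"
    using nf unfolding admits_nf_def by blast
  note eq = phi_at_linear[OF T(1) \<phi> T(3), of L]
  have root: "root_is_homogeneity_curve \<alpha>\<^sub>1 \<alpha>\<^sub>2 v (T \<circ> L) \<psi>" if L: "curve_coords \<gamma> y0 L \<psi>"
  proof -
    obtain e where e: "smooth_near 0 e" "e 0 \<noteq> 0"
      "\<forall>\<^sub>F X in nhds 0. qslope \<gamma> ((1, y0) + L X) - y0 = (snd X - (fst X)\<^sup>2 * \<psi> (fst X)) * e X"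
      using L by (auto simp: curve_coords_def smooth_nonzero_near_def)
    have "\<forall>\<^sub>F X in nhds 0. e X \<noteq> 0"
      by (rule eventually_nhds_compose[OF smooth_near_isCont[OF e(1)]])
        (use eventually_nhds_in_open[of "- {0}" "e 0"] e(2) in auto)
    moreover have "\<forall>\<^sub>F X in nhds 0. fst ((1, y0) + L X) > 0"
      by (rule eventually_nhds_compose[of 0 "\<lambda>X. fst ((1, y0) + L X)"])
        (use eventually_nhds_in_open[of "{0<..}" "1::real"] n(1) in
          \<open>auto simp: linear_0 intro!: smooth_near_isCont smooth\<close>)
    ultimately show ?thesis
      unfolding root_is_homogeneity_curve_def using e(3)
    proof eventually_elim
      case (elim X)
      have "v + (T \<circ> L) X = T ((1, y0) + L X)" by (simp only: linear_add[OF T(1)] T(3) o_apply)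
      then show ?case using curve[OF elim(2)] elim(1,3) by auto
    qed
  qed
  have "has_normal_form n \<alpha>\<^sub>1 \<alpha>\<^sub>2 \<phi> v (T \<circ> L)"
    using n(3,4) root by (cases n; simp add: eq; blast)
  moreover have "linear (T \<circ> L)" "bij (T \<circ> L)"
    using n T linear_compose bij_comp by blast+
  ultimately show ?thesis using that n(5) by blast
qed

lemma normal_form_exists_coords:
  assumes \<gamma>: "\<gamma> > 0" and T: "linear T" "bij T" "T (1, y0) = v" and \<phi>: "smooth_near v \<phi>"
    and g: "smooth_near y0 g" and eq: "\<And>x. fst x > 0 \<Longrightarrow> \<phi> (T x) = qhom \<kappa> \<gamma> g x"
    and curve: "\<And>x. fst x > 0 \<Longrightarrow> T x \<in> homogeneity_curve \<alpha>\<^sub>1 \<alpha>\<^sub>2 v \<longleftrightarrow> qslope \<gamma> x = y0"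
    and h: "hessian_det \<phi> v = 0"
    and ft: "\<not> (flat_at (\<D> (\<D> g)) y0 \<and> flat_at (qpart1 \<kappa> \<gamma> g) y0)"
  obtains n L where "linear L" "bij L" "has_normal_form n \<alpha>\<^sub>1 \<alpha>\<^sub>2 \<phi> v L" "\<gamma> = 1 \<Longrightarrow> n \<in> {NF_i, NF_ii}"
proof (rule normal_form_transfer[OF T \<phi> _ curve])
  let ?\<Phi> = "\<lambda>x. \<phi> (T x)"
  have "\<forall>\<^sub>F x in nhds (1, y0). fst x > (0::real)"
    by (rule eventually_fst_pos)
  then have ev: "\<forall>\<^sub>F x in nhds (1, y0). ?\<Phi> x = qhom \<kappa> \<gamma> g x"
    by eventually_elim (rule eq)
  have smq: "smooth_near (1, y0) (qhom \<kappa> \<gamma> g)" using g by (intro smooth_near_qhom) auto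
  have "hessian_det ?\<Phi> (1, y0) = hessian_det (qhom \<kappa> \<gamma> g) (1, y0)"
    by (rule hessian_det_add_affine[OF smq, of _ 0 0 0]) (use ev in simp)
  also have "\<dots> = hess1 \<kappa> \<gamma> g y0" using g by (simp add: hessian_det_qhom)
  finally have "hess1 \<kappa> \<gamma> g y0 = hessian_det ?\<Phi> (1, y0)" by simp
  also have "\<dots> = 0"
    using hessian_det_affine_compose[OF T(1), of 0 "(1, y0)" \<phi>] T(3) \<phi> h by simp
  finally show "admits_nf \<gamma> y0 ?\<Phi>" by (rule qhom_normal_form[OF \<gamma> g ev _ ft])
qed (use that in auto)

text \<open>At fixed second coordinate \<open>y0\<close> the slope
  \<open>y0 (t / s)^(-\<gamma>)\<close> equals \<open>y0\<close> for \<open>t = s\<close>, so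
  flatness in the slope passes to flatness in \<open>t\<close>. This turns finite type along the
  axis \<open>b\<close> into a condition on \<open>qpart1\<close>.\<close>

lemma flat_at_dilated_slope:
  assumes s: "s \<noteq> 0" and h: "flat_at h y0" "smooth_near y0 h"
    and K: "\<forall>\<^sub>F t in nhds s. K t = c * qhom \<kappa> \<gamma> h (t / s, y0)"
  shows "flat_at K s"
proof -
  have sm: "smooth_near s (\<lambda>t. t / s)" using s by (intro smooth)
  have smq: "smooth_near s (\<lambda>t. y0 * (t / s) powr (- \<gamma>))" using s by (intro smooth sm) auto
  have "flat_at (\<lambda>t. h (y0 * (t / s) powr (- \<gamma>)) * (c * (t / s) powr \<kappa>)) s"
    by (rule flat_at_compose_mult) (use smq h s sm in \<open>auto intro!: smooth\<close>)
  moreover have "\<forall>\<^sub>F t in nhds s. h (y0 * (t / s) powr (- \<gamma>)) * (c * (t / s) powr \<kappa>) = K t"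
    using K by eventually_elim (simp add: qhom_def)
  ultimately show ?thesis by (rule flat_at_transfer)
qed

lemma second_partial_deriv_dilated:
  fixes T :: "real \<times> real \<Rightarrow> real \<times> real"
  assumes T: "linear T" "T (1, 0) = s *\<^sub>R b" and b: "b = (1, 0) \<or> b = (0, 1)" and s: "s \<noteq> 0"
    and eq: "\<And>x. fst x > 0 \<Longrightarrow> \<phi> (T x) = qhom \<kappa> \<gamma> g x" and g: "\<And>y. smooth_near y g"
    and x: "fst x > 0" and \<phi>: "smooth_near (T x) \<phi>"
  shows "partial_deriv b (partial_deriv b \<phi>) (T x) = inverse (s\<^sup>2) * qhom (\<kappa> - 2) \<gamma> (qpart1 \<kappa> \<gamma> g) x"
proof -
  have chain: "\<partial>\<^sub>1 (\<lambda>x. f (T x)) x = s * partial_deriv b f (T x)" if "smooth_near (T x) f" for f x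
    using partial_deriv_affine_compose[OF T(1), of 0 x f "(1, 0)"] that b T(2) by auto
  have "isCont T x" using isCont_linear_plane[OF T(1), where v = 0 and x = x] by simp
  from eventually_nhds_compose[OF this smooth_near_eventually[OF \<phi>]]
  have "\<forall>\<^sub>F x in nhds x. \<partial>\<^sub>1 (\<lambda>x. \<phi> (T x)) x = s * partial_deriv b \<phi> (T x)"
    by eventually_elim (rule chain)
  from partial_deriv_cong[OF this, of "(1, 0)"]
  have "\<partial>\<^sub>1 (\<partial>\<^sub>1 (\<lambda>x. \<phi> (T x))) x = \<partial>\<^sub>1 (\<lambda>x. s * partial_deriv b \<phi> (T x)) x" .
  also have "\<dots> = s * (s * partial_deriv b (partial_deriv b \<phi>) (T x))"
  proof -
    have sb: "smooth_near (T x) (partial_deriv b \<phi>)" using b \<phi> by (auto intro: smooth)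
    have "smooth_near x (\<lambda>x. partial_deriv b \<phi> (T x))"
      using smooth_near_affine_compose[OF T(1), of 0 x "partial_deriv b \<phi>"] sb by simp
    then show ?thesis
      using chain[OF sb] by (simp add: partial_deriv_cmult smooth_near_differentiable)
  qed
  finally have "\<partial>\<^sub>1 (\<partial>\<^sub>1 (\<lambda>x. \<phi> (T x))) x = s\<^sup>2 * partial_deriv b (partial_deriv b \<phi>) (T x)"
    by (simp add: power2_eq_square)
  moreover have "\<forall>\<^sub>F x in nhds x. \<phi> (T x) = qhom \<kappa> \<gamma> g x"
    using eventually_qhom[where \<gamma> = \<gamma>, OF x g] by eventually_elim (simp add: eq)
  from partial_deriv_cong[OF eventually_partial_deriv_cong[OF this]]
  have "\<partial>\<^sub>1 (\<partial>\<^sub>1 (\<lambda>x. \<phi> (T x))) x = qhom (\<kappa> - 2) \<gamma> (qpart1 \<kappa> \<gamma> g) x"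
    using second_partial_deriv_qhom(3)[OF x g] by simp
  ultimately show ?thesis using s by (simp add: field_simps)
qed

lemma eventually_divide_pos: "s \<noteq> 0 \<Longrightarrow> \<forall>\<^sub>F t in nhds s. t / s > (0::real)"
  by (rule eventually_nhds_compose[of s "\<lambda>t. t / s"])
    (use eventually_nhds_in_open[of "{0<..}" "1::real"] in \<open>auto intro!: continuous_intros\<close>)

text \<open>Here \<open>b\<close> is the direction of an axis along which \<open>v\<close> does not vanish, and \<open>b'\<close> is that of the other axis.\<close>

lemma normal_form_exists_axis:
  fixes b b' :: "real \<times> real"
  assumes bb: "b = (1, 0) \<and> b' = (0, 1) \<or> b = (0, 1) \<and> b' = (1, 0)"
    and \<alpha>: "\<alpha> > 0" "\<beta> > 0" and s: "s \<noteq> 0" and v: "v = s *\<^sub>R b + y0 *\<^sub>R b'"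
    and smx: "\<And>x. x \<noteq> 0 \<Longrightarrow> smooth_near x \<phi>"
    and hom: "\<And>y r. r > 0 \<Longrightarrow>
      \<phi> ((r powr \<alpha> * s) *\<^sub>R b + (r powr \<beta> * y) *\<^sub>R b') = r powr \<rho> * \<phi> (s *\<^sub>R b + y *\<^sub>R b')"
    and curve: "homogeneity_curve \<alpha>\<^sub>1 \<alpha>\<^sub>2 v = {(r powr \<alpha> * s) *\<^sub>R b + (r powr \<beta> * y0) *\<^sub>R b' | r. r > 0}"
    and ft: "finite_type_at (\<lambda>t. partial_deriv b (partial_deriv b \<phi>) (t *\<^sub>R b + y0 *\<^sub>R b')) s \<or>
      finite_type_at (\<lambda>t. partial_deriv b' (partial_deriv b' \<phi>) (s *\<^sub>R b + t *\<^sub>R b')) y0"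
    and h: "hessian_det \<phi> v = 0"
  obtains n L where "linear L" "bij L" "has_normal_form n \<alpha>\<^sub>1 \<alpha>\<^sub>2 \<phi> v L" "\<alpha> = \<beta> \<Longrightarrow> n \<in> {NF_i, NF_ii}"
proof -
  \<comment> \<open>Reparametrising the dilations by \<open>u = r^\<alpha>\<close> turns the weights
    into 1 and \<gamma> and the degree into \<kappa>.\<close>
  define \<kappa> where "\<kappa> = \<rho> / \<alpha>"
  define \<gamma> where "\<gamma> = \<beta> / \<alpha>"
  \<comment> \<open>The factor \<open>s\<close>, which may be negative, lets \<open>v\<close>
    correspond to \<open>(1, y0)\<close> in the half plane \<open>x1 > 0\<close>.\<close>
  define T where "T x = (s * fst x) *\<^sub>R b + snd x *\<^sub>R b'" for x :: "real \<times> real"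
  define g where "g y = \<phi> (s *\<^sub>R b + y *\<^sub>R b')" for y
  have inj: "x *\<^sub>R b + y *\<^sub>R b' = x' *\<^sub>R b + y' *\<^sub>R b' \<longleftrightarrow> x = x' \<and> y = y'" for x y x' y'
    using bb by auto
  have nz: "x *\<^sub>R b + y *\<^sub>R b' \<noteq> 0" if "x \<noteq> 0" for x y
    using inj[of x y 0 0] that by simp
  have linT: "linear T"
    unfolding T_def by (auto intro!: linearI simp: algebra_simps)
  have "inj T"
    using s bb by (auto intro!: injI simp: T_def prod_eq_iff)
  then have T: "linear T" "bij T" "T (1, y0) = v"
    using linT linear_injective_imp_surjective[OF linT] by (auto simp: bij_def T_def v)
  have \<phi>: "smooth_near v \<phi>" using smx nz[OF s] by (simp add: v)
  have sma: "smooth_near (s *\<^sub>R b + t *\<^sub>R b') \<phi>" for t using smx nz[OF s] .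
  have g: "smooth_near y g" for y
    unfolding g_def by (rule smooth_near_compose) (use sma in \<open>auto simp: inner_add_left intro!: smooth\<close>)
  have pw: "(u powr (1 / \<alpha>)) powr \<alpha> = u" "(u powr (1 / \<alpha>)) powr \<beta> = u powr \<gamma>"
    "(u powr (1 / \<alpha>)) powr \<rho> = u powr \<kappa>" if "u > 0" for u
    using that \<alpha> by (auto simp: powr_powr \<kappa>_def \<gamma>_def)
  have slope: "fst x powr \<gamma> * qslope \<gamma> x = snd x" if "fst x > 0" for x
    using that by (simp add: powr_minus)
  have eq: "\<phi> (T x) = qhom \<kappa> \<gamma> g x" if "fst x > 0" for x
    using hom[of "fst x powr (1 / \<alpha>)" "qslope \<gamma> x"] that
    unfolding pw[OF that] slope[OF that] by (simp add: T_def qhom_def g_def mult.commute)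
  have curve: "T x \<in> homogeneity_curve \<alpha>\<^sub>1 \<alpha>\<^sub>2 v \<longleftrightarrow> qslope \<gamma> x = y0" if x: "fst x > 0" for x
  proof -
    have "T x \<in> homogeneity_curve \<alpha>\<^sub>1 \<alpha>\<^sub>2 v \<longleftrightarrow> (\<exists>r>0. fst x = r powr \<alpha> \<and> snd x = r powr \<beta> * y0)"
      using s by (auto simp: curve T_def inj)
    also have "\<dots> \<longleftrightarrow> snd x = fst x powr \<gamma> * y0"
      using \<alpha> x pw[OF x] by (auto simp: powr_powr \<gamma>_def intro!: exI[of _ "fst x powr (1 / \<alpha>)"])
    also have "\<dots> \<longleftrightarrow> qslope \<gamma> x = y0"
      using x by (auto simp: powr_minus field_simps)
    finally show ?thesis .
  qed
  have D2: "\<D> (\<D> g) = (\<lambda>t. partial_deriv b' (partial_deriv b' \<phi>) (s *\<^sub>R b + t *\<^sub>R b'))"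
  proof -
    have D: "\<D> (\<lambda>y. f (s *\<^sub>R b + y *\<^sub>R b')) t = partial_deriv b' f (s *\<^sub>R b + t *\<^sub>R b')"
      if "smooth_near (s *\<^sub>R b + t *\<^sub>R b') f" for f t
    proof -
      have "((\<lambda>y. s *\<^sub>R b + y *\<^sub>R b') has_derivative (\<lambda>h. h *\<^sub>R b')) (at t)" by (auto intro!: derivative_eq_intros)
      from partial_deriv_eq[OF has_derivative_compose[OF this has_derivative_partial_plane[OF that]], of 1]
      show ?thesis using bb by auto
    qed
    have Dg: "\<D> g = (\<lambda>t. partial_deriv b' \<phi> (s *\<^sub>R b + t *\<^sub>R b'))"
      unfolding g_def[abs_def] by (rule ext) (rule D[OF sma])
    have "b' \<in> Basis" using bb Basis_plane by auto
    then show ?thesis unfolding Dg by (intro ext D smooth_near_partial sma)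
  qed
  have D1: "\<forall>\<^sub>F t in nhds s. partial_deriv b (partial_deriv b \<phi>) (t *\<^sub>R b + y0 *\<^sub>R b') =
      inverse (s\<^sup>2) * qhom (\<kappa> - 2) \<gamma> (qpart1 \<kappa> \<gamma> g) (t / s, y0)"
    using eventually_divide_pos[OF s]
  proof eventually_elim
    case (elim t)
    have "T (t / s, y0) = t *\<^sub>R b + y0 *\<^sub>R b'" using s by (simp add: T_def)
    moreover have "t *\<^sub>R b + y0 *\<^sub>R b' \<noteq> 0" using elim by (intro nz) auto
    ultimately show ?case
      using second_partial_deriv_dilated[OF linT _ _ s eq g, of b "(t / s, y0)"] elim smx bb
      by (auto simp: T_def)
  qed
  have ft': "\<not> (flat_at (\<D> (\<D> g)) y0 \<and> flat_at (qpart1 \<kappa> \<gamma> g) y0)"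
  proof (rule notI, elim conjE)
    assume fl: "flat_at (\<D> (\<D> g)) y0" "flat_at (qpart1 \<kappa> \<gamma> g) y0"
    have "smooth_near y0 (qpart1 \<kappa> \<gamma> g)" unfolding qpart1_def by (intro smooth g)
    from flat_at_dilated_slope[OF s fl(2) this D1] fl(1) ft show False
      by (simp add: D2 flat_at_def)
  qed
  have "\<gamma> > 0" using \<alpha> by (simp add: \<gamma>_def)
  from normal_form_exists_coords[OF this T \<phi> g eq curve h ft']
  obtain n L where n: "linear L" "bij L" "has_normal_form n \<alpha>\<^sub>1 \<alpha>\<^sub>2 \<phi> v L" "\<gamma> = 1 \<Longrightarrow> n \<in> {NF_i, NF_ii}"
    by blast
  show ?thesis by (rule that[OF n(1-3)], rule n(4)) (use \<alpha> in \<open>simp add: \<gamma>_def\<close>)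
qed

lemma normal_form_exists:
  assumes \<alpha>: "\<alpha>\<^sub>1 > 0" "\<alpha>\<^sub>2 > 0" and sm: "smooth_on (- {0}) \<phi>" and hom: "mixed_homogeneous \<alpha>\<^sub>1 \<alpha>\<^sub>2 \<rho> \<phi>"
    and ft: "finite_type_at (\<lambda>t. \<partial>\<^sub>1 (\<partial>\<^sub>1 \<phi>) (t, snd v)) (fst v) \<or> finite_type_at (\<lambda>t. \<partial>\<^sub>2 (\<partial>\<^sub>2 \<phi>) (fst v, t)) (snd v)"
    and v: "v \<noteq> 0" and h: "hessian_det \<phi> v = 0"
  obtains n L where "linear L" "bij L" "has_normal_form n \<alpha>\<^sub>1 \<alpha>\<^sub>2 \<phi> v L" "\<alpha>\<^sub>1 = \<alpha>\<^sub>2 \<Longrightarrow> n \<in> {NF_i, NF_ii}"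
proof -
  have smx: "smooth_near x \<phi>" if "x \<noteq> 0" for x
    using smooth_on_smooth_near[OF sm, of x] that by (simp add: open_Compl)
  have hom': "\<phi> (r powr \<alpha>\<^sub>1 * x, r powr \<alpha>\<^sub>2 * y) = r powr \<rho> * \<phi> (x, y)" if "r > 0" "x \<noteq> 0 \<or> y \<noteq> 0" for r x y
    using hom that unfolding mixed_homogeneous_def by blast
  have "fst v \<noteq> 0 \<or> snd v \<noteq> 0" using v by (auto simp: prod_eq_iff)
  then show ?thesis
  proof
    assume "fst v \<noteq> 0"
    from normal_form_exists_axis[of "(1, 0)" "(0, 1)" \<alpha>\<^sub>1 \<alpha>\<^sub>2 "fst v" v "snd v" \<phi> \<rho> \<alpha>\<^sub>1 \<alpha>\<^sub>2, OF _ \<alpha> this _ smx]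
    show ?thesis using that hom' ft h \<open>fst v \<noteq> 0\<close> by (simp add: homogeneity_curve_def) blast
  next
    assume "snd v \<noteq> 0"
    from normal_form_exists_axis[of "(0, 1)" "(1, 0)" \<alpha>\<^sub>2 \<alpha>\<^sub>1 "snd v" v "fst v" \<phi> \<rho> \<alpha>\<^sub>1 \<alpha>\<^sub>2, OF _ \<alpha>(2,1) this _ smx]
    show ?thesis using that hom' ft h \<open>snd v \<noteq> 0\<close> by (simp add: homogeneity_curve_def) blast
  qed
qed

section \<open>Uniqueness of the normal form\<close>

text \<open>The device for dividing identities by powers of \<open>t\<close>: cancel for
  \<open>t \<noteq> 0\<close>, then let \<open>t\<close> tend to 0.\<close>

lemma isCont_zero_limit:
  fixes f :: "real \<Rightarrow> real"
  assumes "isCont f 0" "\<forall>\<^sub>F t in at 0. f t = 0"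
  shows "f 0 = 0"
proof -
  have "(f \<longlongrightarrow> f 0) (at 0)" using assms(1) by (simp add: isCont_def)
  moreover have "(f \<longlongrightarrow> 0) (at 0)" using assms(2) by (simp add: tendsto_eventually)
  ultimately show ?thesis by (rule tendsto_unique[OF at_neq_bot])
qed

definition on_root :: "(real \<Rightarrow> real) \<Rightarrow> real \<times> real \<Rightarrow> bool"
  where "on_root \<psi> X \<longleftrightarrow> snd X = (fst X)\<^sup>2 * \<psi> (fst X)"

lemma isCont_root_point: "isCont \<psi> 0 \<Longrightarrow> isCont (\<lambda>t::real. (t, t\<^sup>2 * \<psi> t)) 0"
  by (intro continuous_intros)

lemma eventually_root_point:
  assumes "isCont \<psi> 0" "\<forall>\<^sub>F X in nhds (0 :: real \<times> real). Q X"
  shows "\<forall>\<^sub>F t in nhds 0. Q (t, t\<^sup>2 * \<psi> t)"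
  by (rule eventually_nhds_compose[OF isCont_root_point[OF assms(1)]])
    (use assms(2) in \<open>simp add: zero_prod_def\<close>)

lemma eventually_at_nhds: "\<forall>\<^sub>F t in nhds x. Q t \<Longrightarrow> \<forall>\<^sub>F t in at x. Q t \<and> t \<noteq> x"
  by (auto simp: eventually_at_filter elim: eventually_mono)

text \<open>Insert the curve \<open>(t, t\<^sup>2 * \<psi>' t)\<close> and compare coefficients:
  order one shows that the first axis, tangent to both roots, is preserved; order two relates the
  curvatures.\<close>

lemma root_linear_image:
  fixes M :: "real \<times> real \<Rightarrow> real \<times> real"
  assumes M: "linear M" and \<psi>: "isCont \<psi> 0" "isCont \<psi>' 0"
    and root: "\<forall>\<^sub>F X in nhds 0. on_root \<psi>' X \<longrightarrow> on_root \<psi> (M X)"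
  shows "snd (M (1, 0)) = 0" "snd (M (0, 1)) * \<psi>' 0 = (fst (M (1, 0)))\<^sup>2 * \<psi> 0"
proof -
  define a where "a = fst (M (1, 0))"
  define b where "b = fst (M (0, 1))"
  define e where "e = snd (M (1, 0))"
  define d where "d = snd (M (0, 1))"
  have M1: "fst (M X) = fst X * a + snd X * b" and M2: "snd (M X) = fst X * e + snd X * d" for X
    unfolding a_def b_def e_def d_def by (rule linear_plane_fst[OF M], rule linear_plane_snd[OF M])
  let ?u = "\<lambda>t. t * a + t\<^sup>2 * \<psi>' t * b"
  let ?k = "\<lambda>t. (a + t * \<psi>' t * b)\<^sup>2 * \<psi> (?u t)"
  have ev: "\<forall>\<^sub>F t in at 0. (t * e + t\<^sup>2 * \<psi>' t * d = (?u t)\<^sup>2 * \<psi> (?u t)) \<and> t \<noteq> 0"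
    using eventually_at_nhds[OF eventually_root_point[OF \<psi>(2) root]]
    by eventually_elim (simp add: on_root_def M1 M2)
  have cu: "isCont ?u 0" using \<psi> by (intro continuous_intros)
  have c\<psi>: "isCont (\<lambda>t. \<psi> (?u t)) 0" by (rule isCont_o2[OF cu]) (use \<psi> in simp)
  have "(\<lambda>t. e + t * \<psi>' t * d - t * ?k t) 0 = 0"
  proof (rule isCont_zero_limit)
    show "isCont (\<lambda>t. e + t * \<psi>' t * d - t * ?k t) 0" using \<psi> c\<psi> by (intro continuous_intros)
    show "\<forall>\<^sub>F t in at 0. e + t * \<psi>' t * d - t * ?k t = 0"
      using ev
    proof eventually_elim
      case (elim t)
      have "t * (e + t * \<psi>' t * d - t * ?k t) = 0" using elim by algebra
      then show ?case using elim by simp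
    qed
  qed
  then have e0: "e = 0" by simp
  then show "snd (M (1, 0)) = 0" by (simp add: e_def)
  have "(\<lambda>t. \<psi>' t * d - ?k t) 0 = 0"
  proof (rule isCont_zero_limit)
    show "isCont (\<lambda>t. \<psi>' t * d - ?k t) 0" using \<psi> c\<psi> by (intro continuous_intros)
    show "\<forall>\<^sub>F t in at 0. \<psi>' t * d - ?k t = 0"
      using ev
    proof eventually_elim
      case (elim t)
      have "t\<^sup>2 * (\<psi>' t * d - ?k t) = 0" using elim e0 by algebra
      then show ?case using elim by simp
    qed
  qed
  then show "snd (M (0, 1)) * \<psi>' 0 = (fst (M (1, 0)))\<^sup>2 * \<psi> 0"
    by (simp add: mult.commute a_def d_def)
qed

text \<open>Common shape of (ii) to (v). The exponent is lowered to 3, the least \<open>k\<close>,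
  to make forms with different \<open>k\<close> comparable.\<close>

definition tangential_form :: "(real \<times> real \<Rightarrow> real) \<Rightarrow> (real \<Rightarrow> real) \<Rightarrow> (real \<times> real \<Rightarrow> real) \<Rightarrow> bool"
  where "tangential_form F \<psi> r \<longleftrightarrow> smooth_nonzero_near 0 r \<and> (\<exists>R. smooth_near 0 R \<and>
    (\<forall>\<^sub>F X in nhds 0. F X = (fst X)\<^sup>2 * r X + (snd X - (fst X)\<^sup>2 * \<psi> (fst X)) ^ 3 * R X))"

text \<open>On the root \<open>F\<close> equals \<open>x1\<^sup>2 r\<close>, which is nonzero for
  small \<open>x1 \<noteq> 0\<close>.\<close>

lemma tangential_form_nonzero_on_root:
  assumes "tangential_form F \<psi> r" "isCont \<psi> 0"
  shows "\<not> (\<forall>\<^sub>F X in nhds 0. on_root \<psi> X \<longrightarrow> F X = 0)"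
proof
  assume z: "\<forall>\<^sub>F X in nhds 0. on_root \<psi> X \<longrightarrow> F X = 0"
  obtain R where r: "smooth_near 0 r" "r 0 \<noteq> 0"
    and F: "\<forall>\<^sub>F X in nhds 0. F X = (fst X)\<^sup>2 * r X + (snd X - (fst X)\<^sup>2 * \<psi> (fst X)) ^ 3 * R X"
    using assms(1) by (auto simp: tangential_form_def smooth_nonzero_near_def)
  let ?f = "\<lambda>t. r (t, t\<^sup>2 * \<psi> t)"
  have "?f 0 = 0"
  proof (rule isCont_zero_limit[where f = ?f])
    show "isCont ?f 0"
      by (rule isCont_o2[OF isCont_root_point[OF assms(2)]])
        (use smooth_near_isCont[OF r(1)] in \<open>simp add: zero_prod_def\<close>)
    show "\<forall>\<^sub>F t in at 0. ?f t = 0"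
      using eventually_at_nhds[OF eventually_root_point[OF assms(2) z]]
        eventually_at_nhds[OF eventually_root_point[OF assms(2) F]]
      by eventually_elim (auto simp: on_root_def)
  qed
  then show False using r by (simp add: zero_prod_def)
qed

text \<open>Comparing the terms of order two in \<open>x\<^sub>1\<close> transversally to the root shows that the derivative
  \<open>\<partial>\<^sub>2 r\<^sub>1(0)\<close> separates (ii) from (iii) and (iv) from (v).\<close>

lemma tangential_form_linear_image:
  fixes M :: "real \<times> real \<Rightarrow> real \<times> real"
  assumes M: "linear M" and \<psi>: "isCont \<psi> 0" "isCont \<psi>' 0"
    and root: "\<forall>\<^sub>F X in nhds 0. on_root \<psi>' X \<longrightarrow> on_root \<psi> (M X)"
    and F: "tangential_form F \<psi> (\<lambda>X. \<rho> (fst X))" and F': "tangential_form F' \<psi>' r'"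
    and FF': "\<forall>\<^sub>F X in nhds 0. F' X = F (M X)"
  shows "\<partial>\<^sub>2 r' 0 = 0"
proof -
  define a where "a = fst (M (1, 0))"
  define b where "b = fst (M (0, 1))"
  define d where "d = snd (M (0, 1))"
  have e: "snd (M (1, 0)) = 0" by (rule root_linear_image[OF M \<psi> root])
  have M1: "fst (M X) = fst X * a + snd X * b" and M2: "snd (M X) = snd X * d" for X
    using linear_plane_fst[OF M, of X] linear_plane_snd[OF M, of X] e unfolding a_def b_def d_def by auto
  obtain R where R: "smooth_near 0 R" and \<rho>: "smooth_near (0::real\<times>real) (\<lambda>X. \<rho> (fst X))" "\<rho> 0 \<noteq> 0"
    and F: "\<forall>\<^sub>F X in nhds 0. F X = (fst X)\<^sup>2 * \<rho> (fst X) + (snd X - (fst X)\<^sup>2 * \<psi> (fst X)) ^ 3 * R X"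
    using F by (auto simp: tangential_form_def smooth_nonzero_near_def)
  obtain R' where R': "smooth_near 0 R'" and r': "smooth_near 0 r'"
    and F': "\<forall>\<^sub>F X in nhds 0. F' X = (fst X)\<^sup>2 * r' X + (snd X - (fst X)\<^sup>2 * \<psi>' (fst X)) ^ 3 * R' X"
    using F' by (auto simp: tangential_form_def smooth_nonzero_near_def)
  have cM: "isCont M 0" using isCont_linear_plane[OF M, of 0 0] by simp
  have M0: "M 0 = 0" by (rule linear_0[OF M])
  have "\<forall>\<^sub>F X in nhds 0. F (M X) = (fst (M X))\<^sup>2 * \<rho> (fst (M X)) + (snd (M X) - (fst (M X))\<^sup>2 * \<psi> (fst (M X))) ^ 3 * R (M X)"
    by (rule eventually_nhds_compose[OF cM]) (use F in \<open>simp add: M0\<close>)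
  with F' FF' have eq: "\<forall>\<^sub>F X in nhds 0. (fst X)\<^sup>2 * r' X + (snd X - (fst X)\<^sup>2 * \<psi>' (fst X)) ^ 3 * R' X =
     (fst (M X))\<^sup>2 * \<rho> (fst (M X)) + (snd (M X) - (fst (M X))\<^sup>2 * \<psi> (fst (M X))) ^ 3 * R (M X)"
    by eventually_elim simp
  have smRM: "smooth_near 0 (\<lambda>X. R (M X))"
    using smooth_near_affine_compose[OF M, of 0 0 R] R by (simp add: M0)
  \<comment> \<open>On the line \<open>x1 = 0\<close> the left side of \<open>eq\<close> is of order
    \<open>t^3\<close>, whereas the right side contains
    \<open>(t * b)\<^sup>2 * \<rho> (t * b)\<close> with \<open>\<rho> 0 \<noteq> 0\<close>.\<close>
  have b0: "b = 0"
  proof -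
    have iso: "isCont (\<lambda>t::real. (0::real, t)) 0" by (intro continuous_intros)
    have comp: "isCont (\<lambda>t. f (0, t)) 0" if "smooth_near 0 f" for f :: "real \<times> real \<Rightarrow> real"
      by (rule isCont_o2[OF iso]) (use smooth_near_isCont[OF that] in \<open>simp add: zero_prod_def\<close>)
    have smM: "smooth_near 0 (\<lambda>X. \<rho> (fst (M X)))"
      using smooth_near_affine_compose[OF M, of 0 0 "\<lambda>X. \<rho> (fst X)"] \<rho> by (simp add: M0)
    have c\<rho>: "isCont (\<lambda>t. \<rho> (t * b)) 0" using comp[OF smM] by (simp add: M1)
    have c\<psi>: "isCont (\<lambda>t. \<psi> (t * b)) 0"
      by (rule isCont_o2[of _ "\<lambda>t. t * b"]) (use \<psi> in \<open>auto intro!: continuous_intros\<close>)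
    let ?f = "\<lambda>t. t * R' (0, t) - (b\<^sup>2 * \<rho> (t * b) + t * (d - t * b\<^sup>2 * \<psi> (t * b)) ^ 3 * R (M (0, t)))"
    have "?f 0 = 0"
    proof (rule isCont_zero_limit[where f = ?f])
      show "isCont ?f 0" using comp[OF R'] comp[OF smRM] c\<rho> c\<psi> by (intro continuous_intros)
      have "\<forall>\<^sub>F t in nhds 0. t ^ 3 * R' (0, t) =
          (t * b)\<^sup>2 * \<rho> (t * b) + (t * d - (t * b)\<^sup>2 * \<psi> (t * b)) ^ 3 * R (M (0, t))"
        using eventually_nhds_compose[OF iso, of "\<lambda>X. (fst X)\<^sup>2 * r' X + (snd X - (fst X)\<^sup>2 * \<psi>' (fst X)) ^ 3 * R' X =
     (fst (M X))\<^sup>2 * \<rho> (fst (M X)) + (snd (M X) - (fst (M X))\<^sup>2 * \<psi> (fst (M X))) ^ 3 * R (M X)"] eq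
        by (simp add: zero_prod_def M1 M2)
      from eventually_at_nhds[OF this] show "\<forall>\<^sub>F t in at 0. ?f t = 0"
      proof eventually_elim
        case (elim t)
        have "t\<^sup>2 * ?f t = 0" using elim by algebra
        then show ?case using elim by simp
      qed
    qed
    then show ?thesis using \<rho> by simp
  qed
  have ev: "\<forall>\<^sub>F X in nhds 0. smooth_near X r' \<and> smooth_near X R' \<and> smooth_near X (\<lambda>X. R (M X)) \<and>
      (\<forall>\<^sub>F X in nhds X. (fst X)\<^sup>2 * r' X + (snd X - (fst X)\<^sup>2 * \<psi>' (fst X)) ^ 3 * R' X =
     (fst (M X))\<^sup>2 * \<rho> (fst (M X)) + (snd (M X) - (fst (M X))\<^sup>2 * \<psi> (fst (M X))) ^ 3 * R (M X)) \<and>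
      (on_root \<psi>' X \<longrightarrow> on_root \<psi> (M X))"
    using smooth_near_eventually[OF r'] smooth_near_eventually[OF R'] smooth_near_eventually[OF smRM]
      eventually_eventually[THEN iffD2, OF eq] root
    by eventually_elim simp
  \<comment> \<open>For fixed \<open>t \<noteq> 0\<close> the cubic terms have zero derivative in
    \<open>s\<close> at the root point, and the other term \<open>a\<^sup>2 * \<rho> (t * a)\<close>
    does not depend on \<open>s\<close>. So \<open>\<partial>\<^sub>2 r'\<close> vanishes on the
    root off the origin, and by continuity at the origin.\<close>
  let ?g = "\<lambda>t. \<partial>\<^sub>2 r' (t, t\<^sup>2 * \<psi>' t)"
  have "?g 0 = 0"
  proof (rule isCont_zero_limit[where f = ?g])
    show "isCont ?g 0"
      by (rule isCont_o2[OF isCont_root_point[OF \<psi>(2)]])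
        (use smooth_near_isCont[OF smooth_near_partial_plane(2)[OF r']] in \<open>simp add: zero_prod_def\<close>)
    show "\<forall>\<^sub>F t in at 0. ?g t = 0"
      using eventually_at_nhds[OF eventually_root_point[OF \<psi>(2) ev]]
    proof eventually_elim
      case (elim t)
      define \<xi> where "\<xi> = t\<^sup>2 * \<psi>' t"
      \<comment> \<open>\<open>M\<close> maps root to root; along this vertical line the root
        function of \<psi> after \<open>M\<close> is therefore
        \<open>d * (s - \<xi>)\<close>.\<close>
      have \<xi>: "(t * a)\<^sup>2 * \<psi> (t * a) = \<xi> * d"
        using elim by (simp add: on_root_def M1 M2 b0 \<xi>_def)
      have sl: "isCont (\<lambda>s. (t, s)) \<xi>" by (intro continuous_intros)
      have "\<forall>\<^sub>F s in nhds \<xi>. t\<^sup>2 * r' (t, s) + (s - \<xi>) ^ 3 * R' (t, s) =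
          (t * a)\<^sup>2 * \<rho> (t * a) + (s * d - \<xi> * d) ^ 3 * R (M (t, s))"
        using eventually_nhds_compose[OF sl, of "\<lambda>X. (fst X)\<^sup>2 * r' X + (snd X - (fst X)\<^sup>2 * \<psi>' (fst X)) ^ 3 * R' X =
     (fst (M X))\<^sup>2 * \<rho> (fst (M X)) + (snd (M X) - (fst (M X))\<^sup>2 * \<psi> (fst (M X))) ^ 3 * R (M X)"] elim
        by (simp add: M1 M2 b0 \<xi> \<xi>_def [symmetric])
      then have near: "\<forall>\<^sub>F s in nhds \<xi>. r' (t, s) =
          a\<^sup>2 * \<rho> (t * a) + (s - \<xi>) ^ 3 * ((d ^ 3 * R (M (t, s)) - R' (t, s)) / t\<^sup>2)"
      proof eventually_elim
        case (elim s)
        have "t\<^sup>2 * r' (t, s) = t\<^sup>2 * (a\<^sup>2 * \<rho> (t * a)) + (s - \<xi>) ^ 3 * (d ^ 3 * R (M (t, s)) - R' (t, s))"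
          using elim by algebra
        then show ?case using \<open>_ \<and> t \<noteq> 0\<close> by (simp add: field_simps)
      qed
      have line: "((\<lambda>s. f (t, s)) has_real_derivative \<partial>\<^sub>2 f (t, \<xi>)) (at \<xi>)" if "smooth_near (t, \<xi>) f" for f
      proof -
        have "((\<lambda>s. (t, s)) has_derivative (\<lambda>h. (0, h))) (at \<xi>)" by (auto intro!: derivative_eq_intros)
        from has_derivative_compose[OF this has_derivative_partial_plane[OF that]]
        show ?thesis by (simp add: has_field_derivative_def mult.commute[of _ "\<partial>\<^sub>2 f (t, \<xi>)"])
      qed
      have sm: "smooth_near (t, \<xi>) r'" "smooth_near (t, \<xi>) R'" "smooth_near (t, \<xi>) (\<lambda>X. R (M X))"
        using elim by (auto simp: \<xi>_def)
      let ?W = "\<lambda>s. (d ^ 3 * R (M (t, s)) - R' (t, s)) / t\<^sup>2"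
      have "(?W has_real_derivative (d ^ 3 * \<partial>\<^sub>2 (\<lambda>X. R (M X)) (t, \<xi>) - \<partial>\<^sub>2 R' (t, \<xi>)) / t\<^sup>2) (at \<xi>)"
        using line[OF sm(2)] line[OF sm(3)] by (intro DERIV_cdivide DERIV_diff DERIV_cmult)
      note dW = this
      have "((\<lambda>s. (s - \<xi>) ^ 3) has_real_derivative 0) (at \<xi>)"
        by (auto intro!: derivative_eq_intros)
      from DERIV_mult[OF this dW]
      have d0: "((\<lambda>s. (s - \<xi>) ^ 3 * ?W s) has_real_derivative 0) (at \<xi>)"
        by simp
      have "\<D> (\<lambda>s. a\<^sup>2 * \<rho> (t * a) + (s - \<xi>) ^ 3 * ?W s) \<xi> = 0 + 0"
        by (rule partial_deriv_real[OF DERIV_add[OF DERIV_const d0]])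
      moreover have "\<D> (\<lambda>s. r' (t, s)) \<xi> = \<partial>\<^sub>2 r' (t, \<xi>)" by (rule partial_deriv_real[OF line[OF sm(1)]])
      ultimately show ?case using partial_deriv_cong[OF near, of 1] by (simp add: \<xi>_def)
    qed
  qed
  then show ?thesis by (simp add: zero_prod_def)
qed

section \<open>Invariants that tell the normal forms apart\<close>

lemma flat_hessian_phi_at_iff:
  assumes L: "linear L" "bij L" and \<phi>: "smooth_near v \<phi>"
  shows "flat_at (hessian_det (phi_at \<phi> v \<circ> L)) 0 \<longleftrightarrow> flat_at (hessian_det \<phi>) v"
proof -
  have smH: "smooth_near v (hessian_det \<phi>)"
    unfolding hessian_det_def by (intro smooth \<phi>)
  have L0: "L 0 = 0" using linear_0[OF L(1)] .
  have "\<forall>\<^sub>F X in nhds 0. smooth_near (v + L X) \<phi>"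
    by (rule eventually_nhds_compose[OF isCont_linear_plane[OF L(1)]])
      (use smooth_near_eventually[OF \<phi>] in \<open>simp add: L0\<close>)
  then have ev: "\<forall>\<^sub>F X in nhds 0. hessian_det (phi_at \<phi> v \<circ> L) X = hessian_det \<phi> (v + L X) * (ldet L)\<^sup>2"
    by eventually_elim (simp add: hessian_det_phi_at[OF L(1)])
  have smA: "smooth_near x (\<lambda>X. (v + L X) \<bullet> c)" for x c
    unfolding inner_prod_def by (simp, intro smooth L)
  have smA0: "smooth_near 0 (\<lambda>X. hessian_det \<phi> (v + L X))"
    by (rule smooth_near_affine_compose[OF L(1)]) (simp add: L0 smH)
  have "flat_at (\<lambda>X. hessian_det \<phi> (v + L X) * (ldet L)\<^sup>2) 0 \<longleftrightarrow> flat_at (hessian_det \<phi>) v"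
  proof
    assume "flat_at (hessian_det \<phi>) v"
    then show "flat_at (\<lambda>X. hessian_det \<phi> (v + L X) * (ldet L)\<^sup>2) 0"
      by (intro flat_at_compose_mult smA smooth) (simp_all add: L0 smH)
  next
    assume fl: "flat_at (\<lambda>X. hessian_det \<phi> (v + L X) * (ldet L)\<^sup>2) 0"
    define N where "N = inv L"
    have N: "linear N" unfolding N_def by (rule inj_linear_imp_inv_linear[OF L(1) bij_is_inj[OF L(2)]])
    have LN: "L (N x) = x" for x unfolding N_def using L(2) by (simp add: bij_is_surj surj_f_inv_f)
    let ?B = "\<lambda>x. N (x - v)"
    have "smooth_near v (\<lambda>x. ?B x \<bullet> c)" for c
      unfolding inner_prod_def by (simp add: linear_diff[OF N], intro smooth N)
    from flat_at_compose_mult[of v ?B "\<lambda>X. hessian_det \<phi> (v + L X) * (ldet L)\<^sup>2" "\<lambda>_. inverse ((ldet L)\<^sup>2)", OF this]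
      fl smA0
    have "flat_at (\<lambda>x. hessian_det \<phi> (v + L (?B x)) * (ldet L)\<^sup>2 * inverse ((ldet L)\<^sup>2)) v"
      by (simp add: linear_0[OF N] smooth)
    then show "flat_at (hessian_det \<phi>) v"
      using ldet_nonzero[OF L] by (simp add: LN mult.assoc)
  qed
  then show ?thesis using flat_at_cong[OF ev] by simp
qed

text \<open>On the line \<open>x1 = 0\<close> the root function is \<open>x2\<close>, so
  \<open>H\<close> restricts to a function of finite order \<open>m\<close>.\<close>

lemma root_power_not_flat:
  assumes q: "smooth_nonzero_near 0 q" and \<psi>: "smooth_near 0 \<psi>"
    and H: "\<forall>\<^sub>F X in nhds 0. H X = (snd X - (fst X)\<^sup>2 * \<psi> (fst X)) ^ m * q X"
  shows "\<not> flat_at H (0 :: real \<times> real)"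
proof
  assume "flat_at H 0"
  let ?P = "\<lambda>X :: real \<times> real. (snd X - (fst X)\<^sup>2 * \<psi> (fst X)) ^ m * q X"
  have fl: "flat_at ?P (0, 0)"
    using \<open>flat_at H 0\<close> flat_at_cong[OF H] by (simp add: zero_prod_def)
  have "smooth_near (0 :: real \<times> real) (\<lambda>X. \<psi> (fst X))"
    by (rule smooth_near_compose_real) (use \<psi> in \<open>auto intro: smooth\<close>)
  then have "smooth_near 0 ?P" using q by (auto simp: smooth_nonzero_near_def intro!: smooth)
  then have sm: "smooth_near (0, 0) ?P" by (simp add: zero_prod_def)
  have "flat_at (\<lambda>t. ?P (0, t)) 0"
    by (rule flat_at_compose[where A = "\<lambda>t. (0, t)"]) (use fl sm in \<open>auto intro: smooth simp: Basis_prod_def\<close>)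
  moreover have "smooth_nonzero_near 0 (\<lambda>t. q (0, t))"
    using smooth_near_compose_pair[of "\<lambda>t. 0" "0::real" "\<lambda>t. t" q] q
    by (simp add: smooth_nonzero_near_def smooth zero_prod_def)
  then have "ord_at 0 m (\<lambda>t. ?P (0, t))"
    unfolding ord_at_def by (intro exI[of _ "\<lambda>t. q (0, t)"]) simp
  ultimately show False using ord_at_not_flat by blast
qed

text \<open>This and the next two properties determine the case: (i) and (vi) are the vanishing ones
  and differ in \<open>straight\<close>; the other four are told apart by \<open>straight\<close>
  and \<open>cylindrical\<close>.\<close>

definition straight :: "nf_case \<Rightarrow> bool"
  where "straight n \<longleftrightarrow> n \<in> {NF_i, NF_ii, NF_iii}"

definition vanishing :: "nf_case \<Rightarrow> bool"
  where "vanishing n \<longleftrightarrow> n \<in> {NF_i, NF_vi}"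

definition cylindrical :: "nf_case \<Rightarrow> bool"
  where "cylindrical n \<longleftrightarrow> n \<in> {NF_ii, NF_iv}"

text \<open>The properties of the case are read off from \<open>F\<close> on the zero set of its
  Hessian determinant. That set is the root only if the Hessian determinant is not flat, whence the
  first clause.\<close>

definition nf_invariants :: "nf_case \<Rightarrow> (real \<times> real \<Rightarrow> real) \<Rightarrow> (real \<Rightarrow> real) \<Rightarrow> bool"
  where "nf_invariants n F \<psi> \<longleftrightarrow> \<not> flat_at (hessian_det F) 0 \<and> isCont \<psi> 0 \<and>
    (\<forall>\<^sub>F X in nhds 0. hessian_det F X = 0 \<longleftrightarrow> on_root \<psi> X) \<and> (straight n \<longleftrightarrow> \<psi> 0 = 0) \<and>
    (vanishing n \<longrightarrow> (\<forall>\<^sub>F X in nhds 0. on_root \<psi> X \<longrightarrow> F X = 0)) \<and>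
    (\<not> vanishing n \<longrightarrow> (\<exists>r. tangential_form F \<psi> r \<and>
      (if cylindrical n then \<exists>\<rho>. r = (\<lambda>X. \<rho> (fst X)) else \<partial>\<^sub>2 r 0 \<noteq> 0)))"

lemma hessian_root_invariants:
  assumes q: "smooth_nonzero_near 0 q" and \<psi>: "smooth_near 0 \<psi>" and m: "m > 0"
    and H: "\<forall>\<^sub>F X in nhds 0. H X = (snd X - (fst X)\<^sup>2 * \<psi> (fst X)) ^ m * q X"
  shows "\<not> flat_at H 0" "isCont \<psi> 0" "\<forall>\<^sub>F X in nhds 0. H X = 0 \<longleftrightarrow> on_root \<psi> X"
proof -
  show "\<not> flat_at H 0" by (rule root_power_not_flat[OF q \<psi> H])
  show "isCont \<psi> 0" by (rule smooth_near_isCont[OF \<psi>])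
  have "\<forall>\<^sub>F X in nhds 0. q X \<noteq> 0"
    by (rule eventually_nhds_compose[OF smooth_near_isCont])
      (use q eventually_nhds_in_open[of "- {0}" "q 0"] in \<open>auto simp: smooth_nonzero_near_def\<close>)
  with H show "\<forall>\<^sub>F X in nhds 0. H X = 0 \<longleftrightarrow> on_root \<psi> X"
    by eventually_elim (use m in \<open>auto simp: on_root_def\<close>)
qed

lemma tangential_formI:
  assumes k: "k \<ge> 3" and r: "smooth_nonzero_near 0 r" "smooth_nonzero_near 0 r\<^sub>2" and \<psi>: "smooth_near 0 \<psi>"
    and F: "\<forall>\<^sub>F X in nhds 0. F X = (fst X)\<^sup>2 * r X + (snd X - (fst X)\<^sup>2 * \<psi> (fst X)) ^ k * r\<^sub>2 X"
  shows "tangential_form F \<psi> r"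
proof -
  have "smooth_near (0 :: real \<times> real) (\<lambda>X. \<psi> (fst X))"
    by (rule smooth_near_compose_real) (use \<psi> in \<open>auto intro: smooth\<close>)
  then have "smooth_near 0 (\<lambda>X. (snd X - (fst X)\<^sup>2 * \<psi> (fst X)) ^ (k - 3) * r\<^sub>2 X)"
    using r by (auto simp: smooth_nonzero_near_def intro!: smooth)
  moreover have "(y::real) ^ k = y ^ 3 * y ^ (k - 3)" for y
    using k by (simp flip: power_add)
  then have "\<forall>\<^sub>F X in nhds 0. F X = (fst X)\<^sup>2 * r X + (snd X - (fst X)\<^sup>2 * \<psi> (fst X)) ^ 3 *
      ((snd X - (fst X)\<^sup>2 * \<psi> (fst X)) ^ (k - 3) * r\<^sub>2 X)"
    using F by (simp add: mult.assoc)
  ultimately show ?thesis using r unfolding tangential_form_def by blast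
qed

lemma geometric_jet_partial2:
  assumes "geometric_jet k r" "k \<ge> 3" "r 0 \<noteq> 0"
  shows "\<partial>\<^sub>2 r 0 \<noteq> 0"
  using assms unfolding geometric_jet_def by (auto dest!: bspec[of _ _ 1])

text \<open>Only (i) admits a flat Hessian determinant. Otherwise the Hessian determinant is a
  positive power of the root function times a nonvanishing one, with \<psi> = 0 in the straight
  cases.\<close>

lemma nf_invariants_exist:
  assumes nf: "has_normal_form n \<alpha>\<^sub>1 \<alpha>\<^sub>2 \<phi> v L" and nfl: "n = NF_i \<Longrightarrow> \<not> flat_at (hessian_det (phi_at \<phi> v \<circ> L)) 0"
  shows "\<exists>\<psi>. nf_invariants n (phi_at \<phi> v \<circ> L) \<psi>"
proof -
  let ?F = "phi_at \<phi> v \<circ> L"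
  have lift: "smooth_nonzero_near (0::real\<times>real) (\<lambda>X. r (fst X))" if "smooth_nonzero_near 0 r" for r
    using smooth_near_compose_real[of fst "0::real\<times>real" r] that by (simp add: smooth_nonzero_near_def smooth)
  note z = smooth_near_const[of "0::real" "0::real"]
  have inv: "nf_invariants n ?F \<psi>"
    if "smooth_nonzero_near 0 q" "smooth_near 0 \<psi>" "m > 0" "\<forall>\<^sub>F X in nhds 0. hessian_det ?F X = (snd X - (fst X)\<^sup>2 * \<psi> (fst X)) ^ m * q X"
      "straight n \<longleftrightarrow> \<psi> 0 = 0" "vanishing n \<Longrightarrow> (\<forall>\<^sub>F X in nhds 0. on_root \<psi> X \<longrightarrow> ?F X = 0)"
      "\<not> vanishing n \<Longrightarrow> (\<exists>r. tangential_form ?F \<psi> r \<and>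
      (if cylindrical n then \<exists>\<rho>. r = (\<lambda>X. \<rho> (fst X)) else \<partial>\<^sub>2 r 0 \<noteq> 0))" for q \<psi> m
    using hessian_root_invariants[OF that(1-4)] that(5-7) unfolding nf_invariants_def by blast
  have tang: "nf_invariants n ?F \<psi>"
    if "k \<ge> 3" "smooth_nonzero_near 0 r" "smooth_nonzero_near 0 r\<^sub>2" "smooth_nonzero_near 0 q" "smooth_near 0 \<psi>"
      "\<forall>\<^sub>F X in nhds 0. ?F X = (fst X)\<^sup>2 * r X + (snd X - (fst X)\<^sup>2 * \<psi> (fst X)) ^ k * r\<^sub>2 X"
      "\<forall>\<^sub>F X in nhds 0. hessian_det ?F X = (snd X - (fst X)\<^sup>2 * \<psi> (fst X)) ^ (k - 2) * q X"
      "straight n \<longleftrightarrow> \<psi> 0 = 0" "\<not> vanishing n" "cylindrical n \<Longrightarrow> \<exists>\<rho>. r = (\<lambda>X. \<rho> (fst X))"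
      "\<not> cylindrical n \<Longrightarrow> \<partial>\<^sub>2 r 0 \<noteq> 0" for k r r\<^sub>2 q \<psi>
  proof (rule inv[OF that(4,5) _ that(7,8)])
    show "\<exists>r. tangential_form ?F \<psi> r \<and> (if cylindrical n then \<exists>\<rho>. r = (\<lambda>X. \<rho> (fst X)) else \<partial>\<^sub>2 r 0 \<noteq> 0)"
      using tangential_formI[where F = ?F, OF that(1,2,3,5,6)] that(10,11) by (intro exI[of _ r]) auto
  qed (use that(1,9) in auto)
  show ?thesis
  proof (cases n)
    case NF_i
    then obtain k r \<phi>' k' q where "k \<ge> 2" "smooth_nonzero_near 0 q"
      "\<forall>\<^sub>F x in nhds 0. ?F x = snd x ^ k * r x + \<phi>' x"
      "\<forall>\<^sub>F x in nhds 0. hessian_det ?F x = snd x ^ (k' + 2 * k - 2) * q x" "\<forall>\<^sub>F x in nhds 0. \<phi>' x = 0"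
      using nf nfl by (auto simp: normal_form_i_def)
    note * = this
    have "\<forall>\<^sub>F X in nhds 0. on_root (\<lambda>_. 0) X \<longrightarrow> ?F X = 0"
      using *(3,5) by eventually_elim (use *(1) in \<open>simp add: on_root_def\<close>)
    then show ?thesis
      using *(1,4) NF_i by (intro exI[of _ "\<lambda>_. 0"] inv[OF *(2) z, of "k' + 2 * k - 2"])
        (auto simp: straight_def vanishing_def)
  next
    case NF_ii
    then obtain k r\<^sub>1 r\<^sub>2 q where *: "normal_form_ii ?F k r\<^sub>1 r\<^sub>2 q" using nf by auto
    have "nf_invariants n ?F (\<lambda>_. 0)"
      by (rule tang[of k "\<lambda>X. r\<^sub>1 (fst X)" r\<^sub>2 q])
        (use * NF_ii lift in
          \<open>auto simp: normal_form_ii_def smooth_nonzero_near_def smooth straight_def vanishing_def cylindrical_def\<close>)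
    then show ?thesis by blast
  next
    case NF_iii
    then obtain k r\<^sub>1 r\<^sub>2 q where *: "normal_form_iii ?F k r\<^sub>1 r\<^sub>2 q" using nf by auto
    have "nf_invariants n ?F (\<lambda>_. 0)"
      by (rule tang[of k r\<^sub>1 r\<^sub>2 q])
        (use * NF_iii geometric_jet_partial2[of k r\<^sub>1] in
          \<open>auto simp: normal_form_iii_def smooth_nonzero_near_def smooth straight_def vanishing_def cylindrical_def\<close>)
    then show ?thesis by blast
  next
    case NF_iv
    then obtain k \<psi> r\<^sub>1 r\<^sub>2 q where *: "normal_form_iv ?F k \<psi> r\<^sub>1 r\<^sub>2 q" using nf by auto
    have "nf_invariants n ?F \<psi>"
      by (rule tang[of k "\<lambda>X. r\<^sub>1 (fst X)" r\<^sub>2 q])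
        (use * NF_iv lift in
          \<open>auto simp: normal_form_iv_def smooth_nonzero_near_def smooth straight_def vanishing_def cylindrical_def\<close>)
    then show ?thesis by blast
  next
    case NF_v
    then obtain k \<psi> r\<^sub>1 r\<^sub>2 q where *: "normal_form_v ?F k \<psi> r\<^sub>1 r\<^sub>2 q" using nf by auto
    have "nf_invariants n ?F \<psi>"
      by (rule tang[of k r\<^sub>1 r\<^sub>2 q])
        (use * NF_v geometric_jet_partial2[of k r\<^sub>1] in
          \<open>auto simp: normal_form_v_def smooth_nonzero_near_def smooth straight_def vanishing_def cylindrical_def\<close>)
    then show ?thesis by blast
  next
    case NF_vi
    then obtain k \<psi> r q where *: "normal_form_vi ?F k \<psi> r q" using nf by auto
    then have \<psi>: "smooth_near 0 \<psi>" by (simp add: normal_form_vi_def smooth_nonzero_near_def)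
    have k: "k \<ge> 2" and F: "\<forall>\<^sub>F x in nhds 0. ?F x = (snd x - (fst x)\<^sup>2 * \<psi> (fst x)) ^ k * r x"
      using * by (auto simp: normal_form_vi_def)
    have "\<forall>\<^sub>F X in nhds 0. on_root \<psi> X \<longrightarrow> ?F X = 0"
      using F by eventually_elim (use k in \<open>simp add: on_root_def\<close>)
    then show ?thesis
      using * NF_vi by (intro exI[of _ \<psi>] inv[OF _ \<psi>, of q "2 * k - 3"])
        (auto simp: straight_def vanishing_def cylindrical_def normal_form_vi_def smooth_nonzero_near_def)
  qed
qed

text \<open>\<open>M = inv L \<circ> L'\<close> carries the second germ to the first, and with it
  the zero sets of the Hessian determinants. The last two claims are implications in one direction;
  exchanging \<open>L\<close> and \<open>L'\<close> gives the other.\<close>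

lemma nf_invariants_linear_image:
  assumes \<phi>: "smooth_near v \<phi>" and L: "linear L" "bij L" "linear L'" "bij L'"
    and inv: "nf_invariants n (phi_at \<phi> v \<circ> L) \<psi>" "nf_invariants n' (phi_at \<phi> v \<circ> L') \<psi>'"
  shows "straight n \<longleftrightarrow> straight n'" "vanishing n \<Longrightarrow> vanishing n'"
    "\<not> vanishing n \<Longrightarrow> \<not> vanishing n' \<Longrightarrow> cylindrical n \<Longrightarrow> cylindrical n'"
proof -
  let ?F = "phi_at \<phi> v \<circ> L" and ?F' = "phi_at \<phi> v \<circ> L'"
  define N where "N = inv L"
  have N: "linear N" unfolding N_def by (rule inj_linear_imp_inv_linear[OF L(1) bij_is_inj[OF L(2)]])
  have LN: "L (N x) = x" for x unfolding N_def using L(2) by (simp add: bij_is_surj surj_f_inv_f)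
  define M where "M = N \<circ> L'"
  have M: "linear M" unfolding M_def using N L(3) linear_compose by blast
  have bM: "bij M" unfolding M_def N_def using L(2,4) bij_comp bij_imp_bij_inv by blast
  have LM: "L (M X) = L' X" for X by (simp add: M_def LN)
  have FM: "?F' X = ?F (M X)" for X by (simp add: LM)
  have M0: "M 0 = 0" by (rule linear_0[OF M])
  have cM: "isCont M 0" using isCont_linear_plane[OF M, where v = 0 and x = 0] by simp
  have evM: "\<forall>\<^sub>F X in nhds 0. Q (M X)" if "\<forall>\<^sub>F X in nhds 0. Q X" for Q
    by (rule eventually_nhds_compose[OF cM]) (use that in \<open>simp add: M0\<close>)
  have "\<forall>\<^sub>F X in nhds 0. smooth_near (v + L' X) \<phi>"
    by (rule eventually_nhds_compose[OF isCont_linear_plane[OF L(3)]])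
      (use smooth_near_eventually[OF \<phi>] in \<open>simp add: linear_0[OF L(3)]\<close>)
  then have H: "\<forall>\<^sub>F X in nhds 0. hessian_det ?F' X = 0 \<longleftrightarrow> hessian_det ?F (M X) = 0"
  proof eventually_elim
    case (elim X)
    then show ?case
      using hessian_det_phi_at[OF L(1), of v "M X" \<phi>] hessian_det_phi_at[OF L(3), of v X \<phi>]
        ldet_nonzero[OF L(1,2)] ldet_nonzero[OF L(3,4)] by (simp add: LM)
  qed
  have Z: "\<forall>\<^sub>F X in nhds 0. hessian_det ?F X = 0 \<longleftrightarrow> on_root \<psi> X" "\<forall>\<^sub>F X in nhds 0. hessian_det ?F' X = 0 \<longleftrightarrow> on_root \<psi>' X"
    and c: "isCont \<psi> 0" "isCont \<psi>' 0"
    using inv by (simp_all add: nf_invariants_def)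
  have root: "\<forall>\<^sub>F X in nhds 0. on_root \<psi>' X \<longleftrightarrow> on_root \<psi> (M X)"
    using H evM[OF Z(1)] Z(2) by eventually_elim blast
  then have root': "\<forall>\<^sub>F X in nhds 0. on_root \<psi>' X \<longrightarrow> on_root \<psi> (M X)" by eventually_elim blast
  note lin = root_linear_image[OF M c root']
  have "fst (M (1, 0)) \<noteq> 0" "snd (M (0, 1)) \<noteq> 0"
    using ldet_nonzero[OF M bM] lin(1) by (auto simp: ldet_def)
  then have "\<psi> 0 = 0 \<longleftrightarrow> \<psi>' 0 = 0" using lin(2) by auto
  then show "straight n \<longleftrightarrow> straight n'" using inv by (simp add: nf_invariants_def)
  show "vanishing n'" if "vanishing n"
  proof (rule ccontr)
    assume "\<not> vanishing n'"
    then obtain r where r: "tangential_form ?F' \<psi>' r" using inv(2) by (auto simp: nf_invariants_def)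
    have "\<forall>\<^sub>F X in nhds 0. on_root \<psi> X \<longrightarrow> ?F X = 0" using inv(1) that by (simp add: nf_invariants_def)
    from evM[OF this] root have "\<forall>\<^sub>F X in nhds 0. on_root \<psi>' X \<longrightarrow> ?F' X = 0"
      by eventually_elim (simp only: FM)
    then show False using tangential_form_nonzero_on_root[OF r c(2)] by blast
  qed
  show "cylindrical n'" if nv: "\<not> vanishing n" "\<not> vanishing n'" "cylindrical n"
  proof (rule ccontr)
    assume "\<not> cylindrical n'"
    then obtain r' where r': "tangential_form ?F' \<psi>' r'" "\<partial>\<^sub>2 r' 0 \<noteq> 0"
      using inv(2) nv by (auto simp: nf_invariants_def)
    obtain \<rho> where "tangential_form ?F \<psi> (\<lambda>X. \<rho> (fst X))"
      using inv(1) nv by (auto simp: nf_invariants_def)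
    from tangential_form_linear_image[OF M c root' this r'(1)] r'(2) FM show False by simp
  qed
qed

text \<open>If the Hessian determinant of \<phi> is flat at \<open>v\<close>, both cases are (i);
  otherwise the three invariants agree.\<close>

lemma normal_form_unique:
  assumes \<phi>: "smooth_near v \<phi>" and L: "linear L" "bij L" "linear L'" "bij L'"
    and nf: "has_normal_form n \<alpha>\<^sub>1 \<alpha>\<^sub>2 \<phi> v L" "has_normal_form n' \<alpha>\<^sub>1 \<alpha>\<^sub>2 \<phi> v L'"
  shows "n = n'"
proof (cases "flat_at (hessian_det \<phi>) v")
  case True
  have "n = NF_i" if "linear L" "bij L" "has_normal_form n \<alpha>\<^sub>1 \<alpha>\<^sub>2 \<phi> v L" for n L
    using nf_invariants_exist[OF that(3)] flat_hessian_phi_at_iff[OF that(1,2) \<phi>] True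
    by (auto simp: nf_invariants_def)
  then show ?thesis using L nf by metis
next
  case False
  obtain \<psi> \<psi>' where inv: "nf_invariants n (phi_at \<phi> v \<circ> L) \<psi>" "nf_invariants n' (phi_at \<phi> v \<circ> L') \<psi>'"
    using nf_invariants_exist[OF nf(1)] nf_invariants_exist[OF nf(2)]
      flat_hessian_phi_at_iff[OF L(1,2) \<phi>] flat_hessian_phi_at_iff[OF L(3,4) \<phi>] False by metis
  have "straight n \<longleftrightarrow> straight n'" "vanishing n \<longleftrightarrow> vanishing n'"
    "\<not> vanishing n \<Longrightarrow> cylindrical n \<longleftrightarrow> cylindrical n'"
    using nf_invariants_linear_image[OF \<phi> L inv] nf_invariants_linear_image[OF \<phi> L(3,4,1,2) inv(2,1)] by blast+
  then show ?thesis
    by (cases n; cases n') (simp_all add: straight_def vanishing_def cylindrical_def)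
qed

theorem proposition1p4:
  fixes \<alpha>\<^sub>1 \<alpha>\<^sub>2 \<rho> :: real
    and \<phi> :: "real \<times> real \<Rightarrow> real"
    and v :: "real \<times> real"
  assumes "\<alpha>\<^sub>1 > 0" and "\<alpha>\<^sub>2 > 0"
    and "\<rho> \<in> {-1, 0, 1}"
    and "smooth_on (- {0}) \<phi>"
    and "mixed_homogeneous \<alpha>\<^sub>1 \<alpha>\<^sub>2 \<rho> \<phi>"
    and "\<And>x\<^sub>1 x\<^sub>2. (x\<^sub>1, x\<^sub>2) \<noteq> (0, 0) \<Longrightarrow> hessian_det \<phi> (x\<^sub>1, x\<^sub>2) = 0 \<Longrightarrow>
           finite_type_at (\<lambda>t. \<partial>\<^sub>1 (\<partial>\<^sub>1 \<phi>) (t, x\<^sub>2)) x\<^sub>1 \<or>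
           finite_type_at (\<lambda>t. \<partial>\<^sub>2 (\<partial>\<^sub>2 \<phi>) (x\<^sub>1, t)) x\<^sub>2"
    and "v \<noteq> 0"
    and "hessian_det \<phi> v = 0"
  shows "(\<exists>!n. \<exists>L. linear L \<and> bij L \<and> has_normal_form n \<alpha>\<^sub>1 \<alpha>\<^sub>2 \<phi> v L) \<and>
         ((\<forall>x. x \<noteq> 0 \<longrightarrow> \<not> flat_at (hessian_det \<phi>) x) \<longrightarrow>
            (\<forall>L. linear L \<longrightarrow> bij L \<longrightarrow>
               \<not> flat_at (hessian_det (phi_at \<phi> v \<circ> L)) 0 \<and>
               (\<forall>k r \<phi>'. normal_form_i (phi_at \<phi> v \<circ> L) k r \<phi>' \<longrightarrow>
                  (\<forall>\<^sub>F x in nhds 0. \<phi>' x = 0)))) \<and>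
         (\<alpha>\<^sub>1 = \<alpha>\<^sub>2 \<longrightarrow>
            (\<forall>n L. linear L \<longrightarrow> bij L \<longrightarrow> has_normal_form n \<alpha>\<^sub>1 \<alpha>\<^sub>2 \<phi> v L \<longrightarrow>
               n \<in> {NF_i, NF_ii}))"
proof -
  have \<phi>: "smooth_near v \<phi>"
    using smooth_on_smooth_near[OF assms(4), of v] assms(7) by (simp add: open_Compl)
  have ft: "finite_type_at (\<lambda>t. \<partial>\<^sub>1 (\<partial>\<^sub>1 \<phi>) (t, snd v)) (fst v) \<or>
      finite_type_at (\<lambda>t. \<partial>\<^sub>2 (\<partial>\<^sub>2 \<phi>) (fst v, t)) (snd v)"
    using assms(6)[of "fst v" "snd v"] assms(7,8) by (simp add: zero_prod_def)
  from normal_form_exists[OF assms(1,2,4,5) ft assms(7,8)]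
  obtain n L where nL: "linear L" "bij L" "has_normal_form n \<alpha>\<^sub>1 \<alpha>\<^sub>2 \<phi> v L" "\<alpha>\<^sub>1 = \<alpha>\<^sub>2 \<Longrightarrow> n \<in> {NF_i, NF_ii}"
    by blast
  have uniq: "n' = n" if "linear L'" "bij L'" "has_normal_form n' \<alpha>\<^sub>1 \<alpha>\<^sub>2 \<phi> v L'" for n' L'
    by (rule normal_form_unique[OF \<phi> that(1,2) nL(1,2) that(3) nL(3)])
  have "\<exists>!n. \<exists>L. linear L \<and> bij L \<and> has_normal_form n \<alpha>\<^sub>1 \<alpha>\<^sub>2 \<phi> v L"
    using nL uniq by blast
  moreover have "\<not> flat_at (hessian_det (phi_at \<phi> v \<circ> L)) 0 \<and>
      (\<forall>k r \<phi>'. normal_form_i (phi_at \<phi> v \<circ> L) k r \<phi>' \<longrightarrow> (\<forall>\<^sub>F x in nhds 0. \<phi>' x = 0))"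
    if "\<forall>x. x \<noteq> 0 \<longrightarrow> \<not> flat_at (hessian_det \<phi>) x" "linear L" "bij L" for L
  proof -
    have "\<not> flat_at (hessian_det (phi_at \<phi> v \<circ> L)) 0"
      using flat_hessian_phi_at_iff[OF that(2,3) \<phi>] that(1) assms(7) by blast
    then show ?thesis by (auto simp: normal_form_i_def)
  qed
  \<comment> \<open>Existence gives a case in this set for one \<open>L\<close>; uniqueness extends
    it to every other linear map.\<close>
  moreover have "n' \<in> {NF_i, NF_ii}"
    if "\<alpha>\<^sub>1 = \<alpha>\<^sub>2" "linear L'" "bij L'" "has_normal_form n' \<alpha>\<^sub>1 \<alpha>\<^sub>2 \<phi> v L'" for n' L'
    using uniq[OF that(2-4)] nL(4)[OF that(1)] by blast
  ultimately show ?thesis by blast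
qed

end
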